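(* Let $d\in\mathbb{N}$, $s\ge0$, $1\le p\le\infty$, $0<q\le\infty$, and $-\infty<b<\infty$. Assume that $l\in\mathbb{N}$ is such that $l>s/2$. Then $$\|f\|_{\mathbf{B}^{s,b}_{p,q}(\mathbb{R}^d)}\asymp\|f\|_{L_p(\mathbb{R}^d)}+\left(\int_0^1t^{-sq}(1-\log t)^{bq}\|f-B_{l,t}f\|_{L_p(\mathbb{R}^d)}^q\frac{dt}{t}\right)^{1/q}$$ (with the usual modification if $q=\infty$). The corresponding result for periodic spaces (on $\mathbb{T}$) also holds true.
   Context: For $1\le p\le\infty$, $0<q\le\infty$, $b\in\mathbb{R}$, $s\ge0$, $\mathbf{B}^{s,b}_{p,q}(\mathbb{R}^d)$ is the set of $f\in L_p(\mathbb{R}^d)$ with finite quasi-norm $\|f\|_{\mathbf{B}^{s,b}_{p,q}}=\|f\|_{L_p(\mathbb{R}^d)}+\left(\int_0^1(t^{-s}(1-\log t)^b\omega_k(f,t)_p)^q\frac{dt}{t}\right)^{1/q}$ (supremum over $0<t<1$ if $q=\infty$), where $k\in\mathbb{N}$, $k>s$, is fixed (different $k$ give equivalent quasi-norms), $\omega_k(f,t)_p=\sup_{|h|\le t}\|\Delta_h^kf\|_{L_p(\mathbb{R}^d)}$, $\Delta^1_hf(x)=f(x+h)-f(x)$, $\Delta_h^{k+1}=\Delta_h^1\Delta_h^k$. The periodic space $\mathbf{B}^{s,b}_{p,q}(\mathbb{T})$ is defined in the same way with $L_p(\mathbb{T})$-norms. Ball averages: for $t>0$ and locally integrable $f$, $B_tf(x)=\frac1{|B_t(x)|}\int_{B_t(x)}f(y)\,dy$,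 where $B_t(x)$ is the ball of radius $t$ centered at $x$ and $|B_t(x)|$ its Lebesgue measure, and for $l\in\mathbb{N}$ $$B_{l,t}f(x)=\frac{-2}{\binom{2l}{l}}\sum_{j=1}^l(-1)^j\binom{2l}{l-j}B_{jt}f(x).$$ In the periodic case $f$ is regarded as a periodic function on $\mathbb{R}$. The equivalence is for $f\in L_p$, with constants independent of $f$. *)

theory Defs
  imports "HOL-Analysis.Analysis" "HOL-Probability.Essential_Supremum"
begin

text \<open>
  Functions are complex-valued representatives of their almost-everywhere classes. All (quasi-)norms
  take values in the extended nonnegative reals, so that ``the norm is finite'' is an inequality
  rather than a side condition.
\<close>

text \<open>Power of an extended nonnegative real; used for exponents \<open>a > 0\<close> only.\<close>

definition epowr :: "ennreal \<Rightarrow> real \<Rightarrow> ennreal"  (infixr \<open>epowr\<close> 80) where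
  "x epowr a = (if x = \<infinity> then \<infinity> else ennreal (enn2real x powr a))"

definition Lp_norm :: "'a measure \<Rightarrow> ennreal \<Rightarrow> ('a \<Rightarrow> complex) \<Rightarrow> ennreal" where
  "Lp_norm M p f =
    (if p = \<infinity> then esssup M (\<lambda>x. ennreal (norm (f x)))
     else (\<integral>\<^sup>+ x. ennreal (norm (f x) powr enn2real p) \<partial>M) epowr (1 / enn2real p))"

definition Lp_space :: "'a measure \<Rightarrow> ennreal \<Rightarrow> ('a \<Rightarrow> complex) set" where
  "Lp_space M p = {f \<in> borel_measurable M. Lp_norm M p f < \<infinity>}"

text \<open>
  The circle is \<open>\<real> / 2\<pi>\<int>\<close>: functions on it are \<open>2\<pi>\<close>-periodic functions on the line, and norms are
  taken over one period.
\<close>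

abbreviation period_measure :: "real measure" where
  "period_measure \<equiv> lebesgue_on {0..<2 * pi}"

definition Lp_periodic :: "ennreal \<Rightarrow> (real \<Rightarrow> complex) set" where
  "Lp_periodic p = {f \<in> Lp_space period_measure p. periodic_fun_simple f (2 * pi)}"

definition forward_difference ::
    "'a::real_vector \<Rightarrow> ('a \<Rightarrow> complex) \<Rightarrow> 'a \<Rightarrow> complex" where
  "forward_difference h f = (\<lambda>x. f (x + h) - f x)"

text \<open>
  In the definitions below, the measure \<open>M\<close> only says where norms are taken: it is Lebesgue measure
  for the whole space and \<^const>\<open>period_measure\<close> for periodic functions. Translates and
  averages are always formed on the whole space.
\<close>

definition modulus_of_smoothness ::
    "'a::euclidean_space measure \<Rightarrow> nat \<Rightarrow> ennreal \<Rightarrow> ('a \<Rightarrow> complex) \<Rightarrow> real \<Rightarrow> ennreal" where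
  "modulus_of_smoothness M k p f t =
    (SUP h\<in>{h. norm h \<le> t}. Lp_norm M p ((forward_difference h ^^ k) f))"

definition ball_average ::
    "real \<Rightarrow> ('a::euclidean_space \<Rightarrow> complex) \<Rightarrow> 'a \<Rightarrow> complex" where
  "ball_average t f x =
    (1 / measure lebesgue (ball x t)) *\<^sub>R (LINT y:ball x t|lebesgue. f y)"

definition combined_ball_average ::
    "nat \<Rightarrow> real \<Rightarrow> ('a::euclidean_space \<Rightarrow> complex) \<Rightarrow> 'a \<Rightarrow> complex" where
  "combined_ball_average l t f x =
    (- 2 / real ((2 * l) choose l)) *\<^sub>R
      (\<Sum>j = 1..l. ((-1) ^ j * real ((2 * l) choose (l - j))) *\<^sub>R ball_average (real j * t) f x)"

text \<open>
  The quasi-norm \<open>(\<integral>\<^sub>0\<^sup>1 (t\<^sup>-\<^sup>s (1 - log t)\<^sup>b \<phi>(t))\<^sup>q dt/t)\<^sup>1\<^sup>/\<^sup>q\<close>, with the supremum over \<open>0 < t < 1\<close>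
  in place of the integral when \<open>q = \<infinity>\<close>.
\<close>

definition log_weighted_norm ::
    "real \<Rightarrow> real \<Rightarrow> ennreal \<Rightarrow> (real \<Rightarrow> ennreal) \<Rightarrow> ennreal" where
  "log_weighted_norm s b q \<phi> =
    (if q = \<infinity> then SUP t\<in>{0<..<1}. ennreal (t powr (- s) * (1 - ln t) powr b) * \<phi> t
     else (\<integral>\<^sup>+ t\<in>{0<..<1}.
             (ennreal (t powr (- s) * (1 - ln t) powr b) * \<phi> t) epowr enn2real q * ennreal (1 / t)
           \<partial>lborel) epowr (1 / enn2real q))"

definition besov_norm ::
    "'a::euclidean_space measure \<Rightarrow> nat \<Rightarrow> real \<Rightarrow> real \<Rightarrow> ennreal \<Rightarrow> ennreal
      \<Rightarrow> ('a \<Rightarrow> complex) \<Rightarrow> ennreal" where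
  "besov_norm M k s b p q f =
    Lp_norm M p f + log_weighted_norm s b q (modulus_of_smoothness M k p f)"

definition ball_average_norm ::
    "'a::euclidean_space measure \<Rightarrow> nat \<Rightarrow> real \<Rightarrow> real \<Rightarrow> ennreal \<Rightarrow> ennreal
      \<Rightarrow> ('a \<Rightarrow> complex) \<Rightarrow> ennreal" where
  "ball_average_norm M l s b p q f =
    Lp_norm M p f +
    log_weighted_norm s b q (\<lambda>t. Lp_norm M p (\<lambda>x. f x - combined_ball_average l t f x))"

text \<open>Two-sided estimate with constants independent of \<open>f\<close>; both sides may be infinite.\<close>

definition equivalent_on ::
    "'f set \<Rightarrow> ('f \<Rightarrow> ennreal) \<Rightarrow> ('f \<Rightarrow> ennreal) \<Rightarrow> bool" where
  "equivalent_on F N N' \<longleftrightarrow>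
    (\<exists>c C :: real. 0 < c \<and> 0 < C \<and>
      (\<forall>f\<in>F. ennreal c * N' f \<le> N f \<and> N f \<le> ennreal C * N' f))"

end

theory Submission
  imports Defs "HOL-Real_Asymp.Real_Asymp"
begin

text \<open>
  Write \<open>A\<^sub>t\<close> for the combined ball average. On the one hand \<open>f - A\<^sub>t f\<close> is an average of symmetric
  differences of order \<open>2l\<close>, so its norm \<open>D(t)\<close> is at most \<open>\<omega>\<^bsub>2l\<^esub>(f, t)\<close>; Marchaud's inequality changes the
  order of the modulus. On the other hand one difference of \<open>A\<^sub>t u\<close> with step \<open>h\<close> costs a factor
  \<open>O(|h|/t)\<close>, because a ball and its translate nearly coincide. Hence the \<open>k\<close>-fold iterate \<open>A\<^sub>t\<^sup>k f\<close> is smooth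
  of order \<open>k\<close> at scale \<open>t\<close> and differs from \<open>f\<close> by \<open>O(D(t))\<close>. Comparing the scales \<open>t\<close> and \<open>2t\<close>, with all
  operators commuting, gives \<open>\<phi>(t) \<le> 2\<^sup>-\<^sup>k \<phi>(2t) + O(D(t))\<close> for a quantity \<open>\<phi>\<close> that dominates
  \<open>\<omega>\<^sub>k(f, \<cdot>)\<close>, and such a recursion is summed by a Hardy-type inequality as soon as \<open>s < k\<close>. No Fourier
  multipliers are needed, which is why \<open>p = 1\<close> and \<open>p = \<infinity>\<close> are not special.
\<close>

section \<open>Powers of extended nonnegative reals and Hardy-type inequalities\<close>

text \<open>The kernel of a ball average is an indicator function, so its translates vary in L1 only
  at the rate |h|/t: one average supports one difference, and smoothness of order k takes k
  averages. The averages themselves need not contract; the gain 2^-k comes from comparing the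
  weights (t/|h|)^k at the scales t and 2t. Three obstacles shape the summation. Absorbing the
  recursion requires a weighted norm that is already finite, which is not assumed; but the recursion
  looks upward, from t to 2t, so it can be run on scales above some \<epsilon>, where a uniform
  bound gives finiteness and the resulting constants do not depend on \<epsilon>. The dominating
  quantity is a supremum over uncountably many steps h, so its measurability in t is not evident.
  Finally, the two-scale comparison also produces D(2t), which is absorbed by adding a multiple of D
  to the dominating quantity. For the line and the circle alike, the argument uses only that the
  norm is invariant under translations; averages are always taken on the whole space.\<close>

lemma epowr_ennreal [simp]: "0 \<le> x \<Longrightarrow> ennreal x epowr a = ennreal (x powr a)"
  by (simp add: epowr_def)

lemma epowr_zero [simp]: "0 epowr a = 0"
  by (simp add: epowr_def)

lemma epowr_top [simp]: "\<infinity> epowr a = \<infinity>" "top epowr a = top"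
  by (simp_all add: epowr_def)

lemma epowr_eq_top_iff: "x epowr a = top \<longleftrightarrow> x = top"
  by (simp add: epowr_def)

lemma epowr_mono:
  assumes "x \<le> y" "0 \<le> a"
  shows "x epowr a \<le> y epowr a"
proof (cases "y = top")
  case False
  with assms have "x \<noteq> top" by (auto simp: top_unique)
  with False assms show ?thesis
    by (auto simp: epowr_def intro!: ennreal_leI powr_mono2 enn2real_mono simp: less_top)
qed simp

lemma epowr_mult:
  assumes "0 < a"
  shows "(x * y) epowr a = x epowr a * y epowr a"
proof (cases "x = 0 \<or> y = 0")
  case False
  then show ?thesis
  proof (cases "x = top \<or> y = top")
    case True
    with False assms show ?thesis
      by (auto simp: ennreal_mult_top ennreal_top_mult epowr_def ennreal_mult_eq_top_iff enn2real_eq_0_iff)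
  next
    case False
    then show ?thesis
      by (cases x; cases y) (auto simp: ennreal_mult'[symmetric] powr_mult)
  qed
qed auto

lemma epowr_epowr: "(x epowr a) epowr b = x epowr (a * b)"
  by (cases x) (auto simp: powr_powr)

lemma epowr_one [simp]: "x epowr 1 = x"
  by (cases x) auto

lemma epowr_le_iff:
  assumes "0 < a"
  shows "x epowr a \<le> y epowr a \<longleftrightarrow> x \<le> y"
proof
  assume "x epowr a \<le> y epowr a"
  then have "(x epowr a) epowr (1 / a) \<le> (y epowr a) epowr (1 / a)"
    by (rule epowr_mono) (use assms in simp)
  moreover have "a * (1 / a) = 1" using assms by simp
  ultimately show "x \<le> y" by (simp only: epowr_epowr epowr_one)
next
  assume "x \<le> y"
  then show "x epowr a \<le> y epowr a" by (rule epowr_mono) (use assms in simp)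
qed

lemma epowr_inverse_le_iff:
  assumes "0 < a"
  shows "x epowr (1 / a) \<le> y \<longleftrightarrow> x \<le> y epowr a"
  using epowr_le_iff[of a "x epowr (1 / a)" y] assms by (simp add: epowr_epowr)

lemma borel_measurable_epowr [measurable]:
  assumes [measurable]: "f \<in> borel_measurable M"
  shows "(\<lambda>x. f x epowr a) \<in> borel_measurable M"
  unfolding epowr_def by measurable

text \<open>Either \<open>y\<close> is at most \<open>\<eta> * x\<close> or \<open>x\<close> is at
  most \<open>y / \<eta>\<close>, so one of the two terms dominates the sum. This covers
  \<open>a < 1\<close> as well as \<open>a \<ge> 1\<close>, and a small \<open>\<eta>\<close> keeps
  the factor of \<open>x\<close> close to 1, so that a contraction survives taking powers.\<close>

lemma epowr_add_le:
  assumes "0 < a" "0 < \<eta>"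
  shows "(x + y) epowr a
    \<le> ennreal ((1 + \<eta>) powr a) * x epowr a + ennreal ((1 + 1 / \<eta>) powr a) * y epowr a"
proof -
  have "x + y \<le> ennreal (1 + \<eta>) * x \<or> x + y \<le> ennreal (1 + 1 / \<eta>) * y"
  proof (cases "y \<le> ennreal \<eta> * x")
    case True
    then have "x + y \<le> ennreal 1 * x + ennreal \<eta> * x" by (auto intro: add_left_mono)
    also have "\<dots> = ennreal (1 + \<eta>) * x"
      using assms by (simp only: distrib_right[symmetric] ennreal_plus)
    finally show ?thesis by simp
  next
    case False
    then have "ennreal \<eta> * x \<le> y" by auto
    then have "ennreal (1/\<eta>) * (ennreal \<eta> * x) \<le> ennreal (1/\<eta>) * y" by (rule mult_left_mono) simp
    then have "x \<le> ennreal (1 / \<eta>) * y"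
      using assms by (simp add: mult.assoc[symmetric] ennreal_mult[symmetric])
    then have "x + y \<le> ennreal (1 / \<eta>) * y + ennreal 1 * y" by (auto intro: add_right_mono)
    also have "\<dots> = ennreal (1 + 1 / \<eta>) * y"
    proof -
      have "ennreal (1 + 1 / \<eta>) = ennreal (1 / \<eta>) + ennreal 1"
        using assms by (subst ennreal_plus[symmetric]) (auto simp: add.commute)
      then show ?thesis by (simp only: distrib_right)
    qed
    finally show ?thesis by simp
  qed
  then have "(x + y) epowr a \<le> (ennreal (1 + \<eta>) * x) epowr a
     \<or> (x + y) epowr a \<le> (ennreal (1 + 1 / \<eta>) * y) epowr a"
    using assms by (auto intro: epowr_mono)
  then show ?thesis
  proof
    assume "(x + y) epowr a \<le> (ennreal (1 + \<eta>) * x) epowr a"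
    then show ?thesis
      using assms by (simp add: epowr_mult del: ennreal_plus) (erule order_trans, simp)
  next
    assume "(x + y) epowr a \<le> (ennreal (1 + 1 / \<eta>) * y) epowr a"
    then show ?thesis
      using assms by (simp add: epowr_mult del: ennreal_plus) (erule order_trans, simp)
  qed
qed

section \<open>The logarithmic weight and its norm\<close>

definition log_weight :: "real \<Rightarrow> real \<Rightarrow> real \<Rightarrow> real" where
  "log_weight s b t = t powr (- s) * (1 - ln t) powr b"

lemma log_weight_nonneg [simp]: "0 \<le> log_weight s b t"
  by (simp add: log_weight_def)

lemma borel_measurable_log_weight [measurable]: "log_weight s b \<in> borel_measurable borel"
  unfolding log_weight_def by measurable

text \<open>Away from 0 the weight is continuous on a compact interval. The bound serves twice: for
  the scales above a fixed \<open>\<delta>\<close>, and, with a constant that depends on the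
  truncation, to show that truncated quantities are finite.\<close>

lemma log_weight_bounded:
  assumes "0 < \<epsilon>"
  obtains W where "0 < W" "\<And>t. \<epsilon> \<le> t \<Longrightarrow> t < 1 \<Longrightarrow> log_weight s b t \<le> W"
proof -
  have ln_le: "ln t \<le> 0" if "\<epsilon> \<le> t" "t \<le> 1" for t using that assms by simp
  have "continuous_on {\<epsilon>..1} (log_weight s b)"
    unfolding log_weight_def
  proof (intro continuous_intros ballI impI)
    fix t assume "t \<in> {\<epsilon>..1}"
    then have *: "ln t \<le> 0" "0 < t" using assms ln_le[of t] by auto
    show "1 - ln t \<noteq> 0" using * by linarith
    show "t \<noteq> 0" using * by simp
    show "t \<noteq> 0" using * by simp
  qed
  then have "bounded (log_weight s b ` {\<epsilon>..1})"
    by (intro compact_imp_bounded compact_continuous_image) auto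
  then obtain W where W: "\<And>x. x \<in> log_weight s b ` {\<epsilon>..1} \<Longrightarrow> norm x \<le> W"
    unfolding bounded_iff by blast
  have *: "log_weight s b t \<le> max W 1" if "\<epsilon> \<le> t" "t < 1" for t
  proof -
    have "norm (log_weight s b t) \<le> W" by (rule W) (use that in auto)
    then show ?thesis by simp
  qed
  show thesis by (rule that[OF _ *]) simp_all
qed

text \<open>The logarithmic factor is slowly varying, so it does not spoil the exponent gap \<open>s < m\<close>.\<close>

lemma log_weight_doubling:
  assumes "s < m"
  obtains \<delta> \<theta> where "0 < \<delta>" "\<delta> \<le> 1/2" "0 < \<theta>" "\<theta> < 1"
    "\<And>t. 0 < t \<Longrightarrow> t < \<delta> \<Longrightarrow> log_weight s b t * 2 powr (- m) \<le> \<theta> * log_weight s b (2 * t)"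
proof -
  \<comment> \<open>Half of the exponent gap \<open>m - s\<close> pays for the logarithmic factor;
    the other half remains as \<open>\<theta> = 2 powr (- (m - s) / 2)\<close>.\<close>
  define \<eta> :: real where "\<eta> = 2 powr ((m - s) / 2)"
  have "\<eta> > 1" using assms by (simp add: \<eta>_def)
  have "((\<lambda>t::real. ((1 - ln t) / (1 - ln (2 * t))) powr b) \<longlongrightarrow> 1) (at_right 0)"
    by real_asymp
  then have "eventually (\<lambda>t. ((1 - ln t) / (1 - ln (2 * t))) powr b < \<eta>) (at_right 0)"
    using \<open>\<eta> > 1\<close> by (rule order_tendstoD)
  then obtain d where d: "0 < d" "\<And>t. 0 < t \<Longrightarrow> t < d \<Longrightarrow> ((1 - ln t) / (1 - ln (2 * t))) powr b < \<eta>"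
    unfolding eventually_at_right_field by auto
  have *: "log_weight s b t * 2 powr (- m) \<le> 2 powr (- (m - s) / 2) * log_weight s b (2 * t)"
    if t: "0 < t" "t < min d (1/2)" for t
  proof -
    have "ln t < 0" "ln (2 * t) < 0" using t by (auto simp del: ln_mult)
    then have pos: "1 - ln t > 0" "1 - ln (2*t) > 0" by linarith+
    have "((1 - ln t) / (1 - ln (2 * t))) powr b < \<eta>" using d t by auto
    then have "(1 - ln t) powr b \<le> \<eta> * (1 - ln (2*t)) powr b"
      using pos by (subst (asm) powr_divide) (auto simp: field_simps)
    then have "log_weight s b t * 2 powr (- m)
        \<le> t powr (-s) * (\<eta> * (1 - ln (2*t)) powr b) * 2 powr (-m)"
      unfolding log_weight_def by (intro mult_right_mono mult_left_mono) auto
    also have "\<dots> = 2 powr (s + (m - s)/2 - m) * log_weight s b (2 * t)"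
      using t unfolding log_weight_def \<eta>_def
      by (simp add: powr_mult powr_add powr_diff powr_minus) (simp add: field_simps del: ln_mult)
    also have "s + (m - s)/2 - m = - (m - s) / 2" by (simp add: field_simps)
    finally show ?thesis .
  qed
  have "(2::real) powr (- (m - s) / 2) < 2 powr 0"
    using assms by (intro powr_less_mono) auto
  then show thesis
    using d(1) by (intro that[of "min d (1/2)" "2 powr (- (m - s) / 2)"] *) auto
qed

lemma log_weighted_norm_eq:
  "log_weighted_norm s b q \<phi> =
    (if q = \<infinity> then SUP t\<in>{0<..<1}. ennreal (log_weight s b t) * \<phi> t
     else (\<integral>\<^sup>+ t\<in>{0<..<1}. (ennreal (log_weight s b t) * \<phi> t) epowr enn2real q * ennreal (1 / t)
           \<partial>lborel) epowr (1 / enn2real q))"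
  by (simp add: log_weighted_norm_def log_weight_def)

lemma log_weighted_norm_mono:
  assumes "\<And>t. 0 < t \<Longrightarrow> t < 1 \<Longrightarrow> \<phi> t \<le> \<psi> t"
  shows "log_weighted_norm s b q \<phi> \<le> log_weighted_norm s b q \<psi>"
proof -
  have "(\<integral>\<^sup>+ t\<in>{0<..<1}. (ennreal (log_weight s b t) * \<phi> t) epowr enn2real q * ennreal (1 / t) \<partial>lborel)
    \<le> (\<integral>\<^sup>+ t\<in>{0<..<1}. (ennreal (log_weight s b t) * \<psi> t) epowr enn2real q * ennreal (1 / t) \<partial>lborel)"
    using assms
    by (intro nn_integral_mono) (auto simp: indicator_def intro!: mult_right_mono epowr_mono mult_left_mono)
  moreover have "(SUP t\<in>{0<..<1}. ennreal (log_weight s b t) * \<phi> t)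
    \<le> (SUP t\<in>{0<..<1}. ennreal (log_weight s b t) * \<psi> t)"
    using assms by (intro SUP_mono) (auto intro!: mult_left_mono bexI)
  ultimately show ?thesis
    unfolding log_weighted_norm_eq by (auto intro!: epowr_mono)
qed

lemma log_weighted_norm_cmult:
  assumes "0 < c" "0 < q"
    and [measurable]: "(\<lambda>t. \<phi> t * indicator {0<..<1} t) \<in> borel_measurable borel"
  shows "log_weighted_norm s b q (\<lambda>t. ennreal c * \<phi> t) = ennreal c * log_weighted_norm s b q \<phi>"
proof (cases "q = \<infinity>")
  case True
  then show ?thesis
    by (simp add: log_weighted_norm_eq SUP_mult_left_ennreal mult.left_commute)
next
  case False
  then have q: "0 < enn2real q" using assms by (simp add: enn2real_positive_iff less_top)
  \<comment> \<open>Measurability is known only on (0,1), so the constant is pulled out of the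
    truncated function, which has the same norm.\<close>
  define \<phi>' where "\<phi>' t = \<phi> t * indicator {0<..<1} t" for t
  have [measurable]: "\<phi>' \<in> borel_measurable borel" using assms(3) by (simp add: \<phi>'_def[abs_def])
  let ?f = "\<lambda>\<phi> t. (ennreal (log_weight s b t) * \<phi> t) epowr enn2real q * ennreal (1 / t) * indicator {0<..<1} t"
  have "(\<integral>\<^sup>+ t. ?f (\<lambda>t. ennreal c * \<phi> t) t \<partial>lborel) = (\<integral>\<^sup>+ t. ennreal (c powr enn2real q) * ?f \<phi>' t \<partial>lborel)"
  proof (intro nn_integral_cong)
    fix t :: real
    show "?f (\<lambda>t. ennreal c * \<phi> t) t = ennreal (c powr enn2real q) * ?f \<phi>' t"
      using q assms(1) by (cases "t \<in> {0<..<1}") (simp_all add: epowr_mult \<phi>'_def ac_simps)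
  qed
  also have "\<dots> = ennreal (c powr enn2real q) * (\<integral>\<^sup>+ t. ?f \<phi>' t \<partial>lborel)"
    by (rule nn_integral_cmult) measurable
  also have "(\<integral>\<^sup>+ t. ?f \<phi>' t \<partial>lborel) = (\<integral>\<^sup>+ t. ?f \<phi> t \<partial>lborel)"
    by (intro nn_integral_cong) (auto simp add: \<phi>'_def indicator_def)
  finally have "log_weighted_norm s b q (\<lambda>t. ennreal c * \<phi> t)
    = (ennreal c epowr enn2real q) epowr (1 / enn2real q) * log_weighted_norm s b q \<phi>"
    using False q assms(1) by (simp only: log_weighted_norm_eq if_False) (simp add: epowr_mult)
  moreover have "enn2real q * (1 / enn2real q) = 1" using q by simp
  ultimately show ?thesis by (simp only: epowr_epowr epowr_one)
qed

section \<open>Dyadic recursions and the Hardy inequality\<close>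

lemma ennreal_absorb:
  fixes x y :: ennreal
  assumes "x \<le> ennreal \<theta> * x + y" "x < top" "0 \<le> \<theta>" "\<theta> < 1"
  shows "x \<le> ennreal (1 / (1 - \<theta>)) * y"
proof (cases "y = top")
  case True
  then show ?thesis using assms by (simp add: ennreal_mult_top)
next
  case False
  obtain u v where uv: "x = ennreal u" "0 \<le> u" "y = ennreal v" "0 \<le> v"
    using assms(2) False by (cases x; cases y) auto
  have "ennreal u \<le> ennreal (\<theta> * u + v)"
    using assms(1,3) uv by (simp add: ennreal_mult)
  then have "u \<le> \<theta> * u + v"
    using assms(3) uv by (simp del: ennreal_plus add: ennreal_le_iff)
  then have "u \<le> 1 / (1 - \<theta>) * v" using assms by (simp add: field_simps)
  then show ?thesis
    using uv assms(4) by (simp add: ennreal_mult[symmetric] del: times_divide_eq_left)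
qed

lemma ennreal_linear_combination_le:
  fixes x y :: ennreal
  shows "ennreal c * x + ennreal d * y \<le> ennreal (max c d) * (x + y)"
  unfolding distrib_left by (intro add_mono mult_right_mono ennreal_leI) auto

text \<open>The uniform bound \<open>A\<close> takes over for \<open>t \<ge> 1/2\<close>, where
  \<open>2 * t\<close> leaves (0,1). In the applications \<open>A\<close> is a multiple of the Lp
  norm of the function, \<open>\<phi>\<close> is the quantity to be estimated and
  \<open>\<psi>\<close> the forcing term.\<close>

definition dyadic_recursion :: "real \<Rightarrow> ennreal \<Rightarrow> (real \<Rightarrow> ennreal) \<Rightarrow> (real \<Rightarrow> ennreal) \<Rightarrow> bool" where
  "dyadic_recursion m A \<phi> \<psi> \<longleftrightarrow> A < top \<and> (\<forall>t. 0 < t \<longrightarrow> t < 1 \<longrightarrow> \<phi> t \<le> A) \<and>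
    (\<forall>t. 0 < t \<longrightarrow> t < 1/2 \<longrightarrow> \<phi> t \<le> ennreal (2 powr (- m)) * \<phi> (2 * t) + \<psi> t)"

lemma dyadic_recursionD:
  assumes "dyadic_recursion m A \<phi> \<psi>"
  shows "A < top" "\<And>t. 0 < t \<Longrightarrow> t < 1 \<Longrightarrow> \<phi> t \<le> A"
    "\<And>t. 0 < t \<Longrightarrow> t < 1/2 \<Longrightarrow> \<phi> t \<le> ennreal (2 powr (- m)) * \<phi> (2 * t) + \<psi> t"
  using assms by (auto simp: dyadic_recursion_def)

lemma dyadic_recursion_weighted:
  assumes "dyadic_recursion m A \<phi> \<psi>" "0 < t" "t < 1/2" "0 < \<theta>"
    and "log_weight s b t * 2 powr (- m) \<le> \<theta> * log_weight s b (2 * t)"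
  shows "ennreal (log_weight s b t) * \<phi> t
    \<le> ennreal \<theta> * (ennreal (log_weight s b (2 * t)) * \<phi> (2 * t)) + ennreal (log_weight s b t) * \<psi> t"
proof -
  have "ennreal (log_weight s b t) * \<phi> t
      \<le> ennreal (log_weight s b t) * (ennreal (2 powr (- m)) * \<phi> (2 * t) + \<psi> t)"
    using dyadic_recursionD(3)[OF assms(1-3)] by (rule mult_left_mono) simp
  also have "\<dots> = ennreal (log_weight s b t * 2 powr (- m)) * \<phi> (2 * t) + ennreal (log_weight s b t) * \<psi> t"
    by (simp add: distrib_left ennreal_mult mult.assoc)
  also have "\<dots> \<le> ennreal (\<theta> * log_weight s b (2 * t)) * \<phi> (2 * t) + ennreal (log_weight s b t) * \<psi> t"
    using assms(5) by (intro add_right_mono mult_right_mono ennreal_leI) auto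
  finally show ?thesis using assms(4) by (simp add: ennreal_mult mult.assoc)
qed

text \<open>After weighting, the recursion contracts by \<open>\<theta> < 1\<close> below
  \<open>\<delta>\<close>, while \<open>A\<close> controls the scales above. The largest value can
  therefore be absorbed, provided that it is finite.\<close>

lemma log_weighted_norm_hardy_SUP:
  assumes "s < m"
  shows "\<exists>K>0. \<forall>\<phi> \<psi> A. dyadic_recursion m A \<phi> \<psi>
    \<longrightarrow> log_weighted_norm s b \<infinity> \<phi> \<le> ennreal K * (A + log_weighted_norm s b \<infinity> \<psi>)"
proof -
  obtain \<delta> \<theta> where \<delta>: "0 < \<delta>" "\<delta> \<le> 1/2" "0 < \<theta>" "\<theta> < 1"
    "\<And>t. 0 < t \<Longrightarrow> t < \<delta> \<Longrightarrow> log_weight s b t * 2 powr (- m) \<le> \<theta> * log_weight s b (2 * t)"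
    using log_weight_doubling[OF assms] by blast
  obtain W where W: "0 < W" "\<And>t. \<delta> \<le> t \<Longrightarrow> t < 1 \<Longrightarrow> log_weight s b t \<le> W"
    using log_weight_bounded[OF \<open>0 < \<delta>\<close>] by blast
  show ?thesis
  proof (intro exI[of _ "1 / (1 - \<theta>) * max W 1"] conjI allI impI)
    show "0 < 1 / (1 - \<theta>) * max W 1" using \<delta> by simp
    fix \<phi> \<psi> :: "real \<Rightarrow> ennreal" and A
    assume rec: "dyadic_recursion m A \<phi> \<psi>"
    note A = dyadic_recursionD(1)[OF rec] and bd = dyadic_recursionD(2)[OF rec]
    define F where "F t = ennreal (log_weight s b t) * \<phi> t" for t
    define \<Gamma> where "\<Gamma> = log_weighted_norm s b \<infinity> \<psi>"
    have \<Gamma>: "ennreal (log_weight s b t) * \<psi> t \<le> \<Gamma>" if "0 < t" "t < 1" for t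
      unfolding \<Gamma>_def log_weighted_norm_eq using that by (auto intro: SUP_upper)
    have F_step: "F t \<le> ennreal \<theta> * F (2 * t) + \<Gamma>" if t: "0 < t" "t < \<delta>" for t
      unfolding F_def using dyadic_recursion_weighted[OF rec, of t \<theta> s b] \<Gamma>[of t] \<delta> t
      by (auto intro: order_trans add_left_mono)
    have main: "F t \<le> ennreal (1 / (1 - \<theta>)) * (\<Gamma> + ennreal W * A)" if t: "0 < t" "t < 1" for t
    proof -
      define \<epsilon> where "\<epsilon> = t"
      \<comment> \<open>Truncation at the point \<open>t\<close> under consideration. Doubling keeps
        every scale below \<open>\<delta> \<le> 1/2\<close> inside \<open>{\<epsilon>..<1}\<close>,
        so the truncated supremum obeys the same recursion.\<close>
      define S where "S = (SUP u\<in>{\<epsilon>..<1}. F u)"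
      obtain W' where W': "0 < W'" "\<And>u. \<epsilon> \<le> u \<Longrightarrow> u < 1 \<Longrightarrow> log_weight s b u \<le> W'"
        using log_weight_bounded[of \<epsilon>] t by (auto simp: \<epsilon>_def)
      \<comment> \<open>\<open>W'\<close> depends on \<open>\<epsilon>\<close>, but it only serves
        to make \<open>S\<close> finite; the final constant is built from \<open>W\<close> and
        \<open>\<theta>\<close>.\<close>
      have "S \<le> ennreal W' * A"
        unfolding S_def F_def using W' t bd
        by (intro SUP_least mult_mono ennreal_leI) (auto simp: \<epsilon>_def)
      also have "\<dots> < top" using A by (simp add: ennreal_mult_less_top)
      finally have "S < top" .
      moreover have "S \<le> ennreal \<theta> * S + (\<Gamma> + ennreal W * A)"
        unfolding S_def
      proof (rule SUP_least)
        fix u assume u: "u \<in> {\<epsilon>..<1}"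
        show "F u \<le> ennreal \<theta> * (SUP u\<in>{\<epsilon>..<1}. F u) + (\<Gamma> + ennreal W * A)"
        proof (cases "u < \<delta>")
          case True
          have "F u \<le> ennreal \<theta> * F (2 * u) + \<Gamma>"
            using u t True by (intro F_step) (auto simp: \<epsilon>_def)
          also have "\<dots> \<le> ennreal \<theta> * (SUP u\<in>{\<epsilon>..<1}. F u) + (\<Gamma> + ennreal W * A)"
            using u t True \<delta>
            by (intro add_mono mult_left_mono SUP_upper) (auto simp: \<epsilon>_def)
          finally show ?thesis .
        next
          case False
          have "F u \<le> ennreal W * A"
            unfolding F_def using False W(2)[of u] u t bd[of u]
            by (intro mult_mono ennreal_leI) (auto simp: \<epsilon>_def)
          then show ?thesis by (simp add: add_increasing)
        qed
      qed
      ultimately have "S \<le> ennreal (1 / (1 - \<theta>)) * (\<Gamma> + ennreal W * A)"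
        using \<delta> by (intro ennreal_absorb) auto
      moreover have "F t \<le> S"
        unfolding S_def using t by (intro SUP_upper) (auto simp: \<epsilon>_def)
      ultimately show ?thesis by (rule order_trans[rotated])
    qed
    have "log_weighted_norm s b \<infinity> \<phi> \<le> ennreal (1 / (1 - \<theta>)) * (\<Gamma> + ennreal W * A)"
      unfolding log_weighted_norm_eq using main by (auto intro!: SUP_least simp: F_def)
    also have "\<dots> \<le> ennreal (1 / (1 - \<theta>)) * (ennreal (max W 1) * (A + \<Gamma>))"
      using ennreal_linear_combination_le[of W A 1 \<Gamma>]
      by (intro mult_left_mono) (auto simp: add.commute)
    finally show "log_weighted_norm s b \<infinity> \<phi>
        \<le> ennreal (1 / (1 - \<theta>) * max W 1) * (A + log_weighted_norm s b \<infinity> \<psi>)"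
      using \<delta> by (simp add: \<Gamma>_def ennreal_mult mult.assoc del: times_divide_eq_left)
  qed
qed

text \<open>The same absorption for an integral. The substitution of \<open>2 * t\<close> for
  \<open>t\<close> preserves \<open>dt/t\<close>, so passing to the doubled scale costs nothing and
  only the contraction factor remains.\<close>

lemma log_weighted_norm_hardy_measurable:
  assumes "s < m" "0 < q" "q \<noteq> \<infinity>"
  shows "\<exists>K>0. \<forall>\<phi> \<psi> A. dyadic_recursion m A \<phi> \<psi>
    \<longrightarrow> \<phi> \<in> borel_measurable borel \<longrightarrow> \<psi> \<in> borel_measurable borel
    \<longrightarrow> log_weighted_norm s b q \<phi> \<le> ennreal K * (A + log_weighted_norm s b q \<psi>)"
proof -
  define a where "a = enn2real q"
  have a: "0 < a" using assms by (simp add: enn2real_positive_iff less_top a_def)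
  obtain \<delta> \<theta> where \<delta>: "0 < \<delta>" "\<delta> \<le> 1/2" "0 < \<theta>" "\<theta> < 1"
    "\<And>t. 0 < t \<Longrightarrow> t < \<delta> \<Longrightarrow> log_weight s b t * 2 powr (- m) \<le> \<theta> * log_weight s b (2 * t)"
    using log_weight_doubling[OF assms(1)] by blast
  obtain W where W: "0 < W" "\<And>t. \<delta> \<le> t \<Longrightarrow> t < 1 \<Longrightarrow> log_weight s b t \<le> W"
    using log_weight_bounded[OF \<open>0 < \<delta>\<close>] by blast
  \<comment> \<open>Makes \<open>(1 + \<nu>) * \<theta>\<close> the midpoint of
    \<open>\<theta>\<close> and 1: the loss in \<open>epowr_add_le\<close> uses up only half of the
    distance to 1.\<close>
  define \<nu> where "\<nu> = (1 - \<theta>) / (2 * \<theta>)"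
  have \<nu>: "0 < \<nu>" "(1 + \<nu>) * \<theta> = (1 + \<theta>) / 2" using \<delta> by (auto simp: \<nu>_def field_simps)
  define \<rho> where "\<rho> = ((1 + \<theta>) / 2) powr a"
  have "\<rho> < 1 powr a" unfolding \<rho>_def using \<delta> a by (intro powr_less_mono2) auto
  then have \<rho>: "0 \<le> \<rho>" "\<rho> < 1" by (auto simp: \<rho>_def)
  define C1 where "C1 = (1 + 1 / \<nu>) powr a"
  have "0 < 1 + 1 / \<nu>" using \<nu>(1) by (intro add_pos_pos) auto
  then have C1: "0 < C1" by (simp add: C1_def)
  define C2 where "C2 = W powr a / \<delta>"
  have C2: "0 < C2" using W \<delta> by (auto simp: C2_def)
  define R where "R = 1 / (1 - \<rho>)"
  have R: "0 < R" using \<rho> by (simp add: R_def)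
  define K where "K = max (2 powr (1 / a) * (R * C2) powr (1 / a)) (2 powr (1 / a) * (R * C1) powr (1 / a))"
  show ?thesis
  proof (intro exI[of _ K] conjI allI impI)
    show "0 < K" using R C2 by (simp add: K_def less_max_iff_disj)
    fix \<phi> \<psi> :: "real \<Rightarrow> ennreal" and A
    assume rec: "dyadic_recursion m A \<phi> \<psi>"
      and [measurable]: "\<phi> \<in> borel_measurable borel" "\<psi> \<in> borel_measurable borel"
    note A = dyadic_recursionD(1)[OF rec] and bd = dyadic_recursionD(2)[OF rec]
    define F where "F t = (ennreal (log_weight s b t) * \<phi> t) epowr a * ennreal (1 / t)" for t
    define G where "G t = (ennreal (log_weight s b t) * \<psi> t) epowr a * ennreal (1 / t)" for t
    have [measurable]: "F \<in> borel_measurable borel" "G \<in> borel_measurable borel"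
      unfolding F_def G_def by measurable
    define \<Gamma> where "\<Gamma> = (\<integral>\<^sup>+ t\<in>{0<..<1}. G t \<partial>lborel)"
    define J where "J \<epsilon> = (\<integral>\<^sup>+ t\<in>{\<epsilon><..<1}. F t \<partial>lborel)" for \<epsilon>
    have inv: "ennreal (1 / t) = 2 * ennreal (1 / (2 * t))" if "0 < t" for t
    proof -
      have "2 * ennreal (1 / (2 * t)) = ennreal (2 * (1 / (2 * t)))"
        using that by (subst ennreal_mult) auto
      then show ?thesis using that by simp
    qed
    \<comment> \<open>The factor 2 before \<open>F (2 * t)\<close> stems from
      \<open>1 / t = 2 * (1 / (2 * t))\<close>. It is exactly the Jacobian of the substitution, so
      after integration the first term is at most \<open>\<rho>\<close> times the truncated
      integral.\<close>
    have F_step: "F t \<le> ennreal \<rho> * (2 * F (2 * t)) + ennreal C1 * G t" if t: "0 < t" "t < \<delta>" for t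
    proof -
      let ?u = "ennreal (log_weight s b (2 * t)) * \<phi> (2 * t)"
      have "(ennreal (log_weight s b t) * \<phi> t) epowr a \<le> (ennreal \<theta> * ?u + ennreal (log_weight s b t) * \<psi> t) epowr a"
        using a \<delta> t by (intro epowr_mono dyadic_recursion_weighted[OF rec]) auto
      also have "\<dots> \<le> ennreal ((1 + \<nu>) powr a) * (ennreal \<theta> * ?u) epowr a
          + ennreal C1 * (ennreal (log_weight s b t) * \<psi> t) epowr a"
        unfolding C1_def using a \<nu> by (intro epowr_add_le) auto
      also have "ennreal ((1 + \<nu>) powr a) * (ennreal \<theta> * ?u) epowr a = ennreal ((1 + \<nu>) powr a) * (ennreal (\<theta> powr a) * ?u epowr a)"
        using a \<delta> by (subst epowr_mult[where x = "ennreal \<theta>"]) auto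
      also have "\<dots> = ennreal \<rho> * (ennreal (log_weight s b (2 * t)) * \<phi> (2 * t)) epowr a"
      proof -
        have "\<rho> = (1 + \<nu>) powr a * \<theta> powr a"
          unfolding \<rho>_def using \<nu> \<delta> by (subst \<nu>(2)[symmetric], subst powr_mult) auto
        then show ?thesis by (simp add: ennreal_mult mult.assoc)
      qed
      finally have "F t \<le> (ennreal \<rho> * (ennreal (log_weight s b (2 * t)) * \<phi> (2 * t)) epowr a
          + ennreal C1 * (ennreal (log_weight s b t) * \<psi> t) epowr a) * ennreal (1 / t)"
        unfolding F_def by (rule mult_right_mono) simp
      also have "\<dots> = ennreal \<rho> * ((ennreal (log_weight s b (2 * t)) * \<phi> (2 * t)) epowr a * ennreal (1 / t)) + ennreal C1 * G t"
        unfolding G_def by (simp only: distrib_right mult.assoc)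
      also have "(ennreal (log_weight s b (2 * t)) * \<phi> (2 * t)) epowr a * ennreal (1 / t) = 2 * F (2 * t)"
        unfolding F_def inv[OF t(1)] by (simp only: ac_simps)
      finally show ?thesis .
    qed
    have F_bound: "F t \<le> ennreal (V powr a / \<epsilon>) * A epowr a"
      if "0 < \<epsilon>" "\<epsilon> \<le> t" "t < 1" "0 \<le> V" "log_weight s b t \<le> V" for V \<epsilon> t
    proof -
      have "F t \<le> (ennreal V * A) epowr a * ennreal (1 / \<epsilon>)"
        unfolding F_def using that a bd[of t]
        by (intro mult_mono epowr_mono ennreal_leI) (auto simp: field_simps)
      also have "\<dots> = ennreal (V powr a * (1 / \<epsilon>)) * A epowr a"
        using a that by (subst ennreal_mult) (auto simp: epowr_mult ac_simps)
      finally show ?thesis by simp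
    qed
    \<comment> \<open>The bound \<open>V\<close> depends on \<open>\<epsilon>\<close> and enters
      only through finiteness of \<open>J \<epsilon>\<close>. The estimate itself is uniform in
      \<open>\<epsilon>\<close>, so monotone convergence can later carry it to
      \<open>J 0\<close>.\<close>
    have J_le: "J \<epsilon> \<le> ennreal R * (ennreal C1 * \<Gamma> + ennreal C2 * A epowr a)" if \<epsilon>: "0 < \<epsilon>" for \<epsilon>
    proof -
      obtain V where V: "0 < V" "\<And>u. \<epsilon> \<le> u \<Longrightarrow> u < 1 \<Longrightarrow> log_weight s b u \<le> V"
        using log_weight_bounded[of \<epsilon>] \<epsilon> by blast
      have "J \<epsilon> \<le> (\<integral>\<^sup>+ t. ennreal (V powr a / \<epsilon>) * A epowr a * indicator {\<epsilon><..<1} t \<partial>lborel)"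
        unfolding J_def using V \<epsilon>
        by (intro nn_integral_mono) (auto simp: indicator_def intro!: F_bound)
      also have "\<dots> = ennreal (V powr a / \<epsilon>) * A epowr a * emeasure lborel {\<epsilon><..<1}"
        by (rule nn_integral_cmult_indicator) simp
      also have "\<dots> < top"
      proof -
        have "A epowr a < top" using A epowr_eq_top_iff[of A a] by (simp add: less_top[symmetric])
        moreover have "emeasure lborel {\<epsilon><..<1} < top" by (cases "\<epsilon> \<le> 1") auto
        ultimately show ?thesis by (simp add: ennreal_mult_less_top)
      qed
      finally have "J \<epsilon> < top" .
      have "J \<epsilon> \<le> (\<integral>\<^sup>+ t. ennreal \<rho> * (2 * (F (0 + 2 * t) * indicator {\<epsilon><..<1} (0 + 2 * t)))
          + (ennreal C1 * (G t * indicator {0<..<1} t)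
             + ennreal C2 * A epowr a * indicator {0<..<1} t) \<partial>lborel)"
        unfolding J_def
      proof (rule nn_integral_mono)
        fix t :: real
        show "F t * indicator {\<epsilon><..<1} t \<le> ennreal \<rho> * (2 * (F (0 + 2 * t) * indicator {\<epsilon><..<1} (0 + 2 * t)))
          + (ennreal C1 * (G t * indicator {0<..<1} t)
             + ennreal C2 * A epowr a * indicator {0<..<1} t)"
        proof (cases "t \<in> {\<epsilon><..<1}")
          case t: True
          show ?thesis
          proof (cases "t < \<delta>")
            case True
            then have "2 * t \<in> {\<epsilon><..<1}" "t \<in> {0<..<1}" using \<epsilon> \<delta> t by auto
            moreover have "F t \<le> ennreal \<rho> * (2 * F (2 * t)) + ennreal C1 * G t"
              using True t \<epsilon> by (intro F_step) auto
            ultimately show ?thesis using t by (simp add: add.assoc[symmetric] add_increasing2)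
          next
            case False
            have "F t \<le> ennreal C2 * A epowr a"
              unfolding C2_def using False t \<epsilon> \<delta> W by (intro F_bound) auto
            moreover have "t \<in> {0<..<1}" using t \<epsilon> by auto
            ultimately show ?thesis using t by (simp add: add_increasing)
          qed
        qed simp
      qed
      also have "\<dots> = ennreal \<rho> * (2 * (\<integral>\<^sup>+ t. F (0 + 2 * t) * indicator {\<epsilon><..<1} (0 + 2 * t) \<partial>lborel))
          + (ennreal C1 * \<Gamma> + ennreal C2 * A epowr a)"
        unfolding \<Gamma>_def
        by (subst nn_integral_add, measurable, subst nn_integral_add, measurable)
          (simp add: nn_integral_cmult nn_integral_cmult_indicator)
      also have "2 * (\<integral>\<^sup>+ t. F (0 + 2 * t) * indicator {\<epsilon><..<1} (0 + 2 * t) \<partial>lborel) = J \<epsilon>"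
        unfolding J_def
        by (subst nn_integral_real_affine[where c = 2 and t = 0 and f = "\<lambda>t. F t * indicator {\<epsilon><..<1} t"]) auto
      finally show ?thesis
        unfolding R_def using \<rho> \<open>J \<epsilon> < top\<close> by (intro ennreal_absorb)
    qed
    let ?g = "\<lambda>n t. F t * indicator {1 / real (Suc n)<..<1} t"
    have "J 0 \<le> (\<integral>\<^sup>+ t. (SUP n. ?g n t) \<partial>lborel)"
      unfolding J_def
    proof (rule nn_integral_mono)
      fix t :: real
      show "F t * indicator {0<..<1} t \<le> (SUP n. ?g n t)"
      proof (cases "t \<in> {0<..<1}")
        case True
        then obtain n where "inverse (real (Suc n)) < t" using reals_Archimedean[of t] by auto
        then have "F t * indicator {0<..<1} t = ?g n t"
          using True by (simp add: inverse_eq_divide indicator_def)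
        also have "\<dots> \<le> (SUP n. ?g n t)"
          by (rule SUP_upper) simp
        finally show ?thesis .
      qed simp
    qed
    also have "\<dots> = (SUP n. J (1 / real (Suc n)))"
      unfolding J_def
    proof (rule nn_integral_monotone_convergence_SUP)
      have "1 / real (Suc n') \<le> 1 / real (Suc n)" if "n \<le> n'" for n n'
        using that by (intro divide_left_mono) auto
      then show "incseq ?g"
        unfolding incseq_def le_fun_def by (fastforce simp: indicator_def intro: le_less_trans)
    qed measurable
    also have "\<dots> \<le> ennreal R * (ennreal C1 * \<Gamma> + ennreal C2 * A epowr a)"
      by (intro SUP_least J_le) simp
    finally have J0: "J 0 \<le> ennreal (R * C2) * A epowr a + ennreal (R * C1) * \<Gamma>"
      using R C1 C2 by (simp add: distrib_left ennreal_mult mult.assoc add.commute)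
    have lwn: "log_weighted_norm s b q \<phi> = J 0 epowr (1 / a)" "log_weighted_norm s b q \<psi> = \<Gamma> epowr (1 / a)"
      using assms(3) by (simp_all add: log_weighted_norm_eq J_def F_def G_def \<Gamma>_def a_def)
    have "J 0 epowr (1 / a) \<le> (ennreal (R * C2) * A epowr a + ennreal (R * C1) * \<Gamma>) epowr (1 / a)"
      using J0 a by (intro epowr_mono) auto
    \<comment> \<open>Here \<open>\<eta> = 1\<close> is good enough: the absorption is over and no
      factor has to stay below 1.\<close>
    also have "\<dots> \<le> ennreal ((1 + 1) powr (1 / a)) * (ennreal (R * C2) * A epowr a) epowr (1 / a)
        + ennreal ((1 + 1 / 1) powr (1 / a)) * (ennreal (R * C1) * \<Gamma>) epowr (1 / a)"
      using a by (intro epowr_add_le) auto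
    also have "(ennreal (R * C2) * A epowr a) epowr (1 / a) = ennreal ((R * C2) powr (1 / a)) * A"
      using a R C2 by (subst epowr_mult) (auto simp: epowr_epowr)
    also have "(ennreal (R * C1) * \<Gamma>) epowr (1 / a) = ennreal ((R * C1) powr (1 / a)) * \<Gamma> epowr (1 / a)"
      using a R C1 by (subst epowr_mult) auto
    also have "ennreal ((1 + 1) powr (1 / a)) * (ennreal ((R * C2) powr (1 / a)) * A) +
        ennreal ((1 + 1 / 1) powr (1 / a)) * (ennreal ((R * C1) powr (1 / a)) * \<Gamma> epowr (1 / a))
      = ennreal (2 powr (1 / a) * (R * C2) powr (1 / a)) * A
        + ennreal (2 powr (1 / a) * (R * C1) powr (1 / a)) * \<Gamma> epowr (1 / a)"
      by (simp add: ennreal_mult mult.assoc)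
    also have "\<dots> \<le> ennreal K * (A + \<Gamma> epowr (1 / a))"
      unfolding K_def by (rule ennreal_linear_combination_le)
    finally show "log_weighted_norm s b q \<phi> \<le> ennreal K * (A + log_weighted_norm s b q \<psi>)"
      by (simp only: lwn)
  qed
qed

text \<open>\<open>\<phi>\<close> itself need not be measurable: the recursion is solved by an explicit measurable
  series, which dominates \<open>\<phi>\<close>.\<close>

lemma log_weighted_norm_hardy:
  assumes "s < m" "0 < m" "0 < q"
  shows "\<exists>K>0. \<forall>\<phi> \<psi> A. dyadic_recursion m A \<phi> \<psi>
    \<longrightarrow> (\<lambda>t. \<psi> t * indicator {0<..<1} t) \<in> borel_measurable borel
    \<longrightarrow> log_weighted_norm s b q \<phi> \<le> ennreal K * (A + log_weighted_norm s b q \<psi>)"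
proof (cases "q = \<infinity>")
  case True
  with log_weighted_norm_hardy_SUP[OF assms(1), of b] show ?thesis by auto
next
  case False
  obtain K where K: "0 < K"
    "\<And>\<phi> \<psi> A. dyadic_recursion m A \<phi> \<psi> \<Longrightarrow> \<phi> \<in> borel_measurable borel \<Longrightarrow> \<psi> \<in> borel_measurable borel
      \<Longrightarrow> log_weighted_norm s b q \<phi> \<le> ennreal K * (A + log_weighted_norm s b q \<psi>)"
    using log_weighted_norm_hardy_measurable[OF assms(1,3) False, of b] by blast
  define r where "r = 2 powr (- m)"
  have "r < 2 powr 0" unfolding r_def using assms(2) by (intro powr_less_mono) auto
  then have r: "0 \<le> r" "r < 1" by (auto simp: r_def)
  define c where "c = max (1 / (1 - r)) 1"
  show ?thesis
  proof (intro exI[of _ "K * c"] conjI allI impI)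
    show "0 < K * c" using K(1) by (auto simp: c_def less_max_iff_disj)
    fix \<phi> \<psi> :: "real \<Rightarrow> ennreal" and A
    assume rec0: "dyadic_recursion m A \<phi> \<psi>"
      and meas: "(\<lambda>t. \<psi> t * indicator {0<..<1} t) \<in> borel_measurable borel"
    note A = dyadic_recursionD(1)[OF rec0] and bd = dyadic_recursionD(2)[OF rec0] and rec = dyadic_recursionD(3)[OF rec0]
    define \<psi>' where "\<psi>' t = \<psi> t * indicator {0<..<1} t" for t :: real
    have [measurable]: "\<psi>' \<in> borel_measurable borel" using meas by (simp only: \<psi>'_def[abs_def])
    \<comment> \<open>The forcing may be capped at \<open>A\<close> because \<open>\<phi>\<close> is
      bounded by \<open>A\<close>. The cap makes the series below at most geometric, and the value
      \<open>A\<close> from 1/2 onward starts the comparison of \<open>\<phi>\<close> with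
      \<open>\<Phi>\<close>.\<close>
    define E where "E t = (if t < 1/2 then min (\<psi>' t) A else A)" for t :: real
    have [measurable]: "E \<in> borel_measurable borel" unfolding E_def by measurable
    define \<Phi> where "\<Phi> t = (\<Sum>j. ennreal r ^ j * E (2 ^ j * t))" for t
    have [measurable]: "\<Phi> \<in> borel_measurable borel" unfolding \<Phi>_def by measurable
    have \<Phi>_rec: "\<Phi> t = E t + ennreal r * \<Phi> (2 * t)" for t
    proof -
      have "\<Phi> t = (\<Sum>j. ennreal r ^ (j + 1) * E (2 ^ (j + 1) * t)) + (\<Sum>j<1. ennreal r ^ j * E (2 ^ j * t))"
        unfolding \<Phi>_def by (rule suminf_offset) simp
      also have "(\<Sum>j. ennreal r ^ (j + 1) * E (2 ^ (j + 1) * t)) = ennreal r * \<Phi> (2 * t)"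
      proof -
        have "ennreal r ^ (j + 1) * E (2 ^ (j + 1) * t) = ennreal r * (ennreal r ^ j * E (2 ^ j * (2 * t)))" for j
          by (simp add: mult.assoc mult.left_commute)
        then show ?thesis unfolding \<Phi>_def by (simp only: ennreal_suminf_cmult)
      qed
      finally show ?thesis by (simp add: add.commute)
    qed
    have \<Phi>_le: "\<Phi> t \<le> ennreal (1 / (1 - r)) * A" for t
    proof -
      have "ennreal r ^ j * E u \<le> A * ennreal (r ^ j)" for j u
      proof -
        have "E u \<le> A" by (simp add: E_def)
        then show ?thesis using r by (simp add: ennreal_power mult.commute mult_right_mono)
      qed
      then have "\<Phi> t \<le> (\<Sum>j. A * ennreal (r ^ j))"
        unfolding \<Phi>_def by (intro suminf_le) auto
      also have "\<dots> = A * (\<Sum>j. ennreal (r ^ j))" by (rule ennreal_suminf_cmult)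
      also have "(\<Sum>j. ennreal (r ^ j)) = ennreal (1 / (1 - r))"
        using r by (intro suminf_ennreal_eq geometric_sums) auto
      finally show ?thesis by (simp add: mult.commute)
    qed
    have dom: "\<phi> t \<le> \<Phi> t" if "0 < t" "t < 1" for t
    proof -
      \<comment> \<open>Induction on a number of doublings that carries \<open>t\<close> to 1/2 or
        beyond.\<close>
      have "\<phi> t \<le> \<Phi> t" if "0 < t" "t < 1" "1/2 \<le> 2 ^ n * t" for n t
        using that
      proof (induction n arbitrary: t)
        case 0
        then have "\<phi> t \<le> E t" using bd[of t] by (simp add: E_def)
        also have "E t \<le> \<Phi> t" by (subst \<Phi>_rec) (simp add: add_increasing2)
        finally show ?case .
      next
        case (Suc n)
        show ?case
        proof (cases "t < 1/2")
          case True
          have "\<phi> t \<le> A" using bd Suc by auto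
          moreover have "\<phi> t \<le> ennreal r * \<phi> (2 * t) + \<psi>' t"
            using rec[of t] Suc True by (simp add: r_def \<psi>'_def)
          ultimately have "\<phi> t \<le> ennreal r * \<phi> (2 * t) + min (\<psi>' t) A"
            by (auto simp: min_def add_increasing)
          also have "\<dots> \<le> ennreal r * \<Phi> (2 * t) + E t"
            unfolding E_def using True Suc
            by (intro add_mono mult_left_mono Suc.IH) (auto simp: ac_simps)
          finally show ?thesis by (subst \<Phi>_rec) (simp add: add.commute)
        next
          case False
          then have "\<phi> t \<le> E t" using bd[of t] Suc by (simp add: E_def)
          also have "E t \<le> \<Phi> t" by (subst \<Phi>_rec) (simp add: add_increasing2)
          finally show ?thesis .
        qed
      qed
      moreover obtain n where n: "1 / (2 * t) < 2 ^ n"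
        using real_arch_pow[of 2 "1 / (2 * t)"] by auto
      have "1/2 \<le> 2 ^ n * t" using n that by (simp add: field_simps)
      ultimately show ?thesis using that by blast
    qed
    have "log_weighted_norm s b q \<phi> \<le> log_weighted_norm s b q \<Phi>"
      using dom by (rule log_weighted_norm_mono)
    also have "\<dots> \<le> ennreal K * (ennreal (1 / (1 - r)) * A + log_weighted_norm s b q \<psi>')"
    proof (rule K(2))
      have "ennreal (1 / (1 - r)) * A < top" using A by (simp add: ennreal_mult_less_top)
      moreover have "\<Phi> t \<le> ennreal (2 powr (- m)) * \<Phi> (2 * t) + \<psi>' t" if "0 < t" "t < 1/2" for t
        by (subst \<Phi>_rec) (use that in \<open>simp add: E_def r_def add.commute add_left_mono\<close>)
      ultimately show "dyadic_recursion m (ennreal (1 / (1 - r)) * A) \<Phi> \<psi>'"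
        using \<Phi>_le by (simp add: dyadic_recursion_def)
    qed measurable
    also have "log_weighted_norm s b q \<psi>' \<le> log_weighted_norm s b q \<psi>"
      by (intro log_weighted_norm_mono) (simp add: \<psi>'_def)
    also have "ennreal K * (ennreal (1 / (1 - r)) * A + log_weighted_norm s b q \<psi>)
        \<le> ennreal K * (ennreal c * (A + log_weighted_norm s b q \<psi>))"
      unfolding c_def
      using ennreal_linear_combination_le[of "1 / (1 - r)" A 1 "log_weighted_norm s b q \<psi>"]
      by (intro mult_left_mono) auto
    finally show "log_weighted_norm s b q \<phi> \<le> ennreal (K * c) * (A + log_weighted_norm s b q \<psi>)"
      using K(1) by (simp add: ennreal_mult mult.assoc c_def add_left_mono mult_left_mono)
  qed
qed

section \<open>Minkowski inequalities\<close>

lemma Lp_norm_finite_exponent: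
  assumes "p \<noteq> \<infinity>"
  shows "Lp_norm M p f = (\<integral>\<^sup>+ x. ennreal (norm (f x)) epowr enn2real p \<partial>M) epowr (1 / enn2real p)"
  using assms by (simp add: Lp_norm_def)

lemma enn2real_ge_1:
  assumes "1 \<le> p" "p \<noteq> \<infinity>"
  shows "1 \<le> enn2real p"
  using enn2real_mono[of 1 p] assms by (simp add: less_top)

lemma Lp_norm_le_iff:
  assumes "1 \<le> p" "p \<noteq> \<infinity>"
  shows "Lp_norm M p f \<le> c \<longleftrightarrow> (\<integral>\<^sup>+ x. ennreal (norm (f x)) epowr enn2real p \<partial>M) \<le> c epowr enn2real p"
  unfolding Lp_norm_finite_exponent[OF assms(2)]
  by (rule epowr_inverse_le_iff) (use enn2real_ge_1[OF assms] in simp)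

lemma Lp_norm_top_le_iff:
  assumes [measurable]: "f \<in> borel_measurable M"
  shows "Lp_norm M \<infinity> f \<le> c \<longleftrightarrow> (AE x in M. ennreal (norm (f x)) \<le> c)"
proof
  assume "Lp_norm M \<infinity> f \<le> c"
  then have "esssup M (\<lambda>x. ennreal (norm (f x))) \<le> c" by (simp add: Lp_norm_def)
  then show "AE x in M. ennreal (norm (f x)) \<le> c"
    using esssup_AE[of "\<lambda>x. ennreal (norm (f x))" M] by (auto elim: eventually_mono)
next
  assume "AE x in M. ennreal (norm (f x)) \<le> c"
  then show "Lp_norm M \<infinity> f \<le> c" by (auto simp: Lp_norm_def intro!: esssup_I)
qed

lemma Lp_norm_cong_AE:
  assumes "f \<in> borel_measurable M" "g \<in> borel_measurable M" "AE x in M. f x = g x"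
  shows "Lp_norm M p f = Lp_norm M p g"
proof -
  have "esssup M (\<lambda>x. ennreal (norm (f x))) = esssup M (\<lambda>x. ennreal (norm (g x)))"
    using assms by (intro esssup_AE_cong) auto
  moreover have "(\<integral>\<^sup>+ x. ennreal (norm (f x) powr enn2real p) \<partial>M) = (\<integral>\<^sup>+ x. ennreal (norm (g x) powr enn2real p) \<partial>M)"
    using assms(3) by (intro nn_integral_cong_AE) auto
  ultimately show ?thesis by (simp add: Lp_norm_def)
qed

text \<open>Integrated against a weight and optimised in \<open>\<mu>\<close>, this is Jensen's inequality.\<close>

lemma powr_tangent_le:
  fixes u \<mu> P :: real
  assumes "1 \<le> P" "0 \<le> u" "0 < \<mu>"
  shows "P * \<mu> powr (P - 1) * u \<le> u powr P + (P - 1) * \<mu> powr P"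
proof (cases "P = 1")
  case True
  then show ?thesis using assms by simp
next
  case False
  then have P: "1 < P" using assms by simp
  define q where "q = P / (P - 1)"
  have q: "1 < q" "1 / P + 1 / q = 1" using P by (auto simp: q_def field_simps)
  have "u * \<mu> powr (P - 1) \<le> u powr P / P + (\<mu> powr (P - 1)) powr q / q"
    using P q assms by (intro Youngs_inequality) auto
  also have "(\<mu> powr (P - 1)) powr q = \<mu> powr P"
    using P by (simp add: powr_powr q_def)
  also have "\<mu> powr P / q = (P - 1) / P * \<mu> powr P" using P by (simp add: q_def)
  finally show ?thesis using P by (simp add: field_simps)
qed

text \<open>Jensen's inequality in homogeneous form, for the measure with density \<open>w\<close>
  and total mass \<open>W\<close>: integrate the tangent inequality and then put the tangent point
  at the mean value.\<close>

lemma nn_integral_epowr_le: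
  fixes w g :: "'a \<Rightarrow> ennreal"
  assumes [measurable]: "w \<in> borel_measurable N" "g \<in> borel_measurable N"
    and P: "1 \<le> P" and W: "(\<integral>\<^sup>+ y. w y \<partial>N) = ennreal W" "0 < W"
  shows "(\<integral>\<^sup>+ y. w y * g y \<partial>N) epowr P
      \<le> ennreal (W powr (P - 1)) * (\<integral>\<^sup>+ y. w y * g y epowr P \<partial>N)"
proof (cases "(\<integral>\<^sup>+ y. w y * g y epowr P \<partial>N) = top")
  case True
  then show ?thesis using W by (simp add: ennreal_mult_top)
next
  case False
  let ?X = "\<integral>\<^sup>+ y. w y * g y \<partial>N" and ?I = "\<integral>\<^sup>+ y. w y * g y epowr P \<partial>N"
  from False obtain I where I: "?I = ennreal I" "0 \<le> I"
    by (cases ?I) auto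
  have key: "ennreal (P * \<mu> powr (P - 1)) * ?X \<le> ennreal (I + (P - 1) * \<mu> powr P * W)"
    if "0 < \<mu>" for \<mu>
  proof -
    have pt: "ennreal (P * \<mu> powr (P - 1)) * g y \<le> g y epowr P + ennreal ((P - 1) * \<mu> powr P)" for y
    proof (cases "g y")
      case (real u)
      have "ennreal (P * \<mu> powr (P - 1) * u) \<le> ennreal (u powr P + (P - 1) * \<mu> powr P)"
        using that P real by (intro ennreal_leI powr_tangent_le) auto
      then show ?thesis using real P that by (simp add: ennreal_mult)
    qed simp
    have "ennreal (P * \<mu> powr (P - 1)) * ?X
        = (\<integral>\<^sup>+ y. w y * (ennreal (P * \<mu> powr (P - 1)) * g y) \<partial>N)"
      by (subst nn_integral_cmult[symmetric]) (auto simp: ac_simps)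
    also have "\<dots> \<le> (\<integral>\<^sup>+ y. w y * g y epowr P + ennreal ((P - 1) * \<mu> powr P) * w y \<partial>N)"
      using mult_left_mono[OF pt] by (intro nn_integral_mono) (simp add: distrib_left mult.commute)
    also have "\<dots> = ennreal I + ennreal ((P - 1) * \<mu> powr P) * ennreal W"
      by (subst nn_integral_add) (auto simp: nn_integral_cmult W I)
    finally show ?thesis using P I W by (simp add: ennreal_mult)
  qed
  \<comment> \<open>The choice \<open>\<mu> = 1\<close> only shows that \<open>?X\<close> is finite;
    the mean can be formed as a real number afterwards.\<close>
  have "ennreal P * ?X \<le> ennreal (I + (P - 1) * W)"
    using key[of 1] by simp
  then have "ennreal P * ?X \<noteq> top" by (auto simp: top_unique)
  then obtain X where X: "?X = ennreal X" "0 \<le> X"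
    using P by (cases ?X) (auto simp: ennreal_mult_top)
  have "X powr P \<le> W powr (P - 1) * I"
  proof (cases "X = 0")
    case False
    then have "0 < X" using X by simp
    \<comment> \<open>The mean value of \<open>g\<close>, the optimal tangent point.\<close>
    define \<mu> where "\<mu> = X / W"
    have \<mu>: "0 < \<mu>" using \<open>0 < X\<close> W by (simp add: \<mu>_def)
    have "ennreal (P * \<mu> powr (P - 1) * X) \<le> ennreal (I + (P - 1) * \<mu> powr P * W)"
      using key[OF \<mu>] X P by (simp add: ennreal_mult)
    then have "P * \<mu> powr (P - 1) * X \<le> I + (P - 1) * \<mu> powr P * W"
      using P I W by (subst (asm) ennreal_le_iff) auto
    moreover have "\<mu> powr (P - 1) * X = \<mu> powr P * W"
      using \<mu> W \<open>0 < X\<close> by (simp add: powr_diff \<mu>_def)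
    ultimately have "\<mu> powr P * W \<le> I" by (simp add: algebra_simps)
    then have "W powr (P - 1) * (\<mu> powr P * W) \<le> W powr (P - 1) * I"
      by (intro mult_left_mono) auto
    also have "W powr (P - 1) * (\<mu> powr P * W) = X powr P"
      using W X by (simp add: powr_diff \<mu>_def powr_divide)
    finally show ?thesis .
  qed (use I in simp)
  then show ?thesis
    using X I W by (simp add: ennreal_mult[symmetric])
qed

text \<open>Minkowski's integral inequality, from Jensen in \<open>y\<close> and Tonelli. The second
  claim is absolute convergence for almost every \<open>x\<close>, from which local integrability
  will be read off. Asking for the bound on \<open>H\<close> only where \<open>w\<close> is nonzero
  lets a kernel of bounded support see only the steps \<open>y\<close> in its support.\<close>

lemma Lp_norm_integral_le:
  fixes H :: "'a \<Rightarrow> 'b \<Rightarrow> complex" and w :: "'b \<Rightarrow> real"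
  assumes "sigma_finite_measure M" "sigma_finite_measure N" and p: "1 \<le> p"
    and [measurable]: "(\<lambda>(x, y). H x y) \<in> borel_measurable (M \<Otimes>\<^sub>M N)" "w \<in> borel_measurable N"
    and W: "(\<integral>\<^sup>+ y. ennreal \<bar>w y\<bar> \<partial>N) \<le> ennreal W"
    and c: "\<And>y. y \<in> space N \<Longrightarrow> w y \<noteq> 0 \<Longrightarrow> Lp_norm M p (\<lambda>x. H x y) \<le> c"
  shows "Lp_norm M p (\<lambda>x. \<integral>y. w y *\<^sub>R H x y \<partial>N) \<le> ennreal W * c" (is ?A)
    and "c < top \<Longrightarrow> AE x in M. (\<integral>\<^sup>+ y. ennreal (norm (w y *\<^sub>R H x y)) \<partial>N) < top" (is "_ \<Longrightarrow> ?B")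
proof -
  interpret M: sigma_finite_measure M by fact
  interpret N: sigma_finite_measure N by fact
  interpret pair_sigma_finite M N ..
  let ?u = "\<lambda>x. \<integral>y. w y *\<^sub>R H x y \<partial>N"
  define G where "G x = (\<integral>\<^sup>+ y. ennreal \<bar>w y\<bar> * ennreal (norm (H x y)) \<partial>N)" for x
  have G_eq: "G x = (\<integral>\<^sup>+ y. ennreal (norm (w y *\<^sub>R H x y)) \<partial>N)" for x
    unfolding G_def by (simp add: ennreal_mult)
  have Gm [measurable]: "G \<in> borel_measurable M" unfolding G_def by measurable
  \<comment> \<open>Where the integrand is not integrable, the Bochner integral has the default
    value 0, so the bound by \<open>G\<close> holds at every \<open>x\<close>.\<close>
  have norm_le: "ennreal (norm (\<integral>y. w y *\<^sub>R H x y \<partial>N)) \<le> G x" for x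
  proof (cases "integrable N (\<lambda>y. w y *\<^sub>R H x y)")
    case True
    then show ?thesis unfolding G_eq by (rule integral_norm_bound_ennreal)
  qed (simp add: not_integrable_integral_eq)
  obtain V where V: "(\<integral>\<^sup>+ y. ennreal \<bar>w y\<bar> \<partial>N) = ennreal V" "0 \<le> V" "ennreal V \<le> ennreal W"
    using W by (cases "\<integral>\<^sup>+ y. ennreal \<bar>w y\<bar> \<partial>N") (auto simp: top_unique)
  have int_m [measurable]: "?u \<in> borel_measurable M" by measurable
  have "?A \<and> (c < top \<longrightarrow> ?B)"
  proof (cases "V = 0")
    \<comment> \<open>Jensen's inequality divides by the mass. A kernel of mass 0 vanishes almost
      everywhere, and so does the average.\<close>
    case True
    then have "AE y in N. ennreal \<bar>w y\<bar> = 0"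
      using V by (subst nn_integral_0_iff_AE[symmetric]) auto
    then have "G x = 0" if "x \<in> space M" for x
      unfolding G_def using that by (subst nn_integral_0_iff_AE) (auto elim: eventually_mono)
    then have G0: "AE x in M. G x = 0" by simp
    then have "AE x in M. ennreal (norm (\<integral>y. w y *\<^sub>R H x y \<partial>N)) = 0"
      using norm_le by (auto elim!: eventually_mono) (metis le_zero_eq ennreal_eq_0_iff norm_le_zero_iff)
    then have "Lp_norm M p ?u = Lp_norm M p (\<lambda>x. 0)"
      by (intro Lp_norm_cong_AE) (auto elim!: eventually_mono)
    also have "Lp_norm M p (\<lambda>x. 0) \<le> ennreal W * c"
      by (cases "p = \<infinity>") (auto simp: Lp_norm_def intro!: order_trans[OF esssup_I[where c = 0]])
    finally show ?thesis using G0 by (auto simp: G_eq elim: eventually_mono)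
  next
    case False
    then have V0: "0 < V" using V by simp
    show ?thesis
    proof (cases "p = \<infinity>")
      case True
      \<comment> \<open>The exceptional null set depends on \<open>y\<close>. Tonelli, in the form
        of exchanging the two almost-everywhere quantifiers, makes one null set of \<open>x\<close>
        out of these.\<close>
      have "AE y in N. AE x in M. w y \<noteq> 0 \<longrightarrow> ennreal (norm (H x y)) \<le> c"
      proof (rule AE_I2)
        fix y assume y: "y \<in> space N"
        then have [measurable]: "(\<lambda>x. H x y) \<in> borel_measurable M" by measurable
        show "AE x in M. w y \<noteq> 0 \<longrightarrow> ennreal (norm (H x y)) \<le> c"
          using c[OF y] True by (cases "w y = 0") (auto simp: Lp_norm_top_le_iff[symmetric])
      qed
      then have "AE x in M. AE y in N. w y \<noteq> 0 \<longrightarrow> ennreal (norm (H x y)) \<le> c"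
        by (subst AE_commute) auto
      then have GW: "AE x in M. G x \<le> ennreal W * c"
      proof (rule eventually_mono)
        fix x assume "AE y in N. w y \<noteq> 0 \<longrightarrow> ennreal (norm (H x y)) \<le> c"
        then have "G x \<le> (\<integral>\<^sup>+ y. ennreal \<bar>w y\<bar> * c \<partial>N)"
          unfolding G_def by (intro nn_integral_mono_AE) (auto elim!: eventually_mono intro: mult_left_mono)
        also have "\<dots> = ennreal V * c" using V by (simp add: nn_integral_multc)
        also have "\<dots> \<le> ennreal W * c" using V by (intro mult_right_mono) auto
        finally show "G x \<le> ennreal W * c" .
      qed
      then have ?A unfolding True
        using norm_le order_trans by (subst Lp_norm_top_le_iff) (auto elim!: eventually_mono)
      moreover have ?B if "c < top"
      proof -
        have "ennreal W * c < top" using that by (simp add: ennreal_mult_less_top)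
        with GW show ?thesis by (auto simp: G_eq elim!: eventually_mono)
      qed
      ultimately show ?thesis by simp
    next
      case False
      define P where "P = enn2real p"
      have P: "1 \<le> P" unfolding P_def using p False by (rule enn2real_ge_1)
      have "(\<integral>\<^sup>+ x. G x epowr P \<partial>M)
          \<le> (\<integral>\<^sup>+ x. ennreal (V powr (P - 1)) * (\<integral>\<^sup>+ y. ennreal \<bar>w y\<bar> * ennreal (norm (H x y)) epowr P \<partial>N) \<partial>M)"
        unfolding G_def using V V0 P by (intro nn_integral_mono nn_integral_epowr_le) auto
      also have "\<dots> = ennreal (V powr (P - 1)) * (\<integral>\<^sup>+ x. (\<integral>\<^sup>+ y. ennreal \<bar>w y\<bar> * ennreal (norm (H x y)) epowr P \<partial>N) \<partial>M)"
        by (rule nn_integral_cmult) measurable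
      also have "(\<integral>\<^sup>+ x. (\<integral>\<^sup>+ y. ennreal \<bar>w y\<bar> * ennreal (norm (H x y)) epowr P \<partial>N) \<partial>M)
          = (\<integral>\<^sup>+ y. (\<integral>\<^sup>+ x. ennreal \<bar>w y\<bar> * ennreal (norm (H x y)) epowr P \<partial>M) \<partial>N)"
        by (rule Fubini'[symmetric]) measurable
      also have "\<dots> \<le> (\<integral>\<^sup>+ y. ennreal \<bar>w y\<bar> * c epowr P \<partial>N)"
      proof (rule nn_integral_mono)
        fix y assume y: "y \<in> space N"
        then have [measurable]: "(\<lambda>x. H x y) \<in> borel_measurable M" by measurable
        show "(\<integral>\<^sup>+ x. ennreal \<bar>w y\<bar> * ennreal (norm (H x y)) epowr P \<partial>M) \<le> ennreal \<bar>w y\<bar> * c epowr P"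
        proof (cases "w y = 0")
          case False
          have "(\<integral>\<^sup>+ x. ennreal \<bar>w y\<bar> * ennreal (norm (H x y)) epowr P \<partial>M)
            = ennreal \<bar>w y\<bar> * (\<integral>\<^sup>+ x. ennreal (norm (H x y)) epowr P \<partial>M)"
            by (rule nn_integral_cmult) measurable
          also have "\<dots> \<le> ennreal \<bar>w y\<bar> * c epowr P"
            unfolding P_def
            by (intro mult_left_mono Lp_norm_le_iff[OF p \<open>p \<noteq> \<infinity>\<close>, THEN iffD1] c[OF y False]) auto
          finally show ?thesis .
        qed simp
      qed
      also have "\<dots> = ennreal V * c epowr P" using V by (simp add: nn_integral_multc)
      also have "ennreal (V powr (P - 1)) * (ennreal V * c epowr P) = (ennreal V * c) epowr P"
      proof -
        have "V powr (P - 1) * V = V powr P" using V0 by (simp add: powr_diff)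
        then have "ennreal (V powr (P - 1)) * ennreal V = ennreal (V powr P)"
          by (simp add: ennreal_mult[symmetric] V)
        then show ?thesis using V0 P by (simp add: epowr_mult mult.assoc[symmetric])
      qed
      finally have *: "(\<integral>\<^sup>+ x. G x epowr P \<partial>M) \<le> (ennreal V * c) epowr P"
        by (simp add: mult_left_mono)
      have "(\<integral>\<^sup>+ x. ennreal (norm (\<integral>y. w y *\<^sub>R H x y \<partial>N)) epowr P \<partial>M) \<le> (\<integral>\<^sup>+ x. G x epowr P \<partial>M)"
        using P by (intro nn_integral_mono epowr_mono norm_le) auto
      also note *
      also have "(ennreal V * c) epowr P \<le> (ennreal W * c) epowr P"
        using P V by (intro epowr_mono mult_right_mono) auto
      finally have ?A unfolding Lp_norm_le_iff[OF p False] by (simp add: P_def)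
      moreover have ?B if "c < top"
      proof -
        have "(ennreal V * c) epowr P < top"
          using that epowr_eq_top_iff by (metis ennreal_mult_less_top ennreal_less_top less_top)
        with * have "(\<integral>\<^sup>+ x. G x epowr P \<partial>M) \<noteq> \<infinity>" by (auto simp: top_unique)
        then have "AE x in M. G x epowr P \<noteq> \<infinity>" by (intro nn_integral_PInf_AE) auto
        then show ?thesis
          unfolding G_eq[symmetric] by (auto simp: epowr_eq_top_iff less_top elim!: eventually_mono)
      qed
      ultimately show ?thesis by simp
    qed
  qed
  then show ?A "c < top \<Longrightarrow> ?B" by blast+
qed

lemma Lp_norm_scaleR_le:
  assumes "1 \<le> p" and [measurable]: "f \<in> borel_measurable M"
  shows "Lp_norm M p (\<lambda>x. a *\<^sub>R f x) \<le> ennreal \<bar>a\<bar> * Lp_norm M p f"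
proof (cases "p = \<infinity>")
  case True
  have "AE x in M. ennreal (norm (f x)) \<le> Lp_norm M p f"
    unfolding True by (subst Lp_norm_top_le_iff[symmetric]) auto
  then show ?thesis
    unfolding True
    by (subst Lp_norm_top_le_iff) (auto simp: ennreal_mult elim!: eventually_mono intro: mult_left_mono)
next
  case False
  have P: "1 \<le> enn2real p" using assms(1) False by (rule enn2real_ge_1)
  have "(\<integral>\<^sup>+ x. ennreal (norm (a *\<^sub>R f x)) epowr enn2real p \<partial>M)
      = (\<integral>\<^sup>+ x. ennreal \<bar>a\<bar> epowr enn2real p * ennreal (norm (f x)) epowr enn2real p \<partial>M)"
    using P by (intro nn_integral_cong) (simp only: norm_scaleR ennreal_mult abs_ge_zero norm_ge_zero epowr_mult)
  also have "\<dots> = ennreal \<bar>a\<bar> epowr enn2real p * (\<integral>\<^sup>+ x. ennreal (norm (f x)) epowr enn2real p \<partial>M)"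
    by (rule nn_integral_cmult) measurable
  also have "\<dots> \<le> ennreal \<bar>a\<bar> epowr enn2real p * Lp_norm M p f epowr enn2real p"
    by (intro mult_left_mono Lp_norm_le_iff[OF assms(1) False, THEN iffD1]) auto
  also have "\<dots> = (ennreal \<bar>a\<bar> * Lp_norm M p f) epowr enn2real p"
    using P by (simp only: epowr_mult)
  finally show ?thesis by (simp only: Lp_norm_le_iff[OF assms(1) False])
qed

text \<open>The integral inequality on a two-point space: \<open>f + g\<close> combines
  \<open>f / a\<close> and \<open>g / b\<close>, both of norm at most 1, with the weights
  \<open>a\<close> and \<open>b\<close>.\<close>

lemma Lp_norm_add_le:
  assumes "sigma_finite_measure M" "1 \<le> p" and [measurable]: "f \<in> borel_measurable M" "g \<in> borel_measurable M"
  shows "Lp_norm M p (\<lambda>x. f x + g x) \<le> Lp_norm M p f + Lp_norm M p g"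
proof (rule ennreal_le_epsilon)
  fix e :: real assume "Lp_norm M p f + Lp_norm M p g < top" and e: "0 < e"
  then obtain A B where AB: "Lp_norm M p f = ennreal A" "0 \<le> A" "Lp_norm M p g = ennreal B" "0 \<le> B"
    by (cases "Lp_norm M p f"; cases "Lp_norm M p g") auto
  \<comment> \<open>The extra \<open>e / 2\<close> keeps both weights positive even when a norm is
    0.\<close>
  define a b where "a = A + e / 2" and "b = B + e / 2"
  have ab: "0 < a" "0 < b" using AB e by (auto simp: a_def b_def)
  have *: "Lp_norm M p (\<lambda>x. (1 / c) *\<^sub>R h x) \<le> 1"
    if "Lp_norm M p h \<le> ennreal c" "0 < c" and [measurable]: "h \<in> borel_measurable M" for c h
  proof -
    have "Lp_norm M p (\<lambda>x. (1 / c) *\<^sub>R h x) \<le> ennreal \<bar>1 / c\<bar> * Lp_norm M p h"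
      using assms(2) by (intro Lp_norm_scaleR_le) auto
    also have "\<dots> \<le> ennreal \<bar>1 / c\<bar> * ennreal c" using that by (intro mult_left_mono) auto
    also have "\<dots> = 1" using that by (simp add: ennreal_mult[symmetric] del: abs_divide)
    finally show ?thesis .
  qed
  let ?u = "\<lambda>x. \<integral>y. (if y then a else b) *\<^sub>R (if y then (1 / a) *\<^sub>R f x else (1 / b) *\<^sub>R g x) \<partial>count_space UNIV"
  have "Lp_norm M p ?u
      \<le> ennreal (a + b) * 1"
  proof (rule Lp_norm_integral_le[OF assms(1) _ assms(2)])
    show "sigma_finite_measure (count_space (UNIV :: bool set))"
      by (intro sigma_finite_measure_count_space_finite) simp
    show "(\<integral>\<^sup>+ y. ennreal \<bar>if y then a else b\<bar> \<partial>count_space UNIV) \<le> ennreal (a + b)"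
      using ab by (subst nn_integral_count_space_finite) (auto simp: UNIV_bool)
    show "Lp_norm M p (\<lambda>x. if y then (1 / a) *\<^sub>R f x else (1 / b) *\<^sub>R g x) \<le> 1" for y
      using *[of f a] *[of g b] AB ab e by (cases y) (auto simp: a_def b_def intro!: ennreal_leI)
  qed measurable
  also have "?u
      = (\<lambda>x. f x + g x)"
    using ab by (intro ext, subst lebesgue_integral_count_space_finite) (auto simp: UNIV_bool)
  finally show "Lp_norm M p (\<lambda>x. f x + g x) \<le> Lp_norm M p f + Lp_norm M p g + ennreal e"
    using AB e by (simp add: a_def b_def ac_simps flip: ennreal_plus)
qed

section \<open>Convolutions on translation-invariant spaces\<close>

lemma nn_integral_lborel_translate:
  fixes g :: "'a::euclidean_space \<Rightarrow> ennreal"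
  assumes [measurable]: "g \<in> borel_measurable borel"
  shows "(\<integral>\<^sup>+ x. g (x + h) \<partial>lborel) = (\<integral>\<^sup>+ x. g x \<partial>lborel)"
  by (subst (2) lborel_distr_plus[of h, symmetric]) (simp add: nn_integral_distr add.commute)

lemma integrable_lborel_translate_iff:
  fixes g :: "'a::euclidean_space \<Rightarrow> 'b::{banach, second_countable_topology}"
  assumes [measurable]: "g \<in> borel_measurable borel"
  shows "integrable lborel (\<lambda>x. g (x + h)) \<longleftrightarrow> integrable lborel g"
  by (subst (2) lborel_distr_plus[of h, symmetric]) (simp add: integrable_distr_eq add.commute)

lemma integral_lborel_translate:
  fixes g :: "'a::euclidean_space \<Rightarrow> 'b::{banach, second_countable_topology}"
  assumes [measurable]: "g \<in> borel_measurable borel"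
  shows "(\<integral>x. g (x + h) \<partial>lborel) = (\<integral>x. g x \<partial>lborel)"
  by (subst (2) lborel_distr_plus[of h, symmetric]) (simp add: integral_distr add.commute)

text \<open>Bounded with bounded support, hence integrable against every locally integrable
  function. The class is closed under sums, multiples and translates, which covers all kernels that
  occur.\<close>

definition averaging_kernel :: "('a::euclidean_space \<Rightarrow> real) \<Rightarrow> bool" where
  "averaging_kernel w \<longleftrightarrow> w \<in> borel_measurable borel \<and> (\<exists>C r. 0 \<le> r \<and> (\<forall>y. \<bar>w y\<bar> \<le> C * indicator (ball 0 r) y))"

lemma kernel_measurable [measurable_dest]: "averaging_kernel w \<Longrightarrow> w \<in> borel_measurable borel"
  by (simp add: averaging_kernel_def)

lemma kernel_bound:
  assumes "averaging_kernel w"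
  shows "\<exists>C r. 0 \<le> C \<and> 0 \<le> r \<and> (\<forall>y. \<bar>w y\<bar> \<le> C * indicator (ball 0 r) y)"
proof -
  obtain C r where Cr: "0 \<le> r" "\<And>y. \<bar>w y\<bar> \<le> C * indicator (ball 0 r) y"
    using assms by (auto simp: averaging_kernel_def)
  have "\<bar>w y\<bar> \<le> max C 0 * indicator (ball 0 r) y" for y
    using Cr(2)[of y] by (auto simp: indicator_def split: split_of_bool split_of_bool_asm)
  then show ?thesis using Cr(1) by (metis max.cobounded2)
qed

lemma kernelI:
  assumes "w \<in> borel_measurable borel" "\<And>y. \<bar>w y\<bar> \<le> C * indicator (ball 0 r) y"
  shows "averaging_kernel w"
proof -
  have "\<bar>w y\<bar> \<le> C * indicator (ball 0 (max r 0)) y" for y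
    using assms(2)[of y] by (cases "r \<le> 0") (simp_all add: max_def ball_empty)
  then show ?thesis using assms(1) unfolding averaging_kernel_def by (metis max.cobounded2)
qed

lemma kernel_zero [simp]: "averaging_kernel (\<lambda>y. 0)"
  by (rule kernelI[of _ 0 0]) simp_all

lemma kernel_cmult:
  assumes "averaging_kernel w"
  shows "averaging_kernel (\<lambda>y. a * w y)"
proof -
  obtain C r where C: "0 \<le> C" "0 \<le> r" "\<And>y. \<bar>w y\<bar> \<le> C * indicator (ball 0 r) y" using kernel_bound[OF assms] by blast
  have "\<bar>a * w y\<bar> \<le> (\<bar>a\<bar> * C) * indicator (ball 0 r) y" for y
    using mult_left_mono[OF C(3)[of y], of "\<bar>a\<bar>"] by (simp add: abs_mult mult.assoc)
  then show ?thesis using assms by (intro kernelI) (auto simp: kernel_measurable)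
qed

lemma kernel_add:
  assumes "averaging_kernel w" "averaging_kernel v"
  shows "averaging_kernel (\<lambda>y. w y + v y)"
proof -
  obtain C r where C: "0 \<le> C" "0 \<le> r" "\<And>y. \<bar>w y\<bar> \<le> C * indicator (ball 0 r) y" using kernel_bound[OF assms(1)] by blast
  obtain D q where D: "0 \<le> D" "0 \<le> q" "\<And>y. \<bar>v y\<bar> \<le> D * indicator (ball 0 q) y" using kernel_bound[OF assms(2)] by blast
  have "\<bar>w y + v y\<bar> \<le> (C + D) * indicator (ball 0 (max r q)) y" for y
    using C(1) C(3)[of y] D(1) D(3)[of y] abs_triangle_ineq[of "w y" "v y"]
    by (auto simp: indicator_def split: split_of_bool split_of_bool_asm)
  then show ?thesis using assms by (intro kernelI) (auto simp: kernel_measurable)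
qed

lemma kernel_sum:
  assumes "\<And>i. i \<in> I \<Longrightarrow> averaging_kernel (w i)"
  shows "averaging_kernel (\<lambda>y. \<Sum>i\<in>I. w i y)"
  using assms by (induction I rule: infinite_finite_induct) (auto intro: kernel_add)

lemma kernel_translate:
  assumes "averaging_kernel w"
  shows "averaging_kernel (\<lambda>y. w (y - h))"
proof -
  have [measurable]: "w \<in> borel_measurable borel" using assms by (rule kernel_measurable)
  obtain C r where C: "0 \<le> C" "0 \<le> r" "\<And>y. \<bar>w y\<bar> \<le> C * indicator (ball 0 r) y" using kernel_bound[OF assms] by blast
  have "\<bar>w (y - h)\<bar> \<le> C * indicator (ball 0 (r + norm h)) y" for y
    using C(3)[of "y - h"] C(1) norm_triangle_ineq2[of y h]
    by (auto simp: indicator_def split: split_of_bool split_of_bool_asm)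
  then show ?thesis using assms by (intro kernelI) (auto simp: kernel_measurable)
qed

lemma emeasure_lborel_ball_eq: "emeasure lborel (ball x r) = ennreal (measure lborel (ball x r))"
  by (rule emeasure_eq_ennreal_measure) (use emeasure_lborel_ball_finite[of x r] in auto)

lemma pred_mem_ball [measurable]: "Measurable.pred borel (\<lambda>y. y \<in> ball x r)"
  by (simp add: pred_def del: mem_ball)

text \<open>Strictly speaking a correlation, with \<open>f (x + y)\<close> in place of
  \<open>f (x - y)\<close>: translating the kernel by \<open>h\<close> then translates the result by
  the same \<open>h\<close>, without a change of sign.\<close>

definition convolve :: "('a::euclidean_space \<Rightarrow> real) \<Rightarrow> ('a \<Rightarrow> complex) \<Rightarrow> 'a \<Rightarrow> complex" where
  "convolve w f x = (\<integral>y. w y *\<^sub>R f (x + y) \<partial>lborel)"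

definition L1_norm :: "('a::euclidean_space \<Rightarrow> real) \<Rightarrow> ennreal" where
  "L1_norm w = (\<integral>\<^sup>+ y. ennreal \<bar>w y\<bar> \<partial>lborel)"

lemma convolve_measurable [measurable]:
  assumes [measurable]: "w \<in> borel_measurable borel" "f \<in> borel_measurable borel"
  shows "convolve w f \<in> borel_measurable borel"
proof -
  have "(\<lambda>x. \<integral>y. w y *\<^sub>R f (x + y) \<partial>lborel) \<in> borel_measurable (borel :: 'a measure)"
    by (intro lborel.borel_measurable_lebesgue_integral) measurable
  then show ?thesis by (simp add: convolve_def[abs_def])
qed

text \<open>The two instances are \<open>S = \<real>\<^sup>d\<close> without periods and \<open>S = [0, 2\<pi>)\<close> with the period \<open>2\<pi>\<close>.\<close>

locale translation_setting =
  fixes S :: "'a::euclidean_space set" and Per :: "'a set" and p :: ennreal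
  assumes S [measurable]: "S \<in> sets borel" and S_pos: "emeasure lborel S \<noteq> 0" and p: "1 \<le> p"
    and shift: "\<And>g :: 'a \<Rightarrow> ennreal. \<And>h. g \<in> borel_measurable borel \<Longrightarrow> (\<And>x z. z \<in> Per \<Longrightarrow> g (x + z) = g x)
      \<Longrightarrow> (\<integral>\<^sup>+ x\<in>S. g (x + h) \<partial>lborel) = (\<integral>\<^sup>+ x\<in>S. g x \<partial>lborel)"
begin

text \<open>A density rather than a restriction: the underlying space remains the whole space, so
  translates and averages are Borel functions for \<open>M\<close> without further ado.\<close>

definition M :: "'a measure" where "M = density lborel (indicator S)"

definition N :: "('a \<Rightarrow> complex) \<Rightarrow> ennreal" where "N f = Lp_norm M p f"

definition F :: "('a \<Rightarrow> complex) set" where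
  "F = {f \<in> borel_measurable borel. (\<forall>z\<in>Per. \<forall>x. f (x + z) = f x) \<and> N f < top}"

lemma sets_M [simp, measurable_cong]: "sets M = sets borel"
  by (simp add: M_def)

lemma space_M [simp]: "space M = UNIV"
  by (simp add: M_def)

lemma nn_integral_M: "g \<in> borel_measurable borel \<Longrightarrow> (\<integral>\<^sup>+ x. g x \<partial>M) = (\<integral>\<^sup>+ x\<in>S. g x \<partial>lborel)"
  unfolding M_def by (subst nn_integral_density) (auto simp: mult.commute)

lemma sigma_finite_M: "sigma_finite_measure M"
  unfolding M_def
  using sigma_finite_measure.sigma_finite_iff_density_finite'[OF sigma_finite_lborel, of "indicator S :: 'a \<Rightarrow> ennreal"]
  by (auto simp: indicator_def)

lemma F_measurable [measurable_dest]: "f \<in> F \<Longrightarrow> f \<in> borel_measurable borel"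
  by (simp add: F_def)

lemma F_periodic: "f \<in> F \<Longrightarrow> z \<in> Per \<Longrightarrow> f (x + z) = f x"
  by (simp add: F_def)

lemma N_finite: "f \<in> F \<Longrightarrow> N f < top"
  by (simp add: F_def)

lemma N_add:
  assumes "f \<in> F" "g \<in> F"
  shows "N (\<lambda>x. f x + g x) \<le> N f + N g"
  unfolding N_def using assms p sigma_finite_M by (intro Lp_norm_add_le) (simp_all add: F_measurable)

lemma N_scaleR:
  assumes "f \<in> F"
  shows "N (\<lambda>x. a *\<^sub>R f x) \<le> ennreal \<bar>a\<bar> * N f"
  unfolding N_def using assms p by (intro Lp_norm_scaleR_le) (simp_all add: F_measurable)

lemma F_add: "f \<in> F \<Longrightarrow> g \<in> F \<Longrightarrow> (\<lambda>x. f x + g x) \<in> F"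
  using N_add[of f g] by (auto simp: F_def intro: le_less_trans)

lemma F_scaleR: "f \<in> F \<Longrightarrow> (\<lambda>x. a *\<^sub>R f x) \<in> F"
  using N_scaleR[of f a] by (auto simp: F_def ennreal_mult_less_top intro: le_less_trans)

lemma F_diff: "f \<in> F \<Longrightarrow> g \<in> F \<Longrightarrow> (\<lambda>x. f x - g x) \<in> F"
  using F_add[OF _ F_scaleR[of g "-1"], of f] by simp

lemma N_diff:
  assumes "f \<in> F" "g \<in> F"
  shows "N (\<lambda>x. f x - g x) \<le> N f + N g"
proof -
  have "N (\<lambda>x. f x + (-1) *\<^sub>R g x) \<le> N f + N (\<lambda>x. (-1) *\<^sub>R g x)"
    using assms by (intro N_add F_scaleR)
  also have "\<dots> \<le> N f + N g" using N_scaleR[OF assms(2), of "-1"] by (intro add_left_mono) simp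
  finally show ?thesis by simp
qed

lemma F_zero: "(\<lambda>x. 0) \<in> F"
proof -
  have "esssup M (\<lambda>x. 0 :: ennreal) \<le> 0" by (rule esssup_I) auto
  then have "N (\<lambda>x. 0) \<le> 0"
    unfolding N_def by (cases "p = \<infinity>") (auto simp: Lp_norm_def)
  then show ?thesis by (simp add: F_def)
qed

lemma N_zero: "N (\<lambda>x. 0) = 0"
  using N_scaleR[OF F_zero, of 0] by simp

text \<open>The locale provides invariance of integrals only. For null sets, as needed when
  \<open>p = \<infinity>\<close>, it is recovered by integrating the indicator of the exceptional
  set.\<close>

lemma AE_M_translate:
  assumes [measurable]: "Measurable.pred borel Q" and "\<And>x z. z \<in> Per \<Longrightarrow> Q (x + z) = Q x"
  shows "(AE x in M. Q (x + h)) \<longleftrightarrow> (AE x in M. Q x)"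
proof -
  define g where "g x = (if Q x then 0 else 1 :: ennreal)" for x
  have [measurable]: "g \<in> borel_measurable borel" unfolding g_def by measurable
  have eq: "(AE x in M. Q (x + h)) \<longleftrightarrow> (\<integral>\<^sup>+ x\<in>S. g (x + h) \<partial>lborel) = 0" for h
  proof -
    have "(\<integral>\<^sup>+ x. g (x + h) \<partial>M) = 0 \<longleftrightarrow> (AE x in M. g (x + h) = 0)"
      by (rule nn_integral_0_iff_AE) measurable
    then show ?thesis by (subst (asm) nn_integral_M) (auto simp: g_def)
  qed
  have "(\<integral>\<^sup>+ x\<in>S. g (x + h) \<partial>lborel) = (\<integral>\<^sup>+ x\<in>S. g (x + 0) \<partial>lborel)"
    using assms(2) by (subst shift) (auto simp: g_def)
  then show ?thesis using eq[of h] eq[of 0] by simp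
qed

lemma N_translate:
  assumes "f \<in> F"
  shows "N (\<lambda>x. f (x + h)) = N f"
proof (cases "p = \<infinity>")
  case True
  have [measurable]: "f \<in> borel_measurable borel"  using assms by (simp_all add: F_measurable kernel_measurable)
  have "N (\<lambda>x. f (x + h)) \<le> c \<longleftrightarrow> N f \<le> c" for c
  proof -
    have "(AE x in M. ennreal (norm (f (x + h))) \<le> c) \<longleftrightarrow> (AE x in M. ennreal (norm (f x)) \<le> c)"
      using assms by (intro AE_M_translate) (auto simp: F_periodic)
    then show ?thesis unfolding N_def unfolding \<open>p = \<infinity>\<close>
      by (subst (1 2) Lp_norm_top_le_iff) auto
  qed
  then show ?thesis by (meson order_antisym order_refl)
next
  case False
  have [measurable]: "f \<in> borel_measurable borel"  using assms by (simp_all add: F_measurable kernel_measurable)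
  define g where "g x = ennreal (norm (f x)) epowr enn2real p" for x
  have [measurable]: "g \<in> borel_measurable borel" unfolding g_def by measurable
  have "(\<integral>\<^sup>+ x. g (x + h) \<partial>M) = (\<integral>\<^sup>+ x\<in>S. g (x + h) \<partial>lborel)"
    by (rule nn_integral_M) measurable
  also have "\<dots> = (\<integral>\<^sup>+ x\<in>S. g x \<partial>lborel)"
    using F_periodic[OF assms] by (intro shift) (auto simp: g_def)
  also have "\<dots> = (\<integral>\<^sup>+ x. g x \<partial>M)"
    by (rule nn_integral_M[symmetric]) measurable
  finally show ?thesis unfolding N_def Lp_norm_finite_exponent[OF False] g_def by simp
qed

lemma F_translate:
  assumes "f \<in> F"
  shows "(\<lambda>x. f (x + h)) \<in> F"
proof -
  have [measurable]: "f \<in> borel_measurable borel" using assms by (rule F_measurable)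
  have "f (x + z + h) = f (x + h)" if "z \<in> Per" for x z
    using F_periodic[OF assms that, of "x + h"] by (simp add: ac_simps)
  moreover have "N (\<lambda>x. f (x + h)) < top" using N_translate[OF assms] N_finite[OF assms] by simp
  ultimately show ?thesis by (simp add: F_def)
qed

lemma N_average:
  fixes w :: "'a \<Rightarrow> real"
  assumes "(\<lambda>(x, y). H x y) \<in> borel_measurable (borel \<Otimes>\<^sub>M borel)" "w \<in> borel_measurable borel"
    and "L1_norm w \<le> ennreal W" "\<And>y. w y \<noteq> 0 \<Longrightarrow> N (\<lambda>x. H x y) \<le> c"
  shows "N (\<lambda>x. \<integral>y. w y *\<^sub>R H x y \<partial>lborel) \<le> ennreal W * c"
    and "c < top \<Longrightarrow> AE x in M. (\<integral>\<^sup>+ y. ennreal (norm (w y *\<^sub>R H x y)) \<partial>lborel) < top"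
proof -
  have [measurable]: "(\<lambda>(x, y). H x y) \<in> borel_measurable (M \<Otimes>\<^sub>M lborel)"
    using assms(1) by (subst measurable_cong_sets[OF sets_pair_measure_cong refl]) auto
  note * = Lp_norm_integral_le[of M "lborel :: 'a measure" p H w W c]
  show "N (\<lambda>x. \<integral>y. w y *\<^sub>R H x y \<partial>lborel) \<le> ennreal W * c"
    unfolding N_def using assms sigma_finite_M sigma_finite_lborel p
    by (intro *(1)) (auto simp: N_def L1_norm_def)
  show "AE x in M. (\<integral>\<^sup>+ y. ennreal (norm (w y *\<^sub>R H x y)) \<partial>lborel) < top" if "c < top"
    using assms sigma_finite_M sigma_finite_lborel p that
    by (intro *(2)) (auto simp: N_def L1_norm_def)
qed

lemma N_convolve:
  assumes "w \<in> borel_measurable borel" "L1_norm w \<le> ennreal W" "f \<in> F"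
  shows "N (convolve w f) \<le> ennreal W * N f"
proof -
  have [measurable]: "f \<in> borel_measurable borel"  using assms by (simp_all add: F_measurable kernel_measurable)
  have "N (\<lambda>x. \<integral>y. w y *\<^sub>R f (x + y) \<partial>lborel) \<le> ennreal W * N f"
    using assms by (intro N_average) (auto simp: N_translate)
  then show ?thesis by (simp add: convolve_def[abs_def])
qed

text \<open>No counting of periods is involved. Absolute convergence in Minkowski's inequality shows
  that almost every centre in \<open>S\<close> has \<open>f\<close> integrable over all its balls of
  integer radius; since \<open>S\<close> is not null such a centre \<open>x0\<close> exists, and
  every ball lies in a large ball about \<open>x0\<close>.\<close>

lemma integrable_ball:
  assumes "f \<in> F"
  shows "integrable lborel (\<lambda>y. indicator (ball x r) y *\<^sub>R f y)"
proof -
  have [measurable]: "f \<in> borel_measurable borel"  using assms by (simp_all add: F_measurable kernel_measurable)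
  have "AE x in M. (\<integral>\<^sup>+ y. ennreal (norm (indicator (ball 0 (real n)) y *\<^sub>R f (x + y))) \<partial>lborel) < top" for n
  proof (rule N_average(2)[where W = "measure lborel (ball 0 (real n))" and c = "N f"])
    show "L1_norm (indicator (ball (0::'a) (real n))) \<le> ennreal (measure lborel (ball (0::'a) (real n)))"
      by (simp add: L1_norm_def ennreal_indicator emeasure_lborel_ball_eq)
    show "indicator (ball (0::'a) (real n)) \<in> borel_measurable borel" by measurable
    show "(\<lambda>(x, y). f (x + y)) \<in> borel_measurable (borel \<Otimes>\<^sub>M borel)" by measurable
    show "N (\<lambda>x. f (x + y)) \<le> N f" for y using assms by (simp add: N_translate)
    show "N f < top" using assms by (rule N_finite)
  qed
  then have "AE x in M. \<forall>n. (\<integral>\<^sup>+ y. ennreal (norm (indicator (ball 0 (real n)) y *\<^sub>R f (x + y))) \<partial>lborel) < top"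
    by (simp add: AE_all_countable)
  moreover have "ae_filter M \<noteq> bot"
    using S_pos by (simp add: ae_filter_eq_bot_iff M_def emeasure_density)
  ultimately obtain x0 where x0: "\<And>n. (\<integral>\<^sup>+ y. ennreal (norm (indicator (ball 0 (real n)) y *\<^sub>R f (x0 + y))) \<partial>lborel) < top"
    using eventually_happens'[of "ae_filter M"] by blast
  obtain n where n: "norm (x - x0) + r < real n" using reals_Archimedean2 by blast
  have "integrable lborel (\<lambda>y. indicator (ball 0 (real n)) y *\<^sub>R f (x0 + y))"
    using x0[of n] by (intro integrableI_bounded) auto
  then have "integrable lborel (\<lambda>y. indicator (ball 0 (real n)) (y + (- x0)) *\<^sub>R f (x0 + (y + (- x0))))"
    by (subst integrable_lborel_translate_iff[where g = "\<lambda>y. indicator (ball 0 (real n)) y *\<^sub>R f (x0 + y)"]) auto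
  then show ?thesis
  proof (rule Bochner_Integration.integrable_bound)
    have "ball x r \<subseteq> ball x0 (real n)"
      using n by (auto simp: dist_norm norm_minus_commute) (smt (verit) norm_triangle_ineq norm_minus_commute diff_add_cancel add_diff_eq)
    then show "AE y in lborel. norm (indicator (ball x r) y *\<^sub>R f y)
        \<le> norm (indicator (ball 0 (real n)) (y + (- x0)) *\<^sub>R f (x0 + (y + (- x0))))"
      by (intro AE_I2) (auto simp: indicator_def dist_norm norm_minus_commute subset_iff)
  qed measurable
qed

lemma integrable_kernel:
  assumes "f \<in> F" "averaging_kernel w"
  shows "integrable lborel (\<lambda>y. w y *\<^sub>R f (x + y))"
proof -
  have [measurable]: "f \<in> borel_measurable borel"  using assms by (simp_all add: F_measurable kernel_measurable)
  obtain C r where C: "0 \<le> C" "0 \<le> r" "\<And>y. \<bar>w y\<bar> \<le> C * indicator (ball 0 r) y" using kernel_bound[OF assms(2)] by blast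
  have "integrable lborel (\<lambda>y. indicator (ball x r) (y + x) *\<^sub>R f (y + x))"
    using integrable_ball[OF assms(1), of x r]
    by (subst integrable_lborel_translate_iff[where g = "\<lambda>y. indicator (ball x r) y *\<^sub>R f y"]) auto
  then have "integrable lborel (\<lambda>y. C *\<^sub>R (indicator (ball x r) (y + x) *\<^sub>R f (y + x)))"
    by (intro integrable_scaleR_right)
  then show ?thesis
  proof (rule Bochner_Integration.integrable_bound)
    show "AE y in lborel. norm (w y *\<^sub>R f (x + y)) \<le> norm (C *\<^sub>R (indicator (ball x r) (y + x) *\<^sub>R f (y + x)))"
    proof (rule AE_I2)
      fix y
      have "norm (w y *\<^sub>R f (x + y)) \<le> C * indicator (ball 0 r) y * norm (f (x + y))"
        using C(3)[of y] by (simp add: mult_right_mono)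
      also have "\<dots> = norm (C *\<^sub>R (indicator (ball x r) (y + x) *\<^sub>R f (y + x)))"
        using C(1) by (auto simp: indicator_def dist_norm add.commute)
      finally show "norm (w y *\<^sub>R f (x + y)) \<le> norm (C *\<^sub>R (indicator (ball x r) (y + x) *\<^sub>R f (y + x)))" .
    qed
  qed (use assms kernel_measurable in auto)
qed

lemma kernel_L1_finite:
  fixes w :: "'a \<Rightarrow> real"
  assumes "averaging_kernel w"
  obtains W where "0 \<le> W" "L1_norm w \<le> ennreal W"
proof -
  obtain C r where C: "0 \<le> C" "0 \<le> r" "\<And>y. \<bar>w y\<bar> \<le> C * indicator (ball 0 r) y" using kernel_bound[OF assms] by blast
  have "L1_norm w \<le> (\<integral>\<^sup>+ y. ennreal C * indicator (ball (0::'a) r) y \<partial>lborel)"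
    unfolding L1_norm_def
  proof (rule nn_integral_mono)
    fix y show "ennreal \<bar>w y\<bar> \<le> ennreal C * indicator (ball 0 r) y"
      using C(1) C(3)[of y] by (cases "y \<in> ball 0 r") (auto simp: ennreal_leI)
  qed
  also have "\<dots> = ennreal (C * measure lborel (ball (0::'a) r))"
    using C by (simp add: nn_integral_cmult_indicator ennreal_mult emeasure_lborel_ball_eq)
  finally show thesis using C by (intro that[of "C * measure lborel (ball (0::'a) r)"]) auto
qed

lemma F_convolve:
  assumes "averaging_kernel w" "f \<in> F"
  shows "convolve w f \<in> F"
proof -
  obtain W where W: "0 \<le> W" "L1_norm w \<le> ennreal W" using kernel_L1_finite[OF assms(1)] by blast
  have "N (convolve w f) \<le> ennreal W * N f" using assms W by (intro N_convolve) (simp_all add: kernel_measurable)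
  also have "\<dots> < top" using N_finite[OF assms(2)] by (simp add: ennreal_mult_less_top)
  moreover have "convolve w f (x + z) = convolve w f x" if "z \<in> Per" for x z
    using F_periodic[OF assms(2) that, of "x + y" for y] by (simp add: convolve_def ac_simps)
  ultimately show ?thesis using assms by (auto simp: F_def)
qed

lemma convolve_diff: "averaging_kernel w \<Longrightarrow> f \<in> F \<Longrightarrow> g \<in> F \<Longrightarrow> convolve w (\<lambda>x. f x - g x) = (\<lambda>x. convolve w f x - convolve w g x)"
  by (simp add: convolve_def[abs_def] scaleR_diff_right integrable_kernel)

lemma convolve_kernel_diff:
  "averaging_kernel w \<Longrightarrow> averaging_kernel v \<Longrightarrow> f \<in> F \<Longrightarrow> convolve (\<lambda>y. w y - v y) f = (\<lambda>x. convolve w f x - convolve v f x)"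
  by (simp add: convolve_def[abs_def] scaleR_diff_left integrable_kernel)

lemma convolve_kernel_sum:
  assumes "f \<in> F" "\<And>i. i \<in> I \<Longrightarrow> averaging_kernel (w i)"
  shows "convolve (\<lambda>y. \<Sum>i\<in>I. w i y) f x = (\<Sum>i\<in>I. convolve (w i) f x)"
  using assms by (simp add: convolve_def scaleR_sum_left integrable_kernel)

lemma convolve_kernel_cmult: "convolve (\<lambda>y. a * w y) f x = a *\<^sub>R convolve w f x"
  by (simp add: convolve_def flip: scaleR_scaleR)

lemma convolve_translate: "convolve w (\<lambda>x. f (x + h)) x = convolve w f (x + h)"
  by (simp add: convolve_def ac_simps)

lemma convolve_kernel_translate:
  assumes "averaging_kernel w" "f \<in> F"
  shows "convolve (\<lambda>y. w (y - h)) f x = convolve w f (x + h)"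
proof -
  have [measurable]: "f \<in> borel_measurable borel" "w \<in> borel_measurable borel"
    using assms by (simp_all add: F_measurable kernel_measurable)
  have "(\<integral>y. w (y - h) *\<^sub>R f (x + y) \<partial>lborel) = (\<integral>y. w (y + h - h) *\<^sub>R f (x + (y + h)) \<partial>lborel)"
    by (subst integral_lborel_translate[where g = "\<lambda>y. w (y - h) *\<^sub>R f (x + y)"]) auto
  then show ?thesis by (simp add: convolve_def ac_simps)
qed

text \<open>Fubini at every single \<open>x\<close>: the product of the kernels vanishes unless
  \<open>x + y + z\<close> lies in \<open>ball x (r + q)\<close>, where \<open>f\<close> is
  integrable. Hence smoothing operators at different scales commute as maps of functions, and not
  merely up to null sets.\<close>

lemma convolve_commute:
  assumes "averaging_kernel w" "averaging_kernel v" and f: "f \<in> F"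
  shows "convolve w (convolve v f) = convolve v (convolve w f)"
proof
  fix x
  have [measurable]: "f \<in> borel_measurable borel" "w \<in> borel_measurable borel" "v \<in> borel_measurable borel" using assms by (simp_all add: F_measurable kernel_measurable)
  obtain C r where C: "0 \<le> C" "0 \<le> r" "\<And>y. \<bar>w y\<bar> \<le> C * indicator (ball 0 r) y" using kernel_bound[OF assms(1)] by blast
  obtain D q where D: "0 \<le> D" "0 \<le> q" "\<And>y. \<bar>v y\<bar> \<le> D * indicator (ball 0 q) y" using kernel_bound[OF assms(2)] by blast
  define B where "B = (\<integral>\<^sup>+ u. ennreal (norm (indicator (ball x (r + q)) u *\<^sub>R f u)) \<partial>lborel)"
  have B: "B < top" unfolding B_def using integrable_ball[OF f] by (simp add: integrable_iff_bounded)
  define J where "J u = ennreal (norm (indicator (ball x (r + q)) u *\<^sub>R f u))" for u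
  have [measurable]: "J \<in> borel_measurable borel" unfolding J_def by measurable
  let ?h = "\<lambda>y z. (w y * v z) *\<^sub>R f (x + y + z)"
  have "(\<integral>\<^sup>+ y. (\<integral>\<^sup>+ z. ennreal (norm (?h y z)) \<partial>lborel) \<partial>lborel) \<le> (\<integral>\<^sup>+ y. ennreal \<bar>w y\<bar> * (ennreal D * B) \<partial>lborel)"
  proof (rule nn_integral_mono)
    fix y
    have "(\<integral>\<^sup>+ z. ennreal (norm (?h y z)) \<partial>lborel)
      \<le> (\<integral>\<^sup>+ z. ennreal \<bar>w y\<bar> * (ennreal D * J (z + (x + y))) \<partial>lborel)"
    proof (rule nn_integral_mono)
      fix z
      have "norm (?h y z) \<le> \<bar>w y\<bar> * (D * norm (indicator (ball x (r + q)) (z + (x + y)) *\<^sub>R f (z + (x + y))))"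
      proof (cases "norm y < r \<and> norm z < q")
        case True
        then have "z + (x + y) \<in> ball x (r + q)"
          using norm_triangle_ineq[of y z] by (simp add: dist_norm norm_minus_commute algebra_simps)
        moreover have "\<bar>v z\<bar> \<le> D" using D(3)[of z] True by simp
        ultimately show ?thesis
          by (simp add: abs_mult mult.assoc ac_simps mult_left_mono mult_right_mono)
      next
        case False
        then have "w y = 0 \<or> v z = 0" using C(3)[of y] D(3)[of z] by auto
        then show ?thesis using D(1) by auto
      qed
      then show "ennreal (norm (?h y z)) \<le> ennreal \<bar>w y\<bar> * (ennreal D * J (z + (x + y)))"
        unfolding J_def using D(1) by (simp only: ennreal_mult[symmetric] abs_ge_zero norm_ge_zero mult_nonneg_nonneg ennreal_leI)
    qed
    also have "\<dots> = ennreal \<bar>w y\<bar> * (\<integral>\<^sup>+ z. ennreal D * J (z + (x + y)) \<partial>lborel)"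
      by (rule nn_integral_cmult) measurable
    also have "(\<integral>\<^sup>+ z. ennreal D * J (z + (x + y)) \<partial>lborel) = ennreal D * (\<integral>\<^sup>+ z. J (z + (x + y)) \<partial>lborel)"
      by (rule nn_integral_cmult) measurable
    also have "(\<integral>\<^sup>+ z. J (z + (x + y)) \<partial>lborel) = B"
      unfolding B_def J_def[symmetric] by (rule nn_integral_lborel_translate) measurable
    finally show "(\<integral>\<^sup>+ z. ennreal (norm (?h y z)) \<partial>lborel) \<le> ennreal \<bar>w y\<bar> * (ennreal D * B)" .
  qed
  also have "\<dots> = L1_norm w * (ennreal D * B)"
    unfolding L1_norm_def by (rule nn_integral_multc) measurable
  also have "\<dots> < top"
  proof -
    obtain W where "L1_norm w \<le> ennreal W" using kernel_L1_finite[OF assms(1)] by blast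
    then have "L1_norm w < top" by (rule le_less_trans) simp
    then show ?thesis using B by (simp add: ennreal_mult_less_top)
  qed
  finally have fin: "(\<integral>\<^sup>+ y. (\<integral>\<^sup>+ z. ennreal (norm (?h y z)) \<partial>lborel) \<partial>lborel) < top" .
  have "integrable (lborel \<Otimes>\<^sub>M lborel) (\<lambda>(y, z). ?h y z)"
  proof (rule integrableI_bounded)
    have "(\<integral>\<^sup>+ u. ennreal (norm (case u of (y, z) \<Rightarrow> ?h y z)) \<partial>(lborel \<Otimes>\<^sub>M lborel))
      = (\<integral>\<^sup>+ y. (\<integral>\<^sup>+ z. ennreal (norm (?h y z)) \<partial>lborel) \<partial>lborel)"
      by (subst lborel.nn_integral_fst[symmetric]) auto
    with fin show "(\<integral>\<^sup>+ u. ennreal (norm (case u of (y, z) \<Rightarrow> ?h y z)) \<partial>(lborel \<Otimes>\<^sub>M lborel)) < \<infinity>" by simp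
  qed measurable
  then have "(\<integral>z. (\<integral>y. ?h y z \<partial>lborel) \<partial>lborel) = (\<integral>y. (\<integral>z. ?h y z \<partial>lborel) \<partial>lborel)"
    by (rule lborel_pair.Fubini_integral)
  moreover have "convolve w (convolve v f) x = (\<integral>y. (\<integral>z. ?h y z \<partial>lborel) \<partial>lborel)"
    by (simp add: convolve_def flip: scaleR_scaleR)
  moreover have "convolve v (convolve w f) x = (\<integral>z. (\<integral>y. ?h y z \<partial>lborel) \<partial>lborel)"
    by (simp add: convolve_def ac_simps flip: scaleR_scaleR)
  ultimately show "convolve w (convolve v f) x = convolve v (convolve w f) x" by simp
qed

end

section \<open>Ball averages as smoothing operators\<close>

lemma measure_lborel_ball:
  "0 \<le> r \<Longrightarrow> measure lborel (ball (x :: 'a::euclidean_space) r) = unit_ball_vol (real DIM('a)) * r ^ DIM('a)"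
  by (rule content_ball)

text \<open>The mean value bound \<open>n * a ^ (n - 1) * (a - b)\<close> for a difference of
  powers, multiplied by \<open>a\<close> so that the exponent \<open>n - 1\<close> does not
  occur.\<close>

lemma power_diff_le:
  fixes a b :: real
  assumes "0 \<le> b" "b \<le> a"
  shows "a * (a ^ n - b ^ n) \<le> real n * a ^ n * (a - b)"
proof (induction n)
  case (Suc n)
  have "a * (a ^ Suc n - b ^ Suc n) = a * (a * (a ^ n - b ^ n)) + a * (b ^ n * (a - b))"
    by (simp add: algebra_simps)
  also have "\<dots> \<le> a * (real n * a ^ n * (a - b)) + a * (a ^ n * (a - b))"
    using assms by (intro add_mono mult_left_mono mult_right_mono Suc.IH power_mono) auto
  also have "\<dots> = real (Suc n) * a ^ Suc n * (a - b)" by (simp add: algebra_simps)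
  finally show ?case .
qed simp

definition ball_kernel :: "real \<Rightarrow> 'a::euclidean_space \<Rightarrow> real" where
  "ball_kernel t y = indicator (ball 0 t) y / measure lborel (ball (0 :: 'a) t)"

lemma borel_measurable_ball_kernel [measurable]: "ball_kernel t \<in> borel_measurable borel"
  unfolding ball_kernel_def by measurable

lemma averaging_kernel_ball_kernel: "averaging_kernel (ball_kernel t)"
  by (rule kernelI[of _ "1 / measure lborel (ball (0 :: 'a) t)" t]) (simp_all add: ball_kernel_def)

lemma L1_norm_ball_kernel:
  assumes "0 < t"
  shows "L1_norm (ball_kernel t :: 'a::euclidean_space \<Rightarrow> real) = 1"
proof -
  define V where "V = measure lborel (ball (0 :: 'a) t)"
  have V: "0 < V" unfolding V_def using assms by (rule content_ball_pos)
  have "L1_norm (ball_kernel t :: 'a \<Rightarrow> real) = (\<integral>\<^sup>+ y. ennreal (1 / V) * indicator (ball (0 :: 'a) t) y \<partial>lborel)"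
    unfolding L1_norm_def ball_kernel_def V_def[symmetric] using V
    by (intro nn_integral_cong) (simp add: indicator_def)
  also have "\<dots> = ennreal (1 / V) * ennreal V"
    by (subst nn_integral_cmult_indicator) (simp_all add: emeasure_lborel_ball_eq V_def)
  also have "\<dots> = 1" using V by (simp add: ennreal_mult[symmetric])
  finally show ?thesis .
qed

lemma L1_norm_translate:
  fixes w :: "'a::euclidean_space \<Rightarrow> real"
  assumes [measurable]: "w \<in> borel_measurable borel"
  shows "L1_norm (\<lambda>y. w (y - h)) = L1_norm w"
  unfolding L1_norm_def using nn_integral_lborel_translate[of "\<lambda>y. ennreal \<bar>w y\<bar>" "- h"] by simp

lemma L1_norm_diff_le:
  fixes w v :: "'a::euclidean_space \<Rightarrow> real"
  assumes [measurable]: "w \<in> borel_measurable borel" "v \<in> borel_measurable borel"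
  shows "L1_norm (\<lambda>y. w y - v y) \<le> L1_norm w + L1_norm v"
proof -
  have "L1_norm (\<lambda>y. w y - v y) \<le> (\<integral>\<^sup>+ y. ennreal \<bar>w y\<bar> + ennreal \<bar>v y\<bar> \<partial>lborel)"
    unfolding L1_norm_def
    by (intro nn_integral_mono) (simp add: ennreal_plus[symmetric] abs_triangle_ineq4 del: ennreal_plus)
  also have "\<dots> = L1_norm w + L1_norm v" unfolding L1_norm_def by (rule nn_integral_add) measurable
  finally show ?thesis .
qed

lemma L1_norm_sum_le:
  fixes w :: "'i \<Rightarrow> 'a::euclidean_space \<Rightarrow> real"
  assumes "finite I" and [measurable]: "\<And>i. i \<in> I \<Longrightarrow> w i \<in> borel_measurable borel"
    and W: "\<And>i. i \<in> I \<Longrightarrow> L1_norm (w i) \<le> ennreal W" and "0 \<le> W"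
  shows "L1_norm (\<lambda>y. \<Sum>i\<in>I. c i * w i y) \<le> ennreal ((\<Sum>i\<in>I. \<bar>c i\<bar>) * W)"
proof -
  have "L1_norm (\<lambda>y. \<Sum>i\<in>I. c i * w i y) \<le> (\<integral>\<^sup>+ y. (\<Sum>i\<in>I. ennreal \<bar>c i\<bar> * ennreal \<bar>w i y\<bar>) \<partial>lborel)"
    unfolding L1_norm_def
  proof (rule nn_integral_mono)
    fix y
    have "\<bar>\<Sum>i\<in>I. c i * w i y\<bar> \<le> (\<Sum>i\<in>I. \<bar>c i\<bar> * \<bar>w i y\<bar>)"
      using sum_abs[of "\<lambda>i. c i * w i y" I] by (simp add: abs_mult)
    then show "ennreal \<bar>\<Sum>i\<in>I. c i * w i y\<bar> \<le> (\<Sum>i\<in>I. ennreal \<bar>c i\<bar> * ennreal \<bar>w i y\<bar>)"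
      by (simp add: ennreal_mult[symmetric] sum_ennreal ennreal_leI)
  qed
  also have "\<dots> = (\<Sum>i\<in>I. \<integral>\<^sup>+ y. ennreal \<bar>c i\<bar> * ennreal \<bar>w i y\<bar> \<partial>lborel)"
    by (rule nn_integral_sum) measurable
  also have "\<dots> = (\<Sum>i\<in>I. ennreal \<bar>c i\<bar> * L1_norm (w i))"
    unfolding L1_norm_def by (intro sum.cong refl nn_integral_cmult) measurable
  also have "\<dots> \<le> (\<Sum>i\<in>I. ennreal \<bar>c i\<bar> * ennreal W)"
    by (intro sum_mono mult_left_mono W) auto
  also have "\<dots> = ennreal ((\<Sum>i\<in>I. \<bar>c i\<bar>) * W)"
    using \<open>0 \<le> W\<close> by (simp add: ennreal_mult[symmetric] sum_ennreal sum_distrib_right)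
  finally show ?thesis .
qed

text \<open>The symmetric difference of a ball and its translate lies in a thin spherical shell.\<close>

lemma L1_norm_ball_kernel_translate:
  fixes h :: "'a::euclidean_space"
  assumes t: "0 < t"
  shows "L1_norm (\<lambda>y. ball_kernel t (y - h) - ball_kernel t y) \<le> ennreal (real DIM('a) * 2 ^ (DIM('a) + 1) * (norm h / t))"
proof (cases "norm h \<le> t")
  case True
  define v where "v = unit_ball_vol (real DIM('a))"
  have v: "0 < v" by (simp add: v_def)
  define x where "x = norm h"
  define d where "d = DIM('a)"
  define A where "A = ball (0 :: 'a) (t + x) - ball 0 (t - x)"
  have x: "0 \<le> x" "x \<le> t" using True by (auto simp: x_def)
  have A: "emeasure lborel A = ennreal (v * (t + x) ^ d - v * (t - x) ^ d)"
  proof -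
    have "emeasure lborel A = emeasure lborel (ball (0 :: 'a) (t + x)) - emeasure lborel (ball (0 :: 'a) (t - x))"
      unfolding A_def using x emeasure_lborel_ball_finite[of "0 :: 'a" "t - x"]
      by (intro emeasure_Diff) (auto simp: subset_ball)
    then show ?thesis
      using x t v by (simp add: emeasure_lborel_ball_eq measure_lborel_ball v_def d_def ennreal_minus)
  qed
  have "L1_norm (\<lambda>y. ball_kernel t (y - h) - ball_kernel t y) \<le> (\<integral>\<^sup>+ y. ennreal (1 / (v * t ^ d)) * indicator A y \<partial>lborel)"
    unfolding L1_norm_def
  proof (rule nn_integral_mono)
    fix y :: 'a
    have "ball_kernel t (y - h) - ball_kernel t y = (indicator (ball 0 t) (y - h) - indicator (ball 0 t) y) / (v * t ^ d)"
      using t by (simp add: ball_kernel_def measure_lborel_ball v_def d_def diff_divide_distrib)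
    moreover have "\<bar>indicator (ball 0 t) (y - h) - indicator (ball 0 t) y\<bar> \<le> (indicator A y :: real)"
      using norm_triangle_ineq2[of y h] norm_triangle_ineq4[of y h]
      by (auto simp: A_def x_def split: split_indicator)
    ultimately show "ennreal \<bar>ball_kernel t (y - h) - ball_kernel t y\<bar> \<le> ennreal (1 / (v * t ^ d)) * indicator A y"
      using v t
      by (auto simp: indicator_def abs_mult divide_right_mono intro!: ennreal_leI split: split_of_bool split_of_bool_asm)
  qed
  also have "\<dots> = ennreal (1 / (v * t ^ d)) * emeasure lborel A"
    by (rule nn_integral_cmult_indicator) (simp add: A_def)
  also have "\<dots> = ennreal (((t + x) ^ d - (t - x) ^ d) / t ^ d)"
  proof -
    have "(t - x) ^ d \<le> (t + x) ^ d" using x by (intro power_mono) auto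
    then have "ennreal (1 / (v * t ^ d)) * ennreal (v * (t + x) ^ d - v * (t - x) ^ d)
      = ennreal (1 / (v * t ^ d) * (v * (t + x) ^ d - v * (t - x) ^ d))"
      using v t by (intro ennreal_mult[symmetric]) auto
    also have "1 / (v * t ^ d) * (v * (t + x) ^ d - v * (t - x) ^ d) = ((t + x) ^ d - (t - x) ^ d) / t ^ d"
      using v t by (simp add: field_simps)
    finally show ?thesis by (simp add: A)
  qed
  also have "\<dots> \<le> ennreal (real d * 2 ^ (d + 1) * (x / t))"
  proof (rule ennreal_leI)
    \<comment> \<open>Origin of the constant: \<open>2 ^ d\<close> comes from
      \<open>t + x \<le> 2 * t\<close>, and one more factor 2 from the thickness
      \<open>2 * x\<close> of the shell.\<close>
    have "t * ((t + x) ^ d - (t - x) ^ d) \<le> (t + x) * ((t + x) ^ d - (t - x) ^ d)"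
      using x by (intro mult_right_mono) (auto intro: power_mono)
    also have "\<dots> \<le> real d * (t + x) ^ d * ((t + x) - (t - x))"
      using x by (intro power_diff_le) auto
    also have "\<dots> \<le> real d * (2 * t) ^ d * ((t + x) - (t - x))"
      using x t by (intro mult_right_mono mult_left_mono power_mono) auto
    finally show "((t + x) ^ d - (t - x) ^ d) / t ^ d \<le> real d * 2 ^ (d + 1) * (x / t)"
      using t by (simp add: field_simps power_mult_distrib)
  qed
  finally show ?thesis by (simp add: d_def x_def)
next
  case False
  \<comment> \<open>For a long step the triangle inequality gives 2, which the claimed constant
    exceeds since \<open>norm h / t > 1\<close>.\<close>
  have "L1_norm (\<lambda>y. ball_kernel t (y - h) - ball_kernel t y)
      \<le> L1_norm (\<lambda>y. ball_kernel t (y - h)) + L1_norm (ball_kernel t :: 'a \<Rightarrow> real)"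
    by (intro L1_norm_diff_le) measurable
  also have "\<dots> = ennreal 2"
    using t by (subst L1_norm_translate) (simp_all add: L1_norm_ball_kernel)
  also have "\<dots> \<le> ennreal (real DIM('a) * 2 ^ (DIM('a) + 1) * (norm h / t))"
  proof (rule ennreal_leI)
    have "1 * 2 \<le> real DIM('a) * 2 ^ (DIM('a) + 1)"
      by (intro mult_mono) (auto simp: Suc_le_eq)
    then have "2 * 1 \<le> real DIM('a) * 2 ^ (DIM('a) + 1) * (norm h / t)"
      using False t by (intro mult_mono) auto
    then show "2 \<le> real DIM('a) * 2 ^ (DIM('a) + 1) * (norm h / t)" by simp
  qed
  finally show ?thesis .
qed

text \<open>Both kernels have mass 1, so the excess of the narrow one on the small ball equals the
  mass \<open>1 - (t / t') ^ DIM('a)\<close> of the wide one on the shell. This is the source of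
  continuity in \<open>t\<close>, and thus of measurability, for the distance between f and its
  averages.\<close>

lemma L1_norm_ball_kernel_dilate:
  assumes t: "0 < t" "t \<le> t'"
  shows "L1_norm (\<lambda>y :: 'a::euclidean_space. ball_kernel t y - ball_kernel t' y) \<le> ennreal (2 * (1 - (t / t') ^ DIM('a)))"
proof -
  define v where "v = unit_ball_vol (real DIM('a))"
  have v: "0 < v" by (simp add: v_def)
  define d where "d = DIM('a)"
  define A where "A = ball (0 :: 'a) t' - ball 0 t"
  have le: "t ^ d \<le> t' ^ d" using t by (intro power_mono) auto
  have A: "emeasure lborel A = ennreal (v * t' ^ d - v * t ^ d)"
  proof -
    have "emeasure lborel A = emeasure lborel (ball (0 :: 'a) t') - emeasure lborel (ball (0 :: 'a) t)"
      unfolding A_def using t emeasure_lborel_ball_finite[of "0 :: 'a" t]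
      by (intro emeasure_Diff) (auto simp: subset_ball)
    then show ?thesis
      using t v by (simp add: emeasure_lborel_ball_eq measure_lborel_ball v_def d_def ennreal_minus)
  qed
  define a where "a = 1 / (v * t ^ d) - 1 / (v * t' ^ d)"
  define b where "b = 1 / (v * t' ^ d)"
  have ab: "0 \<le> a" "0 \<le> b" using v t le by (auto simp: a_def b_def intro!: divide_left_mono)
  have "L1_norm (\<lambda>y :: 'a. ball_kernel t y - ball_kernel t' y)
    \<le> (\<integral>\<^sup>+ y. ennreal a * indicator (ball (0 :: 'a) t) y + ennreal b * indicator A y \<partial>lborel)"
    unfolding L1_norm_def
  proof (rule nn_integral_mono)
    fix y :: 'a
    have "ball_kernel t y - ball_kernel t' y = indicator (ball 0 t) y / (v * t ^ d) - indicator (ball 0 t') y / (v * t' ^ d)"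
      using t by (simp add: ball_kernel_def measure_lborel_ball v_def d_def)
    then have "\<bar>ball_kernel t y - ball_kernel t' y\<bar> \<le> a * indicator (ball 0 t) y + b * indicator A y"
      using t ab by (auto simp: a_def b_def A_def split: split_indicator)
    moreover have "ennreal (a * indicator (ball 0 t) y + b * indicator A y) = ennreal a * indicator (ball 0 t) y + ennreal b * indicator A y"
      using ab by (auto simp: indicator_def)
    ultimately show "ennreal \<bar>ball_kernel t y - ball_kernel t' y\<bar> \<le> ennreal a * indicator (ball 0 t) y + ennreal b * indicator A y"
      by (metis ennreal_leI)
  qed
  also have "\<dots> = ennreal a * emeasure lborel (ball (0 :: 'a) t) + ennreal b * emeasure lborel A"
    by (subst nn_integral_add) (simp_all add: nn_integral_cmult_indicator A_def)
  also have "\<dots> = ennreal (a * (v * t ^ d) + b * (v * t' ^ d - v * t ^ d))"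
  proof -
    have "emeasure lborel (ball (0 :: 'a) t) = ennreal (v * t ^ d)"
      using t by (simp add: emeasure_lborel_ball_eq measure_lborel_ball v_def d_def)
    then show ?thesis
      using ab v t le by (simp add: A ennreal_mult[symmetric] ennreal_plus[symmetric] del: ennreal_plus)
  qed
  also have "a * (v * t ^ d) + b * (v * t' ^ d - v * t ^ d) = 2 * (1 - (t / t') ^ d)"
    using v t by (simp add: a_def b_def field_simps power_divide)
  finally show ?thesis by (simp add: d_def)
qed

section \<open>The kernel of the combined ball average\<close>

definition combined_coeff :: "nat \<Rightarrow> nat \<Rightarrow> real" where
  "combined_coeff l j = - 2 / real ((2 * l) choose l) * ((-1) ^ j * real ((2 * l) choose (l - j)))"

definition combined_kernel :: "nat \<Rightarrow> real \<Rightarrow> 'a::euclidean_space \<Rightarrow> real" where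
  "combined_kernel l t y = (\<Sum>j = 1..l. combined_coeff l j * ball_kernel (real j * t) y)"

text \<open>A bound for the operator norm. The coefficients add up to 1 for
  \<open>l \<ge> 1\<close>, but they alternate in sign, so for \<open>l = 2\<close> the bound is
  already 5/3; therefore its powers are carried through all estimates.\<close>

definition combined_bound :: "nat \<Rightarrow> real" where
  "combined_bound l = (\<Sum>j = 1..l. \<bar>combined_coeff l j\<bar>)"

lemma combined_bound_nonneg [simp]: "0 \<le> combined_bound l"
  by (simp add: combined_bound_def sum_nonneg)

lemma borel_measurable_combined_kernel [measurable]: "combined_kernel l t \<in> borel_measurable borel"
  unfolding combined_kernel_def[abs_def] by measurable

lemma averaging_kernel_combined_kernel: "averaging_kernel (combined_kernel l t)"
  unfolding combined_kernel_def[abs_def]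
  by (intro kernel_sum kernel_cmult averaging_kernel_ball_kernel)

lemma L1_norm_combined_kernel:
  assumes "0 < t"
  shows "L1_norm (combined_kernel l t :: 'a::euclidean_space \<Rightarrow> real) \<le> ennreal (combined_bound l)"
proof -
  have "L1_norm (\<lambda>y :: 'a. \<Sum>j = 1..l. combined_coeff l j * ball_kernel (real j * t) y) \<le> ennreal ((\<Sum>j = 1..l. \<bar>combined_coeff l j\<bar>) * 1)"
    using assms by (intro L1_norm_sum_le) (auto simp: L1_norm_ball_kernel)
  then show ?thesis by (simp add: combined_kernel_def[abs_def] combined_bound_def)
qed

lemma L1_norm_combined_kernel_translate:
  fixes h :: "'a::euclidean_space"
  assumes t: "0 < t"
  shows "L1_norm (\<lambda>y. combined_kernel l t (y - h) - combined_kernel l t y)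
    \<le> ennreal (combined_bound l * (real DIM('a) * 2 ^ (DIM('a) + 1) * (norm h / t)))"
proof -
  define W where "W = real DIM('a) * 2 ^ (DIM('a) + 1) * (norm h / t)"
  have W: "0 \<le> W" using t by (simp add: W_def)
  have "L1_norm (\<lambda>y. ball_kernel (real j * t) (y - h) - ball_kernel (real j * t) y) \<le> ennreal W"
    if "j \<in> {1..l}" for j
  proof -
    have "L1_norm (\<lambda>y. ball_kernel (real j * t) (y - h) - ball_kernel (real j * t) y)
        \<le> ennreal (real DIM('a) * 2 ^ (DIM('a) + 1) * (norm h / (real j * t)))"
      using that t by (intro L1_norm_ball_kernel_translate) auto
    also have "\<dots> \<le> ennreal W"
      unfolding W_def using that t by (intro ennreal_leI mult_left_mono divide_left_mono) auto
    finally show ?thesis .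
  qed
  then have "L1_norm (\<lambda>y. \<Sum>j = 1..l. combined_coeff l j * (ball_kernel (real j * t) (y - h) - ball_kernel (real j * t) y))
      \<le> ennreal ((\<Sum>j = 1..l. \<bar>combined_coeff l j\<bar>) * W)"
    using W by (intro L1_norm_sum_le) auto
  then show ?thesis
    by (simp add: combined_kernel_def combined_bound_def W_def right_diff_distrib sum_subtractf)
qed

lemma L1_norm_combined_kernel_dilate:
  assumes t: "0 < t" "t \<le> t'"
  shows "L1_norm (\<lambda>y :: 'a::euclidean_space. combined_kernel l t y - combined_kernel l t' y)
    \<le> ennreal (combined_bound l * (2 * (1 - (t / t') ^ DIM('a))))"
proof -
  define W where "W = 2 * (1 - (t / t') ^ DIM('a))"
  have W: "0 \<le> W" using t by (simp add: W_def power_le_one)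
  have "L1_norm (\<lambda>y :: 'a. ball_kernel (real j * t) y - ball_kernel (real j * t') y) \<le> ennreal W"
    if "j \<in> {1..l}" for j
    using L1_norm_ball_kernel_dilate[of "real j * t" "real j * t'", where 'a = 'a] that t
    by (simp add: W_def)
  then have "L1_norm (\<lambda>y :: 'a. \<Sum>j = 1..l. combined_coeff l j * (ball_kernel (real j * t) y - ball_kernel (real j * t') y))
      \<le> ennreal ((\<Sum>j = 1..l. \<bar>combined_coeff l j\<bar>) * W)"
    using W by (intro L1_norm_sum_le) auto
  then show ?thesis
    by (simp add: combined_kernel_def combined_bound_def W_def right_diff_distrib sum_subtractf)
qed

lemma ball_average_eq_convolve:
  assumes [measurable]: "f \<in> borel_measurable borel" and "0 < t"
  shows "ball_average t f x = convolve (ball_kernel t) f x"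
proof -
  define V where "V = measure lborel (ball (0 :: 'a) t)"
  have V: "measure lebesgue (ball x t) = V"
    using assms by (simp add: V_def measure_completion measure_lborel_ball)
  have "(\<integral>y. indicator (ball x t) y *\<^sub>R f y \<partial>lebesgue) = (\<integral>y. indicator (ball x t) y *\<^sub>R f y \<partial>lborel)"
    by (rule integral_completion) measurable
  also have "\<dots> = (\<integral>y. indicator (ball x t) (y + x) *\<^sub>R f (y + x) \<partial>lborel)"
    by (rule integral_lborel_translate[where g = "\<lambda>y. indicator (ball x t) y *\<^sub>R f y", symmetric]) measurable
  also have "\<dots> = (\<integral>y. indicator (ball 0 t) y *\<^sub>R f (x + y) \<partial>lborel)"
    by (intro Bochner_Integration.integral_cong) (auto simp: indicator_def dist_norm add.commute)
  finally have "ball_average t f x = (1 / V) *\<^sub>R (\<integral>y. indicator (ball 0 t) y *\<^sub>R f (x + y) \<partial>lborel)"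
    by (simp add: ball_average_def V set_lebesgue_integral_def)
  also have "\<dots> = (\<integral>y. (1 / V) *\<^sub>R (indicator (ball 0 t) y *\<^sub>R f (x + y)) \<partial>lborel)"
    by (simp del: scaleR_scaleR)
  also have "\<dots> = convolve (ball_kernel t) f x"
    unfolding convolve_def ball_kernel_def V_def[symmetric] scaleR_scaleR
    by (intro Bochner_Integration.integral_cong) auto
  finally show ?thesis .
qed

context translation_setting
begin

section \<open>Smoothing operators, differences and their powers\<close>

definition smoother :: "nat \<Rightarrow> real \<Rightarrow> ('a \<Rightarrow> complex) \<Rightarrow> 'a \<Rightarrow> complex" where
  "smoother l t f = convolve (combined_kernel l t) f"

lemma combined_ball_average_eq:
  assumes "f \<in> F" "0 < t"
  shows "combined_ball_average l t f = smoother l t f"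
proof
  fix x
  have "smoother l t f x = (\<Sum>j = 1..l. convolve (\<lambda>y. combined_coeff l j * ball_kernel (real j * t) y) f x)"
    unfolding smoother_def combined_kernel_def[abs_def] using assms
    by (intro convolve_kernel_sum kernel_cmult averaging_kernel_ball_kernel)
  also have "\<dots> = (\<Sum>j = 1..l. combined_coeff l j *\<^sub>R ball_average (real j * t) f x)"
    using assms by (intro sum.cong refl, subst ball_average_eq_convolve) (auto simp: convolve_kernel_cmult F_measurable)
  also have "\<dots> = combined_ball_average l t f x"
    by (simp add: combined_ball_average_def combined_coeff_def scaleR_sum_right)
  finally show "combined_ball_average l t f x = smoother l t f x" ..
qed

text \<open>Linearity is recorded in the form in which it is used: errors \<open>f - G f\<close> are
  pushed through powers of commuting operators.\<close>

definition linop :: "(('a \<Rightarrow> complex) \<Rightarrow> ('a \<Rightarrow> complex)) \<Rightarrow> bool" where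
  "linop G \<longleftrightarrow> (\<forall>f\<in>F. G f \<in> F) \<and> (\<forall>f\<in>F. \<forall>g\<in>F. G (\<lambda>x. f x - g x) = (\<lambda>x. G f x - G g x))"

lemma linop_closed: "linop G \<Longrightarrow> f \<in> F \<Longrightarrow> G f \<in> F"
  by (simp add: linop_def)

lemma linop_diff: "linop G \<Longrightarrow> f \<in> F \<Longrightarrow> g \<in> F \<Longrightarrow> G (\<lambda>x. f x - g x) = (\<lambda>x. G f x - G g x)"
  by (simp add: linop_def)

lemma linop_funpow:
  assumes "linop G"
  shows "linop (G ^^ k)"
proof (induction k)
  case (Suc k)
  then show ?case using assms by (simp add: linop_def)
qed (simp add: linop_def)

lemma funpow_commute:
  assumes "linop G" "linop H" "\<And>f. f \<in> F \<Longrightarrow> G (H f) = H (G f)" "f \<in> F"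
  shows "(G ^^ m) (H f) = H ((G ^^ m) f)"
  using assms(4)
proof (induction m)
  case (Suc m)
  then show ?case using assms(3)[OF linop_closed[OF linop_funpow[OF assms(1)] Suc.prems]] by simp
qed simp

lemma funpow_commute2:
  assumes "linop G" "linop H" "\<And>f. f \<in> F \<Longrightarrow> G (H f) = H (G f)" "f \<in> F"
  shows "(G ^^ m) ((H ^^ n) f) = (H ^^ n) ((G ^^ m) f)"
proof (rule funpow_commute)
  fix f assume "f \<in> F"
  then show "G ((H ^^ n) f) = (H ^^ n) (G f)"
    by (intro funpow_commute[OF assms(2,1), symmetric] assms(3)[symmetric])
qed (fact assms(1) linop_funpow[OF assms(2)] assms(4))+

lemma N_funpow:
  assumes "linop G" "\<And>f. f \<in> F \<Longrightarrow> N (G f) \<le> ennreal c * N f" "0 \<le> c" "f \<in> F"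
  shows "N ((G ^^ k) f) \<le> ennreal (c ^ k) * N f"
proof (induction k)
  case (Suc k)
  have "N ((G ^^ Suc k) f) \<le> ennreal c * N ((G ^^ k) f)"
    using assms linop_closed[OF linop_funpow] by simp
  also have "\<dots> \<le> ennreal c * (ennreal (c ^ k) * N f)" by (intro mult_left_mono Suc.IH) simp
  finally show ?case using assms(3) by (simp add: ennreal_mult mult.assoc)
qed simp

text \<open>By commutation each \<open>G\<close> is paired with one \<open>H\<close>, and each pair
  costs a factor \<open>c\<close>. With \<open>G\<close> a difference and \<open>H\<close> a
  smoothing, k differences meet k smoothings.\<close>

lemma N_funpow_comp:
  assumes "linop G" "linop H" "\<And>f. f \<in> F \<Longrightarrow> G (H f) = H (G f)"
    and "\<And>f. f \<in> F \<Longrightarrow> N (G (H f)) \<le> ennreal c * N f" "0 \<le> c" "f \<in> F"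
  shows "N ((G ^^ k) ((H ^^ k) f)) \<le> ennreal (c ^ k) * N f"
  using assms(6)
proof (induction k arbitrary: f)
  case (Suc k)
  have HF: "H f \<in> F" by (rule linop_closed[OF assms(2) Suc.prems])
  have GF: "G (H f) \<in> F" by (rule linop_closed[OF assms(1) HF])
  have "(H ^^ k) (G (H f)) = G ((H ^^ k) (H f))"
  proof (rule funpow_commute[OF assms(2,1) _ HF])
    fix f assume "f \<in> F"
    then show "H (G f) = G (H f)" by (rule assms(3)[symmetric])
  qed
  then have "N ((G ^^ Suc k) ((H ^^ Suc k) f)) = N ((G ^^ k) ((H ^^ k) (G (H f))))"
    by (simp only: funpow_Suc_right o_apply)
  also have "N ((G ^^ k) ((H ^^ k) (G (H f)))) \<le> ennreal (c ^ k) * N (G (H f))"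
    by (rule Suc.IH) fact
  also have "\<dots> \<le> ennreal (c ^ k) * (ennreal c * N f)"
    by (intro mult_left_mono assms(4) Suc.prems) simp
  finally show ?case using assms(5) by (simp add: ennreal_mult mult_ac)
qed simp

text \<open>Telescoping: \<open>f - G^k f\<close> is the sum of \<open>G^i (f - G f)\<close> over
  \<open>i < k\<close>.\<close>

lemma N_minus_funpow:
  assumes "linop G" "\<And>f. f \<in> F \<Longrightarrow> N (G f) \<le> ennreal c * N f" "0 \<le> c" "f \<in> F"
  shows "N (\<lambda>x. f x - (G ^^ k) f x) \<le> ennreal (\<Sum>i<k. c ^ i) * N (\<lambda>x. f x - G f x)"
proof (induction k)
  case (Suc k)
  have GF: "G f \<in> F" "(G ^^ k) f \<in> F"
    using linop_closed[OF assms(1,4)] linop_closed[OF linop_funpow[OF assms(1)] assms(4)] by auto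
  have dF: "(\<lambda>x. f x - G f x) \<in> F" by (rule F_diff[OF assms(4) GF(1)])
  have "N (\<lambda>x. f x - (G ^^ Suc k) f x) = N (\<lambda>x. (f x - (G ^^ k) f x) + (G ^^ k) (\<lambda>x. f x - G f x) x)"
    using linop_diff[OF linop_funpow[OF assms(1)] assms(4) GF(1), of k]
    by (simp add: funpow_Suc_right del: funpow.simps)
  also have "\<dots> \<le> N (\<lambda>x. f x - (G ^^ k) f x) + N ((G ^^ k) (\<lambda>x. f x - G f x))"
    by (intro N_add F_diff assms(4) GF linop_closed[OF linop_funpow[OF assms(1)]])
  also have "\<dots> \<le> ennreal (\<Sum>i<k. c ^ i) * N (\<lambda>x. f x - G f x) + ennreal (c ^ k) * N (\<lambda>x. f x - G f x)"
    by (intro add_mono Suc.IH N_funpow[OF assms(1,2,3) dF]) simp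
  also have "\<dots> = ennreal (\<Sum>i<Suc k. c ^ i) * N (\<lambda>x. f x - G f x)"
    using assms(3) by (simp add: sum_nonneg distrib_right)
  finally show ?case .
qed (simp add: N_zero)

lemma linop_forward_difference: "linop (forward_difference h)"
  unfolding linop_def forward_difference_def
  by (auto intro!: F_diff F_translate)

lemma linop_smoother: "linop (smoother l t)"
  unfolding linop_def smoother_def
  by (auto intro!: F_convolve convolve_diff averaging_kernel_combined_kernel)

lemma N_forward_difference:
  assumes "f \<in> F"
  shows "N (forward_difference h f) \<le> ennreal 2 * N f"
proof -
  have "N (\<lambda>x. f (x + h) - f x) \<le> N (\<lambda>x. f (x + h)) + N f"
    using assms by (intro N_diff F_translate)
  then show ?thesis using assms
    by (simp add: forward_difference_def N_translate mult_2)
qed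

lemma N_smoother:
  assumes "f \<in> F" "0 < t"
  shows "N (smoother l t f) \<le> ennreal (combined_bound l) * N f"
  unfolding smoother_def using assms
  by (intro N_convolve L1_norm_combined_kernel) auto

lemma smoother_translate: "smoother l t (\<lambda>x. f (x + h)) = (\<lambda>x. smoother l t f (x + h))"
  by (simp add: smoother_def convolve_translate fun_eq_iff)

lemma difference_smoother_commute:
  assumes "f \<in> F"
  shows "forward_difference h (smoother l t f) = smoother l t (forward_difference h f)"
proof -
  have "smoother l t (\<lambda>x. f (x + h) - f x) = (\<lambda>x. smoother l t (\<lambda>x. f (x + h)) x - smoother l t f x)"
    using linop_smoother assms by (intro linop_diff F_translate)
  then show ?thesis by (simp add: forward_difference_def smoother_translate)
qed

lemma smoother_commute:
  assumes "f \<in> F"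
  shows "smoother l t (smoother l t' f) = smoother l t' (smoother l t f)"
  unfolding smoother_def using assms
  by (intro convolve_commute averaging_kernel_combined_kernel)

definition smoothing_bound :: "nat \<Rightarrow> real" where
  "smoothing_bound l = combined_bound l * (real DIM('a) * 2 ^ (DIM('a) + 1))"

lemma smoothing_bound_nonneg [simp]: "0 \<le> smoothing_bound l"
  by (simp add: smoothing_bound_def)

text \<open>The difference is shifted from the function to the kernel, where it costs only the L1
  distance between the kernel and its translate.\<close>

lemma N_difference_smoother:
  assumes "f \<in> F" "0 < t"
  shows "N (forward_difference h (smoother l t f)) \<le> ennreal (smoothing_bound l * (norm h / t)) * N f"
proof -
  have k: "averaging_kernel (combined_kernel l t :: 'a \<Rightarrow> real)" by (rule averaging_kernel_combined_kernel)
  have "N (forward_difference h (smoother l t f)) = N (convolve (\<lambda>y. combined_kernel l t (y - h) - combined_kernel l t y) f)"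
    using assms(1) k kernel_translate[OF k, of h]
    by (simp add: forward_difference_def[abs_def] smoother_def convolve_kernel_diff convolve_kernel_translate)
  also have "\<dots> \<le> ennreal (combined_bound l * (real DIM('a) * 2 ^ (DIM('a) + 1) * (norm h / t))) * N f"
    using assms by (intro N_convolve L1_norm_combined_kernel_translate) auto
  finally show ?thesis by (simp add: smoothing_bound_def mult.assoc)
qed

lemma N_difference_smoother_funpow:
  assumes "f \<in> F" "0 < t"
  shows "N ((forward_difference h ^^ k) ((smoother l t ^^ k) f)) \<le> ennreal ((smoothing_bound l * (norm h / t)) ^ k) * N f"
  using assms
  by (intro N_funpow_comp linop_forward_difference linop_smoother difference_smoother_commute N_difference_smoother) auto

section \<open>The distance between a function and its combined average\<close>

definition deviation :: "nat \<Rightarrow> ('a \<Rightarrow> complex) \<Rightarrow> real \<Rightarrow> ennreal" where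
  "deviation l f t = N (\<lambda>x. f x - smoother l t f x)"

lemma deviation_le:
  assumes "f \<in> F" "0 < t"
  shows "deviation l f t \<le> ennreal (1 + combined_bound l) * N f"
proof -
  have "deviation l f t \<le> N f + N (smoother l t f)"
    unfolding deviation_def using assms linop_smoother linop_closed by (intro N_diff) auto
  also have "\<dots> \<le> N f + ennreal (combined_bound l) * N f" using assms by (intro add_left_mono N_smoother)
  finally show ?thesis by (simp add: distrib_right)
qed

lemma N_minus_smoother_funpow:
  assumes "f \<in> F" "0 < t"
  shows "N (\<lambda>x. f x - (smoother l t ^^ k) f x) \<le> ennreal (\<Sum>i<k. combined_bound l ^ i) * deviation l f t"
  unfolding deviation_def using assms
  by (intro N_minus_funpow linop_smoother N_smoother) auto

text \<open>The kernel depends continuously on \<open>t > 0\<close> in L1, so the smoothing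
  operators do so in operator norm. The purpose is measurability in \<open>t\<close>, without which
  constants could not be moved out of the weighted norm.\<close>

lemma deviation_continuous:
  assumes f: "f \<in> F"
  shows "continuous_on {0<..} (\<lambda>t. enn2real (deviation l f t))"
proof -
  let ?d = "\<lambda>t t' x. smoother l t f x - smoother l t' f x"
  define D where "D t = enn2real (deviation l f t)" for t
  obtain n where n: "N f = ennreal n" "0 \<le> n" using N_finite[OF f] by (cases "N f") auto
  have D: "deviation l f t = ennreal (D t)" "0 \<le> D t" if "0 < t" for t
  proof -
    have "deviation l f t < top"
      using deviation_le[OF f that, of l] by (rule le_less_trans) (use N_finite[OF f] in \<open>simp add: ennreal_mult_less_top del: ennreal_plus\<close>)
    then show "deviation l f t = ennreal (D t)" "0 \<le> D t" by (simp_all add: D_def)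
  qed
  \<comment> \<open>Written with \<open>min\<close> and \<open>max\<close> to be symmetric in the
    two scales; it vanishes on the diagonal.\<close>
  define R where "R t t' = combined_bound l * (2 * (1 - (min t t' / max t t') ^ DIM('a))) * n" for t t'
  have diff: "N (?d t t') \<le> ennreal (R t t')" if "0 < t" "t \<le> t'" for t t'
  proof -
    have "N (?d t t') = N (convolve (\<lambda>y. combined_kernel l t y - combined_kernel l t' y) f)"
      unfolding smoother_def
      by (subst convolve_kernel_diff[OF averaging_kernel_combined_kernel averaging_kernel_combined_kernel f]) simp
    also have "\<dots> \<le> ennreal (combined_bound l * (2 * (1 - (t / t') ^ DIM('a)))) * N f"
      using that f by (intro N_convolve L1_norm_combined_kernel_dilate) auto
    also have "\<dots> = ennreal (R t t')"
      using that n by (simp add: R_def ennreal_mult[symmetric] power_le_one)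
    finally show ?thesis .
  qed
  have diff2: "N (?d t t') \<le> ennreal (R t t')" if "0 < t" "0 < t'" for t t'
  proof (cases "t \<le> t'")
    case False
    have sF: "smoother l t f \<in> F" "smoother l t' f \<in> F" using f linop_smoother linop_closed by auto
    have "N (\<lambda>x. (-1) *\<^sub>R (smoother l t' f x - smoother l t f x)) \<le> ennreal \<bar>-1\<bar> * N (?d t' t)"
      using sF by (intro N_scaleR F_diff)
    also have "\<dots> \<le> ennreal (R t' t)" using diff[of t' t] False that by simp
    finally show ?thesis by (simp add: R_def min.commute max.commute)
  qed (use that diff in auto)
  have le: "D t \<le> D t' + R t t'" if "0 < t" "0 < t'" for t t'
  proof -
    have sF: "smoother l t f \<in> F" "smoother l t' f \<in> F" using f linop_smoother linop_closed by auto
    have "(min t t' / max t t') ^ DIM('a) \<le> 1" using that by (intro power_le_one) auto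
    then have R: "0 \<le> R t t'" using n by (simp add: R_def)
    have "deviation l f t = N (\<lambda>x. (f x - smoother l t' f x) - (smoother l t f x - smoother l t' f x))"
      by (simp add: deviation_def)
    also have "\<dots> \<le> deviation l f t' + N (?d t t')"
      unfolding deviation_def by (intro N_diff F_diff f sF)
    also have "\<dots> \<le> deviation l f t' + ennreal (R t t')" using diff2 that by (intro add_left_mono)
    finally have "ennreal (D t) \<le> ennreal (D t' + R t t')" using D that R by simp
    then show ?thesis using D(2)[OF that(2)] R by (subst (asm) ennreal_le_iff) auto
  qed
  have "isCont D t0" if t0: "0 < t0" for t0
  proof -
    have "isCont (\<lambda>t. R t t0) t0"
      unfolding R_def using t0 by (intro continuous_intros) auto
    then have "((\<lambda>t. R t t0) \<longlongrightarrow> R t0 t0) (at t0)" by (simp add: isCont_def)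
    then have lim: "((\<lambda>t. R t t0) \<longlongrightarrow> 0) (at t0)" using t0 by (simp add: R_def)
    have "eventually (\<lambda>t. norm (D t - D t0) \<le> R t t0) (at t0)"
    proof -
      have "eventually (\<lambda>t. t \<in> {0<..}) (at t0)"
        using t0 by (intro eventually_at_in_open') auto
      then show ?thesis
      proof (rule eventually_mono)
        fix t :: real assume "t \<in> {0<..}"
        then have "D t \<le> D t0 + R t t0" "D t0 \<le> D t + R t0 t" using le t0 by auto
        moreover have "R t0 t = R t t0" by (simp add: R_def min.commute max.commute)
        ultimately show "norm (D t - D t0) \<le> R t t0" by auto
      qed
    qed
    then have "((\<lambda>t. D t - D t0) \<longlongrightarrow> 0) (at t0)" using lim by (rule Lim_null_comparison)
    then show ?thesis unfolding isCont_def by (rule LIM_zero_cancel)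
  qed
  then show ?thesis by (auto intro!: continuous_at_imp_continuous_on simp: D_def[abs_def])
qed

lemma deviation_measurable:
  assumes f: "f \<in> F"
  shows "(\<lambda>t. deviation l f t * indicator {0<..<1} t) \<in> borel_measurable borel"
proof -
  have "(\<lambda>t. indicator {0<..<1} t *\<^sub>R enn2real (deviation l f t)) \<in> borel_measurable borel"
    by (intro borel_measurable_continuous_on_indicator continuous_on_subset[OF deviation_continuous[OF f]]) auto
  then have "(\<lambda>t. ennreal (indicator {0<..<1} t *\<^sub>R enn2real (deviation l f t))) \<in> borel_measurable borel"
    by measurable
  also have "(\<lambda>t. ennreal (indicator {0<..<1} t *\<^sub>R enn2real (deviation l f t))) = (\<lambda>t. deviation l f t * indicator {0<..<1} t)"
  proof
    fix t :: real
    show "ennreal (indicator {0<..<1} t *\<^sub>R enn2real (deviation l f t)) = deviation l f t * indicator {0<..<1} t"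
    proof (cases "t \<in> {0<..<1}")
      case True
      have "deviation l f t < top"
        using deviation_le[OF f, of t l] True N_finite[OF f]
        by (auto intro: le_less_trans simp: ennreal_mult_less_top)
      then show ?thesis using True by simp
    qed simp
  qed
  finally show ?thesis .
qed

end

section \<open>Moduli of smoothness\<close>

text \<open>The sign exponent \<open>n + i\<close> has the parity of \<open>n - i\<close> and avoids
  truncated subtraction.\<close>

lemma funpow_forward_difference:
  "(forward_difference h ^^ n) f x = (\<Sum>i\<le>n. ((-1) ^ (n + i) * real (n choose i)) *\<^sub>R f (x + real i *\<^sub>R h))"
proof (induction n arbitrary: f x)
  case (Suc n)
  \<comment> \<open>\<open>g\<close> carries the sign belonging to order \<open>n\<close>. Shifting
    the index by one flips it, so both sums appear with the same sign and Pascal's rule merges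
    them.\<close>
  define g where "g i = (-1 :: real) ^ (n + i) *\<^sub>R f (x + real i *\<^sub>R h)" for i
  have "(forward_difference h ^^ Suc n) f x = (forward_difference h ^^ n) (forward_difference h f) x"
    by (simp add: funpow_Suc_right del: funpow.simps)
  also have "\<dots> = (\<Sum>i\<le>n. ((-1) ^ (n + i) * real (n choose i)) *\<^sub>R (f (x + real (Suc i) *\<^sub>R h) - f (x + real i *\<^sub>R h)))"
    by (simp add: Suc.IH forward_difference_def algebra_simps)
  also have "\<dots> = - (\<Sum>i\<le>n. real (n choose i) *\<^sub>R g (Suc i)) - (\<Sum>i\<le>n. real (n choose i) *\<^sub>R g i)"
    by (simp add: g_def scaleR_diff_right sum_subtractf sum_negf mult.commute)
  also have "(\<Sum>i\<le>n. real (n choose i) *\<^sub>R g i) = (\<Sum>i\<le>Suc n. real (n choose i) *\<^sub>R g i)" by simp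
  also have "\<dots> = g 0 + (\<Sum>i\<le>n. real (n choose Suc i) *\<^sub>R g (Suc i))"
    by (simp only: sum.atMost_Suc_shift binomial_n_0 of_nat_1 scaleR_one)
  also have "- (\<Sum>i\<le>n. real (n choose i) *\<^sub>R g (Suc i)) - (g 0 + (\<Sum>i\<le>n. real (n choose Suc i) *\<^sub>R g (Suc i)))
      = - (g 0 + (\<Sum>i\<le>n. real (Suc n choose Suc i) *\<^sub>R g (Suc i)))"
    by (simp add: scaleR_add_left sum.distrib)
  also have "g 0 + (\<Sum>i\<le>n. real (Suc n choose Suc i) *\<^sub>R g (Suc i)) = (\<Sum>i\<le>Suc n. real (Suc n choose i) *\<^sub>R g i)"
    by (simp only: sum.atMost_Suc_shift binomial_n_0 of_nat_1 scaleR_one)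
  also have "- \<dots> = (\<Sum>i\<le>Suc n. ((-1) ^ (Suc n + i) * real (Suc n choose i)) *\<^sub>R f (x + real i *\<^sub>R h))"
    unfolding sum_negf[symmetric] by (intro sum.cong refl) (simp add: g_def mult.commute)
  finally show ?case .
qed simp

lemma sum_symmetric_about:
  fixes g :: "nat \<Rightarrow> 'b::comm_monoid_add"
  shows "(\<Sum>i\<le>2 * l. g i) = g l + (\<Sum>j = 1..l. g (l - j) + g (l + j))"
proof -
  have "{..2 * l} = {..<l} \<union> ({l} \<union> {l + 1..l + l})" by auto
  then have "(\<Sum>i\<le>2 * l. g i) = (\<Sum>i<l. g i) + (g l + (\<Sum>i = l + 1..l + l. g i))"
    by (simp only:) (subst sum.union_disjoint, auto)+
  also have "(\<Sum>i<l. g i) = (\<Sum>j = 1..l. g (l - j))"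
    by (rule sum.reindex_bij_witness[of _ "\<lambda>j. l - j" "\<lambda>i. l - i"]) auto
  also have "(\<Sum>i = l + 1..l + l. g i) = (\<Sum>j = 1..l. g (l + j))"
    by (rule sum.reindex_bij_witness[of _ "\<lambda>j. l + j" "\<lambda>i. i - l"]) auto
  finally show ?thesis by (simp add: sum.distrib ac_simps)
qed

context translation_setting
begin

abbreviation om :: "nat \<Rightarrow> ('a \<Rightarrow> complex) \<Rightarrow> real \<Rightarrow> ennreal" where
  "om k f \<equiv> modulus_of_smoothness M k p f"

lemma om_eq: "om k f t = (SUP h\<in>{h. norm h \<le> t}. N ((forward_difference h ^^ k) f))"
  by (simp add: modulus_of_smoothness_def N_def)

lemma om_upper: "norm h \<le> t \<Longrightarrow> N ((forward_difference h ^^ k) f) \<le> om k f t"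
  unfolding om_eq by (intro SUP_upper) simp

lemma om_mono: "t \<le> t' \<Longrightarrow> om k f t \<le> om k f t'"
  unfolding om_eq by (intro SUP_subset_mono) auto

lemma F_difference_funpow: "f \<in> F \<Longrightarrow> (forward_difference h ^^ k) f \<in> F"
  by (rule linop_closed[OF linop_funpow[OF linop_forward_difference]])

lemma N_difference_funpow: "f \<in> F \<Longrightarrow> N ((forward_difference h ^^ k) f) \<le> ennreal (2 ^ k) * N f"
  by (rule N_funpow[OF linop_forward_difference N_forward_difference]) auto

lemma om_le: "f \<in> F \<Longrightarrow> om k f t \<le> ennreal (2 ^ k) * N f"
  unfolding om_eq by (intro SUP_least N_difference_funpow)

lemma om_finite: "f \<in> F \<Longrightarrow> om k f t < top"
  using om_le[of f k t] N_finite[of f] by (auto intro: le_less_trans simp: ennreal_mult_less_top)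

text \<open>Monotone in \<open>t\<close>, hence Borel; finiteness allows the passage through real
  values.\<close>

lemma om_measurable [measurable]:
  assumes "f \<in> F"
  shows "om k f \<in> borel_measurable borel"
proof -
  have "mono (\<lambda>t. enn2real (om k f t))"
  proof (rule monoI)
    fix t t' :: real assume "t \<le> t'"
    then show "enn2real (om k f t) \<le> enn2real (om k f t')"
      by (intro enn2real_mono om_mono om_finite assms)
  qed
  then have [measurable]: "(\<lambda>t. enn2real (om k f t)) \<in> borel_measurable borel"
    by (rule borel_measurable_mono)
  have "(\<lambda>t. ennreal (enn2real (om k f t))) \<in> borel_measurable borel" by measurable
  also have "(\<lambda>t. ennreal (enn2real (om k f t))) = om k f"
    by (intro ext ennreal_enn2real om_finite assms)
  finally show ?thesis .
qed

lemma om_add_le: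
  assumes "f \<in> F"
  shows "om (k + n) f t \<le> ennreal (2 ^ n) * om k f t"
  unfolding om_eq[of "k + n"]
proof (rule SUP_least)
  fix h :: 'a assume "h \<in> {h. norm h \<le> t}"
  then have "N ((forward_difference h ^^ n) ((forward_difference h ^^ k) f)) \<le> ennreal (2 ^ n) * om k f t"
    using assms by (intro order_trans[OF N_difference_funpow mult_left_mono[OF om_upper]] F_difference_funpow) auto
  then show "N ((forward_difference h ^^ (k + n)) f) \<le> ennreal (2 ^ n) * om k f t"
    by (simp only: add.commute[of k n] funpow_add[of n k] o_apply)
qed

text \<open>Marchaud's inequality rests on \<open>\<Delta>\<^bsub>2h\<^esub> = 2 \<Delta>\<^bsub>h\<^esub> + \<Delta>\<^bsub>h\<^esub>\<^sup>2\<close>, so that \<open>\<Delta>\<^bsub>2h\<^esub>\<^sup>m\<close> and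
  \<open>2\<^sup>m \<Delta>\<^bsub>h\<^esub>\<^sup>m\<close> agree up to terms divisible by \<open>\<Delta>\<^bsub>h\<^esub>\<^sup>m\<^sup>+\<^sup>1\<close>.\<close>

lemma forward_difference_commute:
  "forward_difference h (forward_difference h' f) = forward_difference h' (forward_difference h f)"
  by (simp add: forward_difference_def fun_eq_iff ac_simps)

text \<open>A difference with doubled step is a difference with step \<open>h\<close> followed by
  the sum of the identity and the translation by \<open>h\<close>, an operator of norm at most
  2.\<close>

lemma N_double_difference_funpow:
  assumes "f \<in> F"
  shows "N ((forward_difference (h + h) ^^ m) f) \<le> ennreal (2 ^ m) * N ((forward_difference h ^^ m) f)"
  using assms
proof (induction m arbitrary: f)
  case (Suc m)
  let ?P = "forward_difference (h + h)" and ?G = "forward_difference h"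
  define u where "u = (?G ^^ Suc m) f"
  have u: "u \<in> F" unfolding u_def by (rule F_difference_funpow) fact
  have comm: "(?G ^^ m) (?P f) = ?P ((?G ^^ m) f)"
  proof (rule funpow_commute)
    show "linop ?G" "linop ?P" by (rule linop_forward_difference)+
    show "?G (?P f') = ?P (?G f')" for f' by (rule forward_difference_commute)
  qed fact
  have "(?G ^^ m) (?P f) = (\<lambda>x. u (x + h) + u x)"
    unfolding comm by (simp add: u_def forward_difference_def fun_eq_iff ac_simps)
  then have le: "N ((?G ^^ m) (?P f)) \<le> ennreal 2 * N u"
    using N_add[OF F_translate[OF u, of h] u] N_translate[OF u, of h] by (simp add: mult_2)
  have "N ((?P ^^ Suc m) f) = N ((?P ^^ m) (?P f))"
    by (simp only: funpow_Suc_right o_apply)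
  also have "\<dots> \<le> ennreal (2 ^ m) * N ((?G ^^ m) (?P f))"
    by (intro Suc.IH linop_closed[OF linop_forward_difference] Suc.prems)
  also have "\<dots> \<le> ennreal (2 ^ m) * (ennreal 2 * N u)"
    by (intro mult_left_mono le) simp
  also have "\<dots> = ennreal (2 ^ m * 2) * N u"
    by (subst ennreal_mult) (simp_all only: mult.assoc zero_le_power zero_le_numeral)
  finally show ?case by (simp only: u_def power_Suc2)
qed simp

text \<open>With \<open>P = 2 G + G^2\<close> for the steps \<open>2h\<close> and \<open>h\<close>,
  the induction rests on \<open>2^(m+1) G^(m+1) - P^(m+1) = 2 (2^m G^m - P^m) G - P^m G^2\<close>.
  Both terms on the right contain \<open>m + 2\<close> differences with step \<open>h\<close> once
  the bound for powers of \<open>P\<close> is applied.\<close>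

lemma N_double_difference_defect:
  assumes "f \<in> F"
  shows "N (\<lambda>x. 2 ^ m *\<^sub>R (forward_difference h ^^ m) f x - (forward_difference (h + h) ^^ m) f x)
    \<le> ennreal (real m * 2 ^ m) * N ((forward_difference h ^^ Suc m) f)"
  using assms
proof (induction m arbitrary: f)
  case (Suc m)
  let ?P = "forward_difference (h + h)" and ?G = "forward_difference h"
  have lin: "linop (?P ^^ m)" by (rule linop_funpow[OF linop_forward_difference])
  have GF: "?G f \<in> F" "?P f \<in> F" "?G (?G f) \<in> F"
    using Suc.prems by (simp_all add: linop_closed[OF linop_forward_difference])
  define E where "E x = 2 ^ m *\<^sub>R (?G ^^ m) (?G f) x - (?P ^^ m) (?G f) x" for x
  have EF: "E \<in> F" unfolding E_def
    by (intro F_diff F_scaleR F_difference_funpow GF)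
  have "?G (?G f) = (\<lambda>x. (?P f x - ?G f x) - ?G f x)"
    by (simp add: forward_difference_def fun_eq_iff ac_simps)
  then have "(?P ^^ m) (?G (?G f)) = (\<lambda>x. ((?P ^^ m) (?P f) x - (?P ^^ m) (?G f) x) - (?P ^^ m) (?G f) x)"
    using linop_diff[OF lin GF(2,1)] linop_diff[OF lin F_diff[OF GF(2,1)] GF(1)] by simp
  then have "(\<lambda>x. 2 ^ Suc m *\<^sub>R (?G ^^ Suc m) f x - (?P ^^ Suc m) f x) = (\<lambda>x. 2 *\<^sub>R E x - (?P ^^ m) (?G (?G f)) x)"
    by (simp add: E_def fun_eq_iff funpow_Suc_right scaleR_diff_right scaleR_2 del: funpow.simps)
  then have "N (\<lambda>x. 2 ^ Suc m *\<^sub>R (?G ^^ Suc m) f x - (?P ^^ Suc m) f x) = N (\<lambda>x. 2 *\<^sub>R E x - (?P ^^ m) (?G (?G f)) x)"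
    by simp
  also have "\<dots> \<le> N (\<lambda>x. 2 *\<^sub>R E x) + N ((?P ^^ m) (?G (?G f)))"
    by (intro N_diff F_scaleR EF linop_closed[OF lin] GF)
  also have "\<dots> \<le> ennreal \<bar>2\<bar> * N E + ennreal (2 ^ m) * N ((?G ^^ m) (?G (?G f)))"
    by (intro add_mono N_scaleR EF N_double_difference_funpow GF)
  also have "\<dots> \<le> ennreal \<bar>2\<bar> * (ennreal (real m * 2 ^ m) * N ((?G ^^ Suc m) (?G f))) + ennreal (2 ^ m) * N ((?G ^^ m) (?G (?G f)))"
    unfolding E_def by (intro add_mono mult_left_mono Suc.IH GF order_refl) simp
  also have "\<dots> = ennreal (2 * (real m * 2 ^ m) + 2 ^ m) * N ((?G ^^ Suc (Suc m)) f)"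
  proof -
    have "(?G ^^ Suc m) (?G f) = (?G ^^ Suc (Suc m)) f" "(?G ^^ m) (?G (?G f)) = (?G ^^ Suc (Suc m)) f"
      by (simp_all only: funpow_Suc_right o_apply)
    moreover have "ennreal (2 * (real m * 2 ^ m) + 2 ^ m) = ennreal \<bar>2\<bar> * ennreal (real m * 2 ^ m) + ennreal (2 ^ m)"
      by (subst ennreal_mult[symmetric]; (subst ennreal_plus[symmetric])?) simp_all
    ultimately show ?thesis by (simp only: distrib_right mult.assoc)
  qed
  also have "\<dots> \<le> ennreal (real (Suc m) * 2 ^ Suc m) * N ((?G ^^ Suc (Suc m)) f)"
    by (intro mult_right_mono ennreal_leI) (simp_all add: algebra_simps)
  finally show ?case .
qed (simp add: N_zero)

text \<open>Marchaud's inequality in one dyadic step, with the contraction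
  \<open>2 powr (- real m)\<close> displayed. The summation over scales is left to the Hardy
  inequality.\<close>

lemma marchaud_step:
  assumes f: "f \<in> F" and t: "0 < t"
  shows "om m f t \<le> ennreal (2 powr (- real m)) * om m f (2 * t) + ennreal (real m) * om (Suc m) f t"
  unfolding om_eq[of m f t]
proof (rule SUP_least)
  let ?B = "ennreal (2 powr (- real m)) * om m f (2 * t) + ennreal (real m) * om (Suc m) f t"
  fix h :: 'a assume h: "h \<in> {h. norm h \<le> t}"
  let ?P = "forward_difference (h + h)" and ?G = "forward_difference h"
  define E where "E x = 2 ^ m *\<^sub>R (?G ^^ m) f x - (?P ^^ m) f x" for x
  have PG: "(?P ^^ m) f \<in> F" "(?G ^^ m) f \<in> F" using f by (simp_all add: F_difference_funpow)
  have EF: "E \<in> F" unfolding E_def by (intro F_diff F_scaleR PG)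
  have "(?G ^^ m) f = (\<lambda>x. (1 / 2 ^ m) *\<^sub>R (E x + (?P ^^ m) f x))"
    by (simp add: E_def fun_eq_iff)
  then have "N ((?G ^^ m) f) = N (\<lambda>x. (1 / 2 ^ m) *\<^sub>R (E x + (?P ^^ m) f x))"
    by (rule arg_cong)
  also have "\<dots> \<le> ennreal \<bar>1 / 2 ^ m\<bar> * N (\<lambda>x. E x + (?P ^^ m) f x)"
    by (intro N_scaleR F_add EF PG)
  also have "\<dots> \<le> ennreal \<bar>1 / 2 ^ m\<bar> * (ennreal (real m * 2 ^ m) * N ((?G ^^ Suc m) f) + N ((?P ^^ m) f))"
    using N_add[OF EF PG(1)] N_double_difference_defect[OF f, of m h, folded E_def]
    by (intro mult_left_mono) (auto intro: order_trans add_right_mono)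
  also have "\<dots> \<le> ennreal \<bar>1 / 2 ^ m\<bar> * (ennreal (real m * 2 ^ m) * om (Suc m) f t + om m f (2 * t))"
  proof (intro mult_left_mono add_mono om_upper)
    show "norm (h + h) \<le> 2 * t" using h norm_triangle_ineq[of h h] by simp
  qed (use h in auto)
  also have "\<dots> = ?B"
  proof -
    have "ennreal \<bar>1 / 2 ^ m\<bar> * ennreal (real m * 2 ^ m) = ennreal (real m)"
      by (subst ennreal_mult[symmetric]) auto
    moreover have "\<bar>1 / 2 ^ m\<bar> = 2 powr (- real m)"
      by (simp add: powr_minus powr_realpow field_simps)
    ultimately show ?thesis by (simp only: distrib_left mult.assoc[symmetric] add.commute)
  qed
  finally show "N ((?G ^^ m) f) \<le> ?B" .
qed

text \<open>The dilation \<open>a\<close> may be negative; since the ball is symmetric, only its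
  absolute value survives. In this way averages over all radii \<open>j * t\<close> are integrals
  over one unit ball and can be combined under a single integral sign.\<close>

lemma ball_kernel_scale:
  assumes f: "f \<in> F" and a: "a \<noteq> 0"
  shows "integrable lborel (\<lambda>u. ball_kernel 1 u *\<^sub>R f (x + a *\<^sub>R u))"
    and "(\<integral>u. ball_kernel 1 u *\<^sub>R f (x + a *\<^sub>R u) \<partial>lborel) = convolve (ball_kernel \<bar>a\<bar>) f x"
proof -
  have [measurable]: "f \<in> borel_measurable borel" using f by (rule F_measurable)
  define g where "g y = ball_kernel \<bar>a\<bar> y *\<^sub>R f (x + y)" for y
  have [measurable]: "g \<in> borel_measurable borel" unfolding g_def by measurable
  have int: "integrable lborel g"
    unfolding g_def using f by (intro integrable_kernel averaging_kernel_ball_kernel)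
  have eq: "\<bar>a\<bar> ^ DIM('a) *\<^sub>R g (0 + a *\<^sub>R u) = ball_kernel 1 u *\<^sub>R f (x + a *\<^sub>R u)" for u
  proof -
    have "(a *\<^sub>R u \<in> ball 0 \<bar>a\<bar>) = (u \<in> ball 0 1)" using a by simp
    then have "\<bar>a\<bar> ^ DIM('a) * ball_kernel \<bar>a\<bar> (a *\<^sub>R u) = ball_kernel 1 u"
      using a by (auto simp: ball_kernel_def measure_lborel_ball indicator_def)
    then show ?thesis by (simp add: g_def)
  qed
  have L: "lborel = density (distr lborel borel (\<lambda>u :: 'a. 0 + a *\<^sub>R u)) (\<lambda>_. ennreal (\<bar>a\<bar> ^ DIM('a)))"
    using a by (subst lborel_affine[of a 0]) (simp_all add: ennreal_power)
  have "integrable (density (distr lborel borel (\<lambda>u :: 'a. 0 + a *\<^sub>R u)) (\<lambda>_. ennreal (\<bar>a\<bar> ^ DIM('a)))) g"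
    using int L by simp
  then have "integrable (distr lborel borel (\<lambda>u :: 'a. 0 + a *\<^sub>R u)) (\<lambda>y. \<bar>a\<bar> ^ DIM('a) *\<^sub>R g y)"
    by (subst (asm) integrable_density) auto
  then have "integrable lborel (\<lambda>u. \<bar>a\<bar> ^ DIM('a) *\<^sub>R g (0 + a *\<^sub>R u))"
    by (subst (asm) integrable_distr_eq) auto
  then show "integrable lborel (\<lambda>u. ball_kernel 1 u *\<^sub>R f (x + a *\<^sub>R u))"
    by (simp only: eq)
  have "convolve (ball_kernel \<bar>a\<bar>) f x = (\<integral>y. g y \<partial>lborel)" by (simp add: convolve_def g_def)
  also have "\<dots> = (\<integral>y. g y \<partial>density (distr lborel borel (\<lambda>u :: 'a. 0 + a *\<^sub>R u)) (\<lambda>_. ennreal (\<bar>a\<bar> ^ DIM('a))))"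
    by (subst (1) L) simp
  also have "\<dots> = (\<integral>y. \<bar>a\<bar> ^ DIM('a) *\<^sub>R g y \<partial>distr lborel borel (\<lambda>u :: 'a. 0 + a *\<^sub>R u))"
    by (rule integral_density) auto
  also have "\<dots> = (\<integral>u. \<bar>a\<bar> ^ DIM('a) *\<^sub>R g (0 + a *\<^sub>R u) \<partial>lborel)"
    by (rule integral_distr) measurable
  also have "\<dots> = (\<integral>u. ball_kernel 1 u *\<^sub>R f (x + a *\<^sub>R u) \<partial>lborel)" by (simp only: eq)
  finally show "(\<integral>u. ball_kernel 1 u *\<^sub>R f (x + a *\<^sub>R u) \<partial>lborel) = convolve (ball_kernel \<bar>a\<bar>) f x" ..
qed

text \<open>Pairing \<open>u\<close> with \<open>-u\<close>, the combination of ball averages is exactly the one for which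
  \<open>f - B\<^bsub>l,t\<^esub>f\<close> is an average of symmetric differences of order \<open>2l\<close>.\<close>

lemma deviation_as_average:
  assumes f: "f \<in> F" and t: "0 < t"
  shows "f x - smoother l t f x = (\<integral>u. ball_kernel 1 u *\<^sub>R
    ((1 / real ((2 * l) choose l)) *\<^sub>R (\<Sum>i\<le>2 * l. ((-1) ^ (i + l) * real ((2 * l) choose i)) *\<^sub>R f (x + ((real i - real l) * t) *\<^sub>R u))) \<partial>lborel)"
    (is "_ = ?R")
proof -
  let ?c = "\<lambda>i. (-1) ^ (i + l) * real ((2 * l) choose i)"
  let ?k = "\<lambda>i u. ball_kernel 1 u *\<^sub>R f (x + ((real i - real l) * t) *\<^sub>R u)"
  define \<beta> where "\<beta> = real ((2 * l) choose l)"
  have \<beta>: "\<beta> \<noteq> 0" by (simp add: \<beta>_def)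
  define J where "J c = (\<integral>u. ball_kernel 1 u *\<^sub>R f (x + c *\<^sub>R u) \<partial>lborel)" for c
  have int1: "integrable lborel (ball_kernel 1 :: 'a \<Rightarrow> real)"
    by (rule integrableI_bounded) (use L1_norm_ball_kernel[of 1, where 'a = 'a] in \<open>auto simp: L1_norm_def\<close>)
  have int: "integrable lborel (\<lambda>u. ball_kernel 1 u *\<^sub>R f (x + c *\<^sub>R u))" for c
  proof (cases "c = 0")
    case True
    then show ?thesis using int1 by simp
  qed (rule ball_kernel_scale(1)[OF f])
  \<comment> \<open>The middle index \<open>i = l\<close> has dilation 0 and returns
    \<open>f x\<close> itself; its coefficient is the central binomial coefficient, which explains
    the normalisation.\<close>
  have J0: "J 0 = f x"
  proof -
    have "(\<integral>u. ball_kernel 1 (u :: 'a) \<partial>lborel) = 1"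
    proof -
      have "(\<integral>\<^sup>+ u. ennreal (ball_kernel 1 (u :: 'a)) \<partial>lborel) = ennreal 1"
        using L1_norm_ball_kernel[of 1, where 'a = 'a] by (simp add: L1_norm_def ball_kernel_def)
      then show ?thesis by (intro integral_eq_nn_integral[THEN trans]) (auto simp: ball_kernel_def)
    qed
    then show ?thesis using int1 by (simp add: J_def)
  qed
  have Jc: "J c = convolve (ball_kernel \<bar>c\<bar>) f x" if "c \<noteq> 0" for c
    unfolding J_def using ball_kernel_scale(2)[OF f that] .
  define g where "g i = ?c i *\<^sub>R J ((real i - real l) * t)" for i
  have "?R = (1 / \<beta>) *\<^sub>R (\<Sum>i\<le>2 * l. g i)"
  proof -
    have "?R = (\<integral>u. (1 / \<beta>) *\<^sub>R (\<Sum>i\<le>2 * l. ?c i *\<^sub>R ?k i u) \<partial>lborel)"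
      by (simp add: \<beta>_def scaleR_sum_right mult_ac)
    also have "\<dots> = (1 / \<beta>) *\<^sub>R (\<integral>u. (\<Sum>i\<le>2 * l. ?c i *\<^sub>R ?k i u) \<partial>lborel)"
      by (rule integral_scaleR_right)
    also have "(\<integral>u. (\<Sum>i\<le>2 * l. ?c i *\<^sub>R ?k i u) \<partial>lborel)
      = (\<Sum>i\<le>2 * l. \<integral>u. ?c i *\<^sub>R ?k i u \<partial>lborel)"
      by (intro Bochner_Integration.integral_sum integrable_scaleR_right int)
    also have "\<dots> = (\<Sum>i\<le>2 * l. g i)"
      unfolding g_def J_def by (intro sum.cong refl integral_scaleR_right)
    finally show ?thesis .
  qed
  also have "(\<Sum>i\<le>2 * l. g i) = g l + (\<Sum>j = 1..l. g (l - j) + g (l + j))"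
    by (rule sum_symmetric_about)
  also have "g l = \<beta> *\<^sub>R f x" by (simp add: g_def J0 \<beta>_def)
  also have "(\<Sum>j = 1..l. g (l - j) + g (l + j)) = (\<Sum>j = 1..l. (2 * ((-1) ^ j * real ((2 * l) choose (l - j)))) *\<^sub>R convolve (ball_kernel (real j * t)) f x)"
  proof (rule sum.cong[OF refl])
    fix j assume j: "j \<in> {1..l}"
    have sym: "(2 * l) choose (l + j) = (2 * l) choose (l - j)"
      using binomial_symmetric[of "l + j" "2 * l"] j by (simp add: mult_2)
    have s1: "(-1 :: real) ^ (l - j + l) = (-1) ^ j"
    proof -
      have "(-1 :: real) ^ (l - j + l) = (-1) ^ (l - j + l) * ((-1) ^ j * (-1) ^ j)" by (simp flip: power_add)
      also have "\<dots> = (-1) ^ (l - j + l + j) * (-1) ^ j" by (simp add: power_add)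
      also have "l - j + l + j = 2 * l" using j by simp
      finally show ?thesis by simp
    qed
    have s2: "(-1 :: real) ^ (l + j + l) = (-1) ^ j" by (simp add: power_add)
    have "J ((real (l - j) - real l) * t) = convolve (ball_kernel (real j * t)) f x"
      using j t by (subst Jc) (auto simp: abs_mult of_nat_diff)
    moreover have "J ((real (l + j) - real l) * t) = convolve (ball_kernel (real j * t)) f x"
      using j t by (subst Jc) (auto simp: abs_mult)
    ultimately show "g (l - j) + g (l + j) = (2 * ((-1) ^ j * real ((2 * l) choose (l - j)))) *\<^sub>R convolve (ball_kernel (real j * t)) f x"
      unfolding g_def s1 s2 sym by (simp only: scaleR_add_left[symmetric] mult_2)
  qed
  also have "(1 / \<beta>) *\<^sub>R (\<beta> *\<^sub>R f x + (\<Sum>j = 1..l. (2 * ((-1) ^ j * real ((2 * l) choose (l - j)))) *\<^sub>R convolve (ball_kernel (real j * t)) f x))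
    = f x - (\<Sum>j = 1..l. combined_coeff l j *\<^sub>R convolve (ball_kernel (real j * t)) f x)"
    using \<beta> by (simp add: scaleR_add_right scaleR_sum_right combined_coeff_def \<beta>_def[symmetric] sum_negf)
  also have "(\<Sum>j = 1..l. combined_coeff l j *\<^sub>R convolve (ball_kernel (real j * t)) f x) = smoother l t f x"
    unfolding smoother_def combined_kernel_def[abs_def]
    by (subst convolve_kernel_sum[OF f]) (auto simp: convolve_kernel_cmult intro: kernel_cmult averaging_kernel_ball_kernel)
  finally show ?thesis ..
qed

text \<open>Minkowski reduces the claim to a single \<open>u\<close> in the unit ball, whose
  difference has step \<open>t *\<^sub>R u\<close> of norm at most \<open>t\<close>.\<close>

lemma deviation_le_om:
  assumes f: "f \<in> F" and t: "0 < t"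
  shows "deviation l f t \<le> om (2 * l) f t"
proof -
  have [measurable]: "f \<in> borel_measurable borel" using f by (rule F_measurable)
  define \<beta> where "\<beta> = real ((2 * l) choose l)"
  have "1 \<le> (2 * l) choose l" by (simp add: Suc_le_eq)
  then have \<beta>: "1 \<le> \<beta>" unfolding \<beta>_def by linarith
  define H where "H x u = (1 / \<beta>) *\<^sub>R (\<Sum>i\<le>2 * l. ((-1) ^ (i + l) * real ((2 * l) choose i)) *\<^sub>R f (x + ((real i - real l) * t) *\<^sub>R u))" for x u
  have "deviation l f t = N (\<lambda>x. \<integral>u. ball_kernel 1 u *\<^sub>R H x u \<partial>lborel)"
    unfolding deviation_def H_def \<beta>_def deviation_as_average[OF f t] ..
  also have "\<dots> \<le> ennreal 1 * om (2 * l) f t"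
  proof (rule N_average(1))
    show "(\<lambda>(x, u). H x u) \<in> borel_measurable (borel \<Otimes>\<^sub>M borel)" unfolding H_def by measurable
    show "L1_norm (ball_kernel 1 :: 'a \<Rightarrow> real) \<le> ennreal 1" by (simp add: L1_norm_ball_kernel)
    fix u :: 'a assume "ball_kernel 1 u \<noteq> 0"
    then have u: "norm u < 1" by (auto simp: ball_kernel_def indicator_def split: if_splits)
    define w where "w = (forward_difference (t *\<^sub>R u) ^^ (2 * l)) f"
    have w: "w \<in> F" unfolding w_def by (rule F_difference_funpow[OF f])
    \<comment> \<open>A symmetric difference is a forward difference moved back by \<open>l\<close>
      steps; the norm does not see this translation.\<close>
    have "(\<lambda>x. H x u) = (\<lambda>x. ((-1) ^ l / \<beta>) *\<^sub>R w (x + - ((real l * t) *\<^sub>R u)))"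
    proof
      fix x
      have "w (x + - ((real l * t) *\<^sub>R u)) = (\<Sum>i\<le>2 * l. ((-1) ^ i * real ((2 * l) choose i)) *\<^sub>R f (x + ((real i - real l) * t) *\<^sub>R u))"
        unfolding w_def funpow_forward_difference
        by (intro sum.cong refl) (simp add: power_add algebra_simps)
      then show "H x u = ((-1) ^ l / \<beta>) *\<^sub>R w (x + - ((real l * t) *\<^sub>R u))"
        by (simp add: H_def scaleR_sum_right power_add mult_ac)
    qed
    then have "N (\<lambda>x. H x u) = N (\<lambda>x. ((-1) ^ l / \<beta>) *\<^sub>R w (x + - ((real l * t) *\<^sub>R u)))" by (rule arg_cong)
    also have "\<dots> \<le> ennreal \<bar>(-1) ^ l / \<beta>\<bar> * N (\<lambda>x. w (x + - ((real l * t) *\<^sub>R u)))"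
      by (intro N_scaleR F_translate w)
    also have "\<dots> \<le> ennreal 1 * N w"
      unfolding N_translate[OF w] using \<beta> by (intro mult_right_mono ennreal_leI) (auto simp: power_abs)
    also have "\<dots> \<le> om (2 * l) f t"
      unfolding w_def using u t by (auto intro!: om_upper simp: mult_le_cancel_left2)
    finally show "N (\<lambda>x. H x u) \<le> om (2 * l) f t" .
  qed measurable
  finally show ?thesis by simp
qed

end

section \<open>Equivalence of the two quasi-norms\<close>

context translation_setting
begin

text \<open>A substitute for \<open>t\<^sup>k \<parallel>\<nabla>\<^sup>k g\<parallel>\<close> that avoids derivatives, for \<open>g\<close> the \<open>k\<close>-fold
  smoothing of \<open>f\<close> at scale \<open>t\<close>.\<close>

definition smooth_seminorm :: "nat \<Rightarrow> nat \<Rightarrow> ('a \<Rightarrow> complex) \<Rightarrow> real \<Rightarrow> ennreal" where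
  "smooth_seminorm l k f t =
    (SUP h\<in>{h. h \<noteq> 0}. ennreal ((t / norm h) ^ k) * N ((forward_difference h ^^ k) ((smoother l t ^^ k) f)))"

lemma F_smoother_funpow: "f \<in> F \<Longrightarrow> (smoother l t ^^ k) f \<in> F"
  by (rule linop_closed[OF linop_funpow[OF linop_smoother]])

text \<open>The scale \<open>\<tau>\<close> of the weight may lie below the scale \<open>t\<close>
  of the smoothing: functions smoothed at scale \<open>2 * t\<close> will be measured with the
  weight of scale \<open>t\<close>.\<close>

lemma scaled_N_difference_smoother_funpow:
  assumes "f \<in> F" "0 < t" "0 < \<tau>" "\<tau> \<le> t" "h \<noteq> 0"
  shows "ennreal ((\<tau> / norm h) ^ k) * N ((forward_difference h ^^ k) ((smoother l t ^^ k) f))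
    \<le> ennreal (smoothing_bound l ^ k) * N f"
proof -
  have "ennreal ((\<tau> / norm h) ^ k) * N ((forward_difference h ^^ k) ((smoother l t ^^ k) f))
      \<le> ennreal ((\<tau> / norm h) ^ k) * (ennreal ((smoothing_bound l * (norm h / t)) ^ k) * N f)"
    using assms by (intro mult_left_mono N_difference_smoother_funpow) auto
  also have "\<dots> = ennreal ((\<tau> / norm h) ^ k * (smoothing_bound l * (norm h / t)) ^ k) * N f"
    using assms by (subst ennreal_mult) (auto simp: mult.assoc)
  also have "(\<tau> / norm h) ^ k * (smoothing_bound l * (norm h / t)) ^ k = (smoothing_bound l * (\<tau> / t)) ^ k"
    using assms by (simp add: power_mult_distrib[symmetric] mult.commute)
  also have "ennreal ((smoothing_bound l * (\<tau> / t)) ^ k) * N f \<le> ennreal (smoothing_bound l ^ k) * N f"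
  proof (intro mult_right_mono ennreal_leI power_mono)
    show "smoothing_bound l * (\<tau> / t) \<le> smoothing_bound l"
      using assms by (intro mult_left_le) auto
  qed (use assms in auto)
  finally show ?thesis .
qed

lemma smooth_seminorm_le:
  assumes "f \<in> F" "0 < t"
  shows "smooth_seminorm l k f t \<le> ennreal (smoothing_bound l ^ k) * N f"
  unfolding smooth_seminorm_def using assms
  by (intro SUP_least scaled_N_difference_smoother_funpow) auto

text \<open>Since the smoothing operators commute,
  \<open>A\<^sub>t\<^sup>k f - A\<^bsub>2t\<^esub>\<^sup>k f = A\<^sub>t\<^sup>k (f - A\<^bsub>2t\<^esub>\<^sup>k f) - A\<^bsub>2t\<^esub>\<^sup>k (f - A\<^sub>t\<^sup>k f)\<close>: the difference of two scales is itself
  a smoothed deviation.\<close>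

lemma smooth_seminorm_step:
  fixes l k :: nat
  assumes f: "f \<in> F" and t: "0 < t"
  defines "E \<equiv> smoothing_bound l ^ k * (\<Sum>i<k. combined_bound l ^ i)"
  shows "smooth_seminorm l k f t \<le> ennreal (2 powr (- real k)) * smooth_seminorm l k f (2 * t)
    + (ennreal E * deviation l f (2 * t) + ennreal E * deviation l f t)"
  unfolding smooth_seminorm_def[of l k f t]
proof (rule SUP_least)
  fix h :: 'a assume "h \<in> {h. h \<noteq> 0}"
  then have h: "h \<noteq> 0" by simp
  let ?r = "ennreal ((t / norm h) ^ k)" and ?\<Phi> = "ennreal (2 powr (- real k)) * smooth_seminorm l k f (2 * t)"
  define S1 where "S1 = smoother l t ^^ k"
  define S2 where "S2 = smoother l (2 * t) ^^ k"
  define G where "G = forward_difference h ^^ k"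
  have lin: "linop S1" "linop S2" "linop G"
    unfolding S1_def S2_def G_def by (intro linop_funpow linop_smoother linop_forward_difference)+
  define u where "u x = f x - S2 f x" for x
  define v where "v x = f x - S1 f x" for x
  have SF: "S1 f \<in> F" "S2 f \<in> F" using lin f by (simp_all add: linop_closed)
  have uv: "u \<in> F" "v \<in> F" unfolding u_def v_def by (intro F_diff f SF)+
  have comm: "S1 (S2 f) = S2 (S1 f)"
    unfolding S1_def S2_def
  proof (rule funpow_commute2)
    show "smoother l t (smoother l (2 * t) g) = smoother l (2 * t) (smoother l t g)" if "g \<in> F" for g
      using that by (rule smoother_commute)
  qed (rule linop_smoother f)+
  have eq: "S1 f x = (S1 u x - S2 v x) + S2 f x" for x
    using linop_diff[OF lin(1) f SF(2)] linop_diff[OF lin(2) f SF(1)] comm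
    by (simp add: u_def[abs_def] v_def[abs_def])
  have w: "(\<lambda>x. S1 u x - S2 v x) \<in> F" using lin uv by (intro F_diff) (simp_all add: linop_closed)
  have GF: "G (S1 u) \<in> F" "G (S2 v) \<in> F" "G (S2 f) \<in> F" "S1 u \<in> F" "S2 v \<in> F"
    using lin uv SF by (simp_all add: linop_closed)
  have "S1 f = (\<lambda>x. S2 f x - (S2 v x - S1 u x))"
    using eq by (simp add: fun_eq_iff)
  then have "G (S1 f) = (\<lambda>x. G (S2 f) x - (G (S2 v) x - G (S1 u) x))"
    using linop_diff[OF lin(3) SF(2) F_diff[OF GF(5,4)]] linop_diff[OF lin(3) GF(5,4)] by simp
  then have "N (G (S1 f)) = N (\<lambda>x. G (S2 f) x - (G (S2 v) x - G (S1 u) x))" by (rule arg_cong)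
  also have "\<dots> \<le> N (G (S2 f)) + N (\<lambda>x. G (S2 v) x - G (S1 u) x)"
    by (intro N_diff F_diff GF)
  also have "\<dots> \<le> N (G (S2 f)) + (N (G (S2 v)) + N (G (S1 u)))"
    by (intro add_left_mono N_diff GF)
  finally have "?r * N (G (S1 f))
      \<le> ?r * (N (G (S2 f)) + (N (G (S2 v)) + N (G (S1 u))))"
    by (rule mult_left_mono) simp
  also have "\<dots> = ?r * N (G (S2 f))
      + (?r * N (G (S2 v)) + ?r * N (G (S1 u)))"
    by (simp only: distrib_left)
  also have "\<dots> \<le> ?\<Phi>
      + (ennreal (smoothing_bound l ^ k) * N v + ennreal (smoothing_bound l ^ k) * N u)"
  proof (intro add_mono)
    \<comment> \<open>The origin of the gain: the same function \<open>S2 f\<close> is measured with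
      the weight of scale \<open>t\<close> instead of \<open>2 * t\<close>.\<close>
    have "(t / norm h) ^ k = 2 powr (- real k) * ((2 * t) / norm h) ^ k"
      by (simp add: powr_minus powr_realpow power_mult_distrib power_divide field_simps)
    then have "?r * N (G (S2 f))
      = ennreal (2 powr (- real k)) * (ennreal (((2 * t) / norm h) ^ k) * N (G (S2 f)))"
      using t by (simp only:) (subst ennreal_mult, auto simp: mult.assoc)
    also have "\<dots> \<le> ?\<Phi>"
      unfolding smooth_seminorm_def G_def S2_def using h
      by (intro mult_left_mono SUP_upper) auto
    finally show "?r * N (G (S2 f)) \<le> ?\<Phi>" .
    show "?r * N (G (S2 v)) \<le> ennreal (smoothing_bound l ^ k) * N v"
      unfolding G_def S2_def using uv t h by (intro scaled_N_difference_smoother_funpow) auto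
    show "?r * N (G (S1 u)) \<le> ennreal (smoothing_bound l ^ k) * N u"
      unfolding G_def S1_def using uv t h by (intro scaled_N_difference_smoother_funpow) auto
  qed
  also have "\<dots> \<le> ?\<Phi>
      + (ennreal E * deviation l f t + ennreal E * deviation l f (2 * t))"
  proof (intro add_left_mono add_mono)
    have *: "ennreal (smoothing_bound l ^ k) * N (\<lambda>x. f x - (smoother l r ^^ k) f x) \<le> ennreal E * deviation l f r" if "0 < r" for r
    proof -
      have "ennreal (smoothing_bound l ^ k) * N (\<lambda>x. f x - (smoother l r ^^ k) f x)
        \<le> ennreal (smoothing_bound l ^ k) * (ennreal (\<Sum>i<k. combined_bound l ^ i) * deviation l f r)"
        using f that by (intro mult_left_mono N_minus_smoother_funpow) auto
      also have "\<dots> = ennreal E * deviation l f r"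
        unfolding E_def by (subst ennreal_mult) (auto simp: mult.assoc sum_nonneg)
      finally show ?thesis .
    qed
    show "ennreal (smoothing_bound l ^ k) * N v \<le> ennreal E * deviation l f t"
      unfolding v_def[abs_def] S1_def by (rule *[OF t])
    show "ennreal (smoothing_bound l ^ k) * N u \<le> ennreal E * deviation l f (2 * t)"
      unfolding u_def[abs_def] S2_def using t by (intro *) simp
  qed
  finally show "?r * N ((forward_difference h ^^ k) ((smoother l t ^^ k) f))
    \<le> ?\<Phi>
      + (ennreal E * deviation l f (2 * t) + ennreal E * deviation l f t)"
    unfolding G_def S1_def by (simp only: add.commute)
qed

text \<open>Split \<open>f\<close> into its k-fold smoothing and the remainder. The remainder costs
  \<open>2 ^ k\<close>, and on the smooth part the weight is at least 1 because
  \<open>norm h \<le> t\<close>.\<close>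

lemma om_le_smooth_seminorm:
  assumes f: "f \<in> F" and t: "0 < t" and k: "0 < k"
  shows "om k f t \<le> ennreal (2 ^ k * (\<Sum>i<k. combined_bound l ^ i)) * deviation l f t + smooth_seminorm l k f t"
  unfolding om_eq
proof (rule SUP_least)
  let ?c = "ennreal (2 ^ k * (\<Sum>i<k. combined_bound l ^ i))"
  fix h :: 'a assume "h \<in> {h. norm h \<le> t}"
  then have h: "norm h \<le> t" by simp
  show "N ((forward_difference h ^^ k) f) \<le> ?c * deviation l f t + smooth_seminorm l k f t"
  proof (cases "h = 0")
    case True
    \<comment> \<open>The step \<open>h = 0\<close> does not occur in
      \<open>smooth_seminorm\<close>; here the difference vanishes because
      \<open>k > 0\<close>.\<close>
    obtain j where "k = Suc j" using k by (cases k) auto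
    then have "(forward_difference h ^^ k) f = (\<lambda>x. 0)"
      using True by (simp add: forward_difference_def)
    then show ?thesis by (simp add: N_zero)
  next
    case False
    define G where "G = forward_difference h ^^ k"
    define g where "g = (smoother l t ^^ k) f"
    have g: "g \<in> F" unfolding g_def using f by (rule F_smoother_funpow)
    have lin: "linop G" unfolding G_def by (intro linop_funpow linop_forward_difference)
    have d: "(\<lambda>x. f x - g x) \<in> F" by (intro F_diff f g)
    have "N (G f) = N (\<lambda>x. G (\<lambda>x. f x - g x) x + G g x)"
      using linop_diff[OF lin f g] by simp
    also have "\<dots> \<le> N (G (\<lambda>x. f x - g x)) + N (G g)"
      by (intro N_add linop_closed[OF lin] d g)
    also have "\<dots> \<le> ?c * deviation l f t + smooth_seminorm l k f t"
    proof (intro add_mono)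
      have "N (G (\<lambda>x. f x - g x)) \<le> ennreal (2 ^ k) * N (\<lambda>x. f x - g x)"
        unfolding G_def by (rule N_difference_funpow[OF d])
      also have "\<dots> \<le> ennreal (2 ^ k) * (ennreal (\<Sum>i<k. combined_bound l ^ i) * deviation l f t)"
        unfolding g_def using f t by (intro mult_left_mono N_minus_smoother_funpow) auto
      also have "\<dots> = ?c * deviation l f t"
        by (subst ennreal_mult) (auto simp: mult.assoc sum_nonneg)
      finally show "N (G (\<lambda>x. f x - g x)) \<le> ?c * deviation l f t" .
      have "1 \<le> (t / norm h) ^ k" using False h by (intro one_le_power) auto
      then have "ennreal 1 * N (G g) \<le> ennreal ((t / norm h) ^ k) * N (G g)"
        by (intro mult_right_mono ennreal_leI) auto
      also have "\<dots> \<le> smooth_seminorm l k f t"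
        unfolding smooth_seminorm_def G_def g_def using False by (intro SUP_upper) auto
      finally show "N (G g) \<le> smooth_seminorm l k f t" by simp
    qed
    finally show ?thesis by (simp only: G_def)
  qed
qed

section \<open>Weighted estimates between moduli and deviations\<close>

lemma ennreal_affine_collect:
  fixes x y A L :: ennreal
  assumes "x \<le> ennreal K * (ennreal a * A + y)" "y = ennreal c * L" "0 \<le> K" "0 \<le> c"
  shows "x \<le> ennreal (K * max a c) * (A + L)"
proof -
  have "x \<le> ennreal K * (ennreal (max a c) * (A + L))"
    using assms(1,2) ennreal_linear_combination_le[of a A c L]
    by (metis mult_left_mono order_trans zero_le)
  moreover have "0 \<le> max a c" using assms(4) by simp
  ultimately show ?thesis using assms(3) by (simp only: ennreal_mult mult.assoc)
qed

text \<open>The number of smoothings equals the order \<open>k\<close> of the modulus. The two-scale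
  comparison then contracts by \<open>2 powr (- real k)\<close>, and \<open>s < k\<close> makes the
  Hardy inequality applicable.\<close>

lemma log_weighted_norm_om_le_deviation:
  assumes s: "0 \<le> s" "s < real k" and q: "0 < q"
  shows "\<exists>C>0. \<forall>f\<in>F. log_weighted_norm s b q (om k f) \<le> ennreal C * (N f + log_weighted_norm s b q (deviation l f))"
proof -
  let ?L = "log_weighted_norm s b q"
  have k: "0 < k" using s by simp
  define e where "e = (\<Sum>i<k. combined_bound l ^ i)"
  define E where "E = smoothing_bound l ^ k * e"
  \<comment> \<open>Large enough for two purposes: \<open>2 ^ k * e \<le> c\<close>, so that
    \<open>\<Psi>\<close> below dominates the modulus, and
    \<open>E \<le> 2 powr (- real k) * c\<close>, so that the deviation at scale
    \<open>2 * t\<close> disappears into \<open>\<Psi> (2 * t)\<close>.\<close>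
  define c where "c = 2 ^ k * (E + e)"
  have nn: "0 \<le> e" "0 \<le> E" "0 \<le> c" by (simp_all add: e_def E_def c_def sum_nonneg)
  define a0 where "a0 = smoothing_bound l ^ k + c * (1 + combined_bound l)"
  \<comment> \<open>The summand 1 guarantees positivity, as pulling the constant out of the weighted
    norm demands.\<close>
  define c1 where "c1 = E + c + 1"
  have pos: "0 \<le> a0" "0 < c1" using nn by (simp_all add: a0_def c1_def)
  obtain K where K: "0 < K"
    "\<And>\<phi> \<psi> A. dyadic_recursion (real k) A \<phi> \<psi> \<Longrightarrow> (\<lambda>t. \<psi> t * indicator {0<..<1} t) \<in> borel_measurable borel
      \<Longrightarrow> ?L \<phi> \<le> ennreal K * (A + ?L \<psi>)"
    using log_weighted_norm_hardy[of s "real k" q b] s k q by auto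
  have "?L (om k f) \<le> ennreal (K * max a0 c1) * (N f + ?L (deviation l f))"
    if f: "f \<in> F" for f
  proof -
    define \<Psi> where "\<Psi> t = smooth_seminorm l k f t + ennreal c * deviation l f t" for t
    have "?L (om k f) \<le> ?L \<Psi>"
    proof (rule log_weighted_norm_mono)
      fix t :: real assume "0 < t" "t < 1"
      then have "om k f t \<le> ennreal (2 ^ k * e) * deviation l f t + smooth_seminorm l k f t"
        unfolding e_def using f k by (intro om_le_smooth_seminorm)
      also have "\<dots> \<le> ennreal c * deviation l f t + smooth_seminorm l k f t"
        using nn by (intro add_right_mono mult_right_mono ennreal_leI) (auto simp: c_def)
      finally show "om k f t \<le> \<Psi> t" by (simp add: \<Psi>_def add.commute)
    qed
    also have "\<dots> \<le> ennreal K * (ennreal a0 * N f + ?L (\<lambda>t. ennreal c1 * deviation l f t))"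
    proof (rule K(2))
      have "ennreal a0 * N f < top" using N_finite[OF f] by (simp add: ennreal_mult_less_top)
      moreover have "\<Psi> t \<le> ennreal a0 * N f" if t: "0 < t" for t
      proof -
        have "\<Psi> t \<le> ennreal (smoothing_bound l ^ k) * N f + ennreal c * (ennreal (1 + combined_bound l) * N f)"
          unfolding \<Psi>_def using f t by (intro add_mono mult_left_mono smooth_seminorm_le deviation_le) auto
        also have "\<dots> = ennreal a0 * N f"
        proof -
          have "ennreal a0 = ennreal (smoothing_bound l ^ k) + ennreal c * ennreal (1 + combined_bound l)"
            unfolding a0_def using nn by (subst ennreal_plus) (auto simp: ennreal_mult simp del: ennreal_plus)
          then show ?thesis by (simp only: distrib_right mult.assoc)
        qed
        finally show ?thesis .
      qed
      moreover have "\<Psi> t \<le> ennreal (2 powr (- real k)) * \<Psi> (2 * t) + ennreal c1 * deviation l f t" if t: "0 < t" for t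
      proof -
        have "\<Psi> t \<le> (ennreal (2 powr (- real k)) * smooth_seminorm l k f (2 * t)
            + (ennreal E * deviation l f (2 * t) + ennreal E * deviation l f t)) + ennreal c * deviation l f t"
          unfolding \<Psi>_def E_def e_def using f t by (intro add_right_mono smooth_seminorm_step)
        also have "\<dots> = (ennreal (2 powr (- real k)) * smooth_seminorm l k f (2 * t)
            + ennreal E * deviation l f (2 * t)) + (ennreal E + ennreal c) * deviation l f t"
          by (simp only: distrib_right add.assoc)
        also have "\<dots> \<le> (ennreal (2 powr (- real k)) * smooth_seminorm l k f (2 * t)
            + ennreal (2 powr (- real k)) * (ennreal c * deviation l f (2 * t))) + ennreal c1 * deviation l f t"
        proof (intro add_mono order_refl)
          have "E \<le> 2 powr (- real k) * c"
            using nn by (simp add: c_def powr_minus powr_realpow field_simps)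
          then have "ennreal E \<le> ennreal (2 powr (- real k)) * ennreal c"
            using nn by (subst ennreal_mult[symmetric]) (auto intro: ennreal_leI)
          then show "ennreal E * deviation l f (2 * t) \<le> ennreal (2 powr (- real k)) * (ennreal c * deviation l f (2 * t))"
            by (metis mult.assoc mult_right_mono zero_le)
          have "ennreal E + ennreal c \<le> ennreal c1"
            using nn by (subst ennreal_plus[symmetric]) (auto simp: c1_def intro!: ennreal_leI simp del: ennreal_plus)
          then show "(ennreal E + ennreal c) * deviation l f t \<le> ennreal c1 * deviation l f t"
            by (rule mult_right_mono) simp
        qed
        also have "\<dots> = ennreal (2 powr (- real k)) * \<Psi> (2 * t) + ennreal c1 * deviation l f t"
          by (simp only: \<Psi>_def distrib_left)
        finally show ?thesis .
      qed
      ultimately show "dyadic_recursion (real k) (ennreal a0 * N f) \<Psi> (\<lambda>t. ennreal c1 * deviation l f t)"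
        by (simp add: dyadic_recursion_def)
      have "(\<lambda>t. ennreal c1 * (deviation l f t * indicator {0<..<1} t)) \<in> borel_measurable borel"
        using deviation_measurable[OF f] by measurable
      then show "(\<lambda>t. ennreal c1 * deviation l f t * indicator {0<..<1} t) \<in> borel_measurable borel"
        by (simp only: mult.assoc)
    qed
    finally show ?thesis
    proof (rule ennreal_affine_collect)
      show "?L (\<lambda>t. ennreal c1 * deviation l f t) = ennreal c1 * ?L (deviation l f)"
        using pos q f by (intro log_weighted_norm_cmult deviation_measurable)
    qed (use K(1) pos in simp_all)
  qed
  moreover have "0 < K * max a0 c1" using K(1) pos by (auto simp: less_max_iff_disj)
  ultimately show ?thesis by blast
qed

lemma om_indicator_measurable: "f \<in> F \<Longrightarrow> (\<lambda>t. om k f t * indicator {0<..<1} t) \<in> borel_measurable borel"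
  using om_measurable[of f k] by measurable

text \<open>The Marchaud step is a dyadic recursion for the modulus of order \<open>k\<close>,
  forced by the modulus of order \<open>k + 1\<close>.\<close>

lemma log_weighted_norm_om_Suc:
  assumes s: "0 \<le> s" "s < real k" and q: "0 < q"
  shows "\<exists>C>0. \<forall>f\<in>F. log_weighted_norm s b q (om k f) \<le> ennreal C * (N f + log_weighted_norm s b q (om (Suc k) f))"
proof -
  let ?L = "log_weighted_norm s b q"
  have k: "0 < k" using s by simp
  obtain K where K: "0 < K"
    "\<And>\<phi> \<psi> A. dyadic_recursion (real k) A \<phi> \<psi> \<Longrightarrow> (\<lambda>t. \<psi> t * indicator {0<..<1} t) \<in> borel_measurable borel
      \<Longrightarrow> ?L \<phi> \<le> ennreal K * (A + ?L \<psi>)"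
    using log_weighted_norm_hardy[of s "real k" q b] s k q by auto
  have "?L (om k f) \<le> ennreal (K * max (2 ^ k) (real k)) * (N f + ?L (om (Suc k) f))"
    if f: "f \<in> F" for f
  proof (rule ennreal_affine_collect)
    show "?L (\<lambda>t. ennreal (real k) * om (Suc k) f t) = ennreal (real k) * ?L (om (Suc k) f)"
      using k q f by (intro log_weighted_norm_cmult om_indicator_measurable) auto
    show "?L (om k f)
        \<le> ennreal K * (ennreal (2 ^ k) * N f + ?L (\<lambda>t. ennreal (real k) * om (Suc k) f t))"
    proof (rule K(2))
      show "dyadic_recursion (real k) (ennreal (2 ^ k) * N f) (om k f) (\<lambda>t. ennreal (real k) * om (Suc k) f t)"
        using N_finite[OF f] om_le[OF f] marchaud_step[OF f]
        by (simp add: dyadic_recursion_def ennreal_mult_less_top)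
      have "(\<lambda>t. ennreal (real k) * (om (Suc k) f t * indicator {0<..<1} t)) \<in> borel_measurable borel"
        using om_indicator_measurable[OF f] by measurable
      then show "(\<lambda>t. ennreal (real k) * om (Suc k) f t * indicator {0<..<1} t) \<in> borel_measurable borel"
        by (simp only: mult.assoc)
    qed
  qed (use K(1) in simp_all)
  moreover have "0 < K * max (2 ^ k) (real k)" using K(1) by (auto simp: less_max_iff_disj)
  ultimately show ?thesis by blast
qed

lemma log_weighted_norm_om_add:
  assumes s: "0 \<le> s" "s < real k" and q: "0 < q"
  shows "\<exists>C>0. \<forall>f\<in>F. log_weighted_norm s b q (om k f) \<le> ennreal C * (N f + log_weighted_norm s b q (om (k + n) f))"
proof (induction n)
  case 0
  let ?L = "log_weighted_norm s b q"
  have "?L (om k f) \<le> ennreal 1 * (N f + ?L (om (k + 0) f))" for f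
    by (simp add: add_increasing)
  then show ?case by (intro exI[of _ 1]) simp
next
  case (Suc n)
  let ?L = "log_weighted_norm s b q"
  from Suc obtain C where C: "0 < C"
    "\<And>f. f \<in> F \<Longrightarrow> ?L (om k f) \<le> ennreal C * (N f + ?L (om (k + n) f))" by blast
  obtain D where D: "0 < D"
    "\<And>f. f \<in> F \<Longrightarrow> ?L (om (k + n) f) \<le> ennreal D * (N f + ?L (om (Suc (k + n)) f))"
    using log_weighted_norm_om_Suc[of s "k + n" q b] s q by force
  have "?L (om k f) \<le> ennreal (C * (1 + D)) * (N f + ?L (om (k + Suc n) f))" if f: "f \<in> F" for f
  proof -
    let ?M = "?L (om (k + Suc n) f)"
    have "?L (om k f) \<le> ennreal C * (N f + ennreal D * (N f + ?M))"
      using order_trans[OF C(2)[OF f] mult_left_mono[OF add_left_mono[OF D(2)[OF f]]]] by simp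
    also have "\<dots> \<le> ennreal C * ((N f + ?M) + ennreal D * (N f + ?M))"
      by (intro mult_left_mono add_right_mono) auto
    also have "(N f + ?M) + ennreal D * (N f + ?M) = ennreal (1 + D) * (N f + ?M)"
      using D(1) by (simp add: distrib_right)
    finally show ?thesis using C(1) D(1) by (simp add: ennreal_mult mult.assoc)
  qed
  moreover have "0 < C * (1 + D)" using C D by simp
  ultimately show ?case by blast
qed

text \<open>The deviation is governed by the modulus of order \<open>2 * l\<close>. If this order is
  at least \<open>k\<close>, extra differences only cost powers of 2; otherwise Marchaud's
  inequality climbs from \<open>2 * l\<close> to \<open>k\<close>, and \<open>s < 2 * l\<close> is
  what allows its first step.\<close>

lemma log_weighted_norm_deviation_le_om:
  assumes s: "0 \<le> s" "s < real k" "s < 2 * real l" and q: "0 < q"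
  shows "\<exists>C>0. \<forall>f\<in>F. log_weighted_norm s b q (deviation l f) \<le> ennreal C * (N f + log_weighted_norm s b q (om k f))"
proof (cases "k \<le> 2 * l")
  let ?L = "log_weighted_norm s b q"
  case True
  have "?L (deviation l f) \<le> ennreal (2 ^ (2 * l - k)) * (N f + ?L (om k f))" if f: "f \<in> F" for f
  proof -
    have "?L (deviation l f) \<le> ?L (\<lambda>t. ennreal (2 ^ (2 * l - k)) * om k f t)"
    proof (rule log_weighted_norm_mono)
      fix t :: real assume "0 < t" "t < 1"
      then have "deviation l f t \<le> om (k + (2 * l - k)) f t" using deviation_le_om[OF f] True by simp
      also have "\<dots> \<le> ennreal (2 ^ (2 * l - k)) * om k f t" by (rule om_add_le[OF f])
      finally show "deviation l f t \<le> ennreal (2 ^ (2 * l - k)) * om k f t" .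
    qed
    also have "\<dots> = ennreal (2 ^ (2 * l - k)) * ?L (om k f)"
      using q f by (intro log_weighted_norm_cmult om_indicator_measurable) auto
    also have "\<dots> \<le> ennreal (2 ^ (2 * l - k)) * (N f + ?L (om k f))"
      by (intro mult_left_mono) (auto simp: add_increasing)
    finally show ?thesis .
  qed
  then show ?thesis by (intro exI[of _ "2 ^ (2 * l - k)"]) auto
next
  case False
  let ?L = "log_weighted_norm s b q"
  obtain C where C: "0 < C"
    "\<And>f. f \<in> F \<Longrightarrow> ?L (om (2 * l) f) \<le> ennreal C * (N f + ?L (om (2 * l + (k - 2 * l)) f))"
    using log_weighted_norm_om_add[of s "2 * l" q b "k - 2 * l"] s q by auto
  have "?L (deviation l f) \<le> ennreal C * (N f + ?L (om k f))" if f: "f \<in> F" for f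
  proof -
    have "?L (deviation l f) \<le> ?L (om (2 * l) f)"
      by (intro log_weighted_norm_mono deviation_le_om f)
    also have "\<dots> \<le> ennreal C * (N f + ?L (om k f))" using C(2)[OF f] False by simp
    finally show ?thesis .
  qed
  then show ?thesis using C(1) by blast
qed

lemma besov_norm_M_equivalent:
  assumes s: "0 \<le> s" "s < real k" "s < 2 * real l" and q: "0 < q"
  shows "\<exists>C>0. \<forall>f\<in>F. besov_norm M k s b p q f \<le> ennreal C * ball_average_norm M l s b p q f
    \<and> ball_average_norm M l s b p q f \<le> ennreal C * besov_norm M k s b p q f"
proof -
  let ?L = "log_weighted_norm s b q"
  have add_le: "x + y \<le> ennreal (1 + c) * (x + z)" if "y \<le> ennreal c * (x + z)" "0 \<le> c" for x y z :: ennreal and c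
  proof -
    have "x + y \<le> (x + z) + ennreal c * (x + z)" using that by (intro add_mono) auto
    then show ?thesis using that by (simp add: distrib_right)
  qed
  obtain C where C: "0 < C"
    "\<And>f. f \<in> F \<Longrightarrow> ?L (om k f) \<le> ennreal C * (N f + ?L (deviation l f))"
    using log_weighted_norm_om_le_deviation[of s k q b l] s q by blast
  obtain D where D: "0 < D"
    "\<And>f. f \<in> F \<Longrightarrow> ?L (deviation l f) \<le> ennreal D * (N f + ?L (om k f))"
    using log_weighted_norm_deviation_le_om[of s k l q b] s q by blast
  define B where "B = 1 + max C D"
  have "besov_norm M k s b p q f \<le> ennreal B * ball_average_norm M l s b p q f
    \<and> ball_average_norm M l s b p q f \<le> ennreal B * besov_norm M k s b p q f" if f: "f \<in> F" for f
  proof -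
    have 1: "besov_norm M k s b p q f = N f + ?L (om k f)"
      by (simp add: besov_norm_def N_def)
    have "?L (\<lambda>t. Lp_norm M p (\<lambda>x. f x - combined_ball_average l t f x)) = ?L (deviation l f)"
      using combined_ball_average_eq[OF f]
      by (intro antisym log_weighted_norm_mono) (simp_all add: deviation_def N_def)
    then have 2: "ball_average_norm M l s b p q f = N f + ?L (deviation l f)"
      by (simp add: ball_average_norm_def N_def)
    have "?L (om k f) \<le> ennreal (max C D) * (N f + ?L (deviation l f))"
      using C(2)[OF f] by (rule order_trans) (intro mult_right_mono ennreal_leI, auto)
    moreover have "?L (deviation l f) \<le> ennreal (max C D) * (N f + ?L (om k f))"
      using D(2)[OF f] by (rule order_trans) (intro mult_right_mono ennreal_leI, auto)
    ultimately show ?thesis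
      unfolding 1 2 B_def using C(1) by (intro conjI add_le) auto
  qed
  moreover have "0 < B" using C(1) by (simp add: B_def)
  ultimately show ?thesis by blast
qed

end

section \<open>Borel representatives and periodic functions\<close>

lemma borel_measurable_lebesgue_cong_AE:
  fixes f g :: "'a::euclidean_space \<Rightarrow> 'b::topological_space"
  assumes [measurable]: "g \<in> borel_measurable borel" and ae: "AE x in lborel. f x = g x"
  shows "f \<in> borel_measurable lebesgue"
proof (rule measurableI)
  fix A :: "'b set" assume A: "A \<in> sets borel"
  have "AE x in lebesgue. x \<in> g -` A \<longleftrightarrow> x \<in> f -` A"
    unfolding AE_completion_iff using ae by (auto elim: eventually_mono)
  moreover have "g -` A \<in> sets lebesgue"
    using measurable_sets[OF assms(1) A] by simp
  ultimately have "f -` A \<in> sets lebesgue"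
    by (rule completion.in_sets_AE) simp
  then show "f -` A \<inter> space lebesgue \<in> sets lebesgue" by simp
qed simp

lemma AE_lborel_translate:
  fixes h :: "'a::euclidean_space"
  assumes "AE x in lborel. P x"
  shows "AE x in lborel. P (x + h)"
proof -
  have "AE x in distr lborel borel ((+) h). P x" using assms by (simp only: lborel_distr_plus)
  then have "AE x in lborel. P (h + x)" by (intro AE_distrD[of "(+) h" lborel borel]) auto
  then show ?thesis by (simp only: add.commute)
qed

section \<open>Independence of the representative\<close>

lemma Lp_norm_lebesgue_on_borel:
  fixes g :: "'a::euclidean_space \<Rightarrow> complex"
  assumes [measurable]: "S \<in> sets borel" "g \<in> borel_measurable borel"
  shows "Lp_norm (lebesgue_on S) p g = Lp_norm (density lborel (indicator S)) p g"
proof (cases "p = \<infinity>")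
  case True
  have S: "S \<inter> space lebesgue \<in> sets lebesgue" using assms(1) by simp
  have "g \<in> borel_measurable (lebesgue_on S)"
    by (intro measurable_restrict_space1 measurable_completion) measurable
  moreover have "(AE x in lebesgue_on S. Q x) \<longleftrightarrow> (AE x in density lborel (indicator S). Q x)" for Q
    by (subst AE_restrict_space_iff[OF S]) (auto simp: AE_completion_iff AE_density indicator_def)
  ultimately have "Lp_norm (lebesgue_on S) p g \<le> c \<longleftrightarrow> Lp_norm (density lborel (indicator S)) p g \<le> c" for c
    unfolding True by (subst (1 2) Lp_norm_top_le_iff) auto
  then show ?thesis by (meson order_antisym order_refl)
next
  case False
  have "(\<integral>\<^sup>+ x. ennreal (norm (g x)) epowr enn2real p \<partial>lebesgue_on S)
      = (\<integral>\<^sup>+ x. ennreal (norm (g x)) epowr enn2real p * indicator S x \<partial>lborel)"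
    by (subst nn_integral_restrict_space) (auto simp: nn_integral_completion)
  also have "\<dots> = (\<integral>\<^sup>+ x. ennreal (norm (g x)) epowr enn2real p \<partial>density lborel (indicator S))"
    by (subst nn_integral_density) (auto simp: mult.commute)
  finally show ?thesis by (simp only: Lp_norm_finite_exponent[OF False])
qed

lemma Lp_norm_lebesgue_on_cong_AE:
  fixes f g :: "'a::euclidean_space \<Rightarrow> complex"
  assumes S: "S \<in> sets borel" and g: "g \<in> borel_measurable borel" and ae: "AE x in lborel. f x = g x"
  shows "Lp_norm (lebesgue_on S) p f = Lp_norm (density lborel (indicator S)) p g"
proof -
  have "S \<inter> space lebesgue \<in> sets lebesgue" using S by simp
  then have "AE x in lebesgue_on S. f x = g x"
    by (subst AE_restrict_space_iff) (use ae in \<open>auto simp: AE_completion_iff elim: eventually_mono\<close>)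
  moreover have "f \<in> borel_measurable (lebesgue_on S)"
    by (intro measurable_restrict_space1 borel_measurable_lebesgue_cong_AE[OF g ae])
  moreover have "g \<in> borel_measurable (lebesgue_on S)"
    using g by (intro measurable_restrict_space1 measurable_completion) simp
  ultimately have "Lp_norm (lebesgue_on S) p f = Lp_norm (lebesgue_on S) p g"
    by (intro Lp_norm_cong_AE)
  then show ?thesis by (simp only: Lp_norm_lebesgue_on_borel[OF S g])
qed

lemma forward_difference_funpow_cong_AE:
  fixes f g :: "'a::euclidean_space \<Rightarrow> complex"
  assumes "AE x in lborel. f x = g x"
  shows "AE x in lborel. (forward_difference h ^^ k) f x = (forward_difference h ^^ k) g x"
  using assms
proof (induction k)
  case (Suc k)
  then have ae: "AE x in lborel. (forward_difference h ^^ k) f x = (forward_difference h ^^ k) g x" by simp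
  show ?case
    using ae AE_lborel_translate[OF ae, of h]
    by eventually_elim
      (simp add: forward_difference_def[of h "(forward_difference h ^^ k) f"]
        forward_difference_def[of h "(forward_difference h ^^ k) g"])
qed simp

lemma forward_difference_funpow_measurable:
  fixes f :: "'a::euclidean_space \<Rightarrow> complex"
  assumes [measurable]: "f \<in> borel_measurable borel"
  shows "(forward_difference h ^^ k) f \<in> borel_measurable borel"
  unfolding funpow_forward_difference[abs_def] by measurable

lemma ball_average_cong_AE:
  fixes f g :: "'a::euclidean_space \<Rightarrow> complex"
  assumes g [measurable]: "g \<in> borel_measurable borel" and ae: "AE x in lborel. f x = g x"
  shows "ball_average t f x = ball_average t g x"
proof -
  have [measurable]: "f \<in> borel_measurable lebesgue" by (rule borel_measurable_lebesgue_cong_AE[OF g ae])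
  have [measurable]: "g \<in> borel_measurable lebesgue" using g by (intro measurable_completion) simp
  have "(\<integral>y. indicator (ball x t) y *\<^sub>R f y \<partial>lebesgue) = (\<integral>y. indicator (ball x t) y *\<^sub>R g y \<partial>lebesgue)"
  proof (rule integral_cong_AE)
    show "AE y in lebesgue. indicator (ball x t) y *\<^sub>R f y = indicator (ball x t) y *\<^sub>R g y"
      using ae by (auto simp: AE_completion_iff elim: eventually_mono)
  qed (intro borel_measurable_scaleR borel_measurable_indicator; simp)+
  then show ?thesis by (simp add: ball_average_def set_lebesgue_integral_def)
qed

text \<open>The norms are compared for each step \<open>h\<close> separately, so the null sets of
  uncountably many steps need never be united. Agreement is assumed on the whole space because
  translates leave \<open>S\<close>.\<close>

lemma besov_norm_lebesgue_on_cong_AE: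
  fixes f g :: "'a::euclidean_space \<Rightarrow> complex"
  assumes "S \<in> sets borel" "g \<in> borel_measurable borel" "AE x in lborel. f x = g x"
  shows "besov_norm (lebesgue_on S) k s b p q f = besov_norm (density lborel (indicator S)) k s b p q g"
proof -
  have "Lp_norm (lebesgue_on S) p ((forward_difference h ^^ k) f)
      = Lp_norm (density lborel (indicator S)) p ((forward_difference h ^^ k) g)" for h
    using assms
    by (intro Lp_norm_lebesgue_on_cong_AE forward_difference_funpow_cong_AE forward_difference_funpow_measurable)
  then have "modulus_of_smoothness (lebesgue_on S) k p f = modulus_of_smoothness (density lborel (indicator S)) k p g"
    by (simp add: modulus_of_smoothness_def fun_eq_iff)
  then show ?thesis
    using Lp_norm_lebesgue_on_cong_AE[OF assms, of p] by (simp add: besov_norm_def)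
qed

lemma ball_average_norm_lebesgue_on_cong_AE:
  fixes f g :: "'a::euclidean_space \<Rightarrow> complex"
  assumes "S \<in> sets borel" and g [measurable]: "g \<in> borel_measurable borel" and ae: "AE x in lborel. f x = g x"
  shows "ball_average_norm (lebesgue_on S) l s b p q f = ball_average_norm (density lborel (indicator S)) l s b p q g"
proof -
  have avg: "combined_ball_average l t f x = combined_ball_average l t g x" for t x
    unfolding combined_ball_average_def by (simp only: ball_average_cong_AE[OF g ae])
  have meas: "(\<lambda>x. g x - combined_ball_average l t g x) \<in> borel_measurable borel" if "0 < t" for t
  proof -
    have "combined_ball_average l t g x
        = (- 2 / real ((2 * l) choose l)) *\<^sub>R (\<Sum>j = 1..l. ((-1) ^ j * real ((2 * l) choose (l - j))) *\<^sub>R convolve (ball_kernel (real j * t)) g x)" for x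
      unfolding combined_ball_average_def using that
      by (intro arg_cong[where f = "\<lambda>z. _ *\<^sub>R z"] sum.cong refl) (simp add: ball_average_eq_convolve)
    then show ?thesis by simp
  qed
  have "Lp_norm (lebesgue_on S) p (\<lambda>x. f x - combined_ball_average l t f x)
      = Lp_norm (density lborel (indicator S)) p (\<lambda>x. g x - combined_ball_average l t g x)" if "0 < t" for t
    using assms(1) meas[OF that]
    by (rule Lp_norm_lebesgue_on_cong_AE) (use ae avg in \<open>auto elim: eventually_mono\<close>)
  then have "log_weighted_norm s b q (\<lambda>t. Lp_norm (lebesgue_on S) p (\<lambda>x. f x - combined_ball_average l t f x))
      = log_weighted_norm s b q (\<lambda>t. Lp_norm (density lborel (indicator S)) p (\<lambda>x. g x - combined_ball_average l t g x))"
    by (intro antisym log_weighted_norm_mono) simp_all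
  then show ?thesis
    using Lp_norm_lebesgue_on_cong_AE[OF assms, of p] by (simp only: ball_average_norm_def)
qed

text \<open>Fubini's theorem requires Borel functions; every class has a Borel representative, and
  neither norm depends on the representative.\<close>

lemma (in translation_setting) equivalent_on_lebesgue_on:
  assumes s: "0 \<le> s" "s < real k" "s < 2 * real l" and q: "0 < q"
    and A: "\<And>f. f \<in> A \<Longrightarrow> Lp_norm (lebesgue_on S) p f < top
      \<and> (\<exists>g\<in>borel_measurable borel. (\<forall>z\<in>Per. \<forall>x. g (x + z) = g x) \<and> (AE x in lborel. f x = g x))"
  shows "equivalent_on A (besov_norm (lebesgue_on S) k s b p q) (ball_average_norm (lebesgue_on S) l s b p q)"
proof -
  obtain C where C: "0 < C"
    "\<And>g. g \<in> F \<Longrightarrow> besov_norm M k s b p q g \<le> ennreal C * ball_average_norm M l s b p q g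
      \<and> ball_average_norm M l s b p q g \<le> ennreal C * besov_norm M k s b p q g"
    using besov_norm_M_equivalent[OF s q, of b] by blast
  have "ennreal (1 / C) * ball_average_norm (lebesgue_on S) l s b p q f \<le> besov_norm (lebesgue_on S) k s b p q f
    \<and> besov_norm (lebesgue_on S) k s b p q f \<le> ennreal C * ball_average_norm (lebesgue_on S) l s b p q f"
    if f: "f \<in> A" for f
  proof -
    obtain g where g: "g \<in> borel_measurable borel" "\<And>z x. z \<in> Per \<Longrightarrow> g (x + z) = g x" "AE x in lborel. f x = g x"
      and fin: "Lp_norm (lebesgue_on S) p f < top" using A[OF f] by blast
    have "g \<in> F"
      using g fin Lp_norm_lebesgue_on_cong_AE[OF S g(1,3), of p] by (simp add: F_def N_def M_def)
    note C' = C(2)[OF this]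
    have 1: "besov_norm (lebesgue_on S) k s b p q f = besov_norm M k s b p q g"
      unfolding M_def by (rule besov_norm_lebesgue_on_cong_AE[OF S g(1,3)])
    have 2: "ball_average_norm (lebesgue_on S) l s b p q f = ball_average_norm M l s b p q g"
      unfolding M_def by (rule ball_average_norm_lebesgue_on_cong_AE[OF S g(1,3)])
    have "ennreal (1 / C) * ball_average_norm M l s b p q g \<le> ennreal (1 / C) * (ennreal C * besov_norm M k s b p q g)"
      using C' by (intro mult_left_mono) auto
    also have "\<dots> = besov_norm M k s b p q g"
      using C(1) by (simp add: mult.assoc[symmetric] ennreal_mult[symmetric])
    finally show ?thesis using C' by (simp only: 1 2 simp_thms)
  qed
  then show ?thesis
    unfolding equivalent_on_def using C(1) by (intro exI[of _ "1 / C"] exI[of _ C]) auto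
qed

section \<open>Borel representatives and the periodic case\<close>

lemma ex_borel_representative:
  fixes f :: "'a::euclidean_space \<Rightarrow> complex"
  assumes [measurable]: "f \<in> borel_measurable lebesgue"
  obtains g where "g \<in> borel_measurable borel" "AE x in lborel. f x = g x"
proof -
  have "(\<lambda>x. Re (f x)) \<in> borel_measurable lebesgue" "(\<lambda>x. Im (f x)) \<in> borel_measurable lebesgue"
    by measurable
  then obtain u v where uv: "u \<in> borel_measurable lborel" "AE x in lborel. Re (f x) = u x"
      "v \<in> borel_measurable lborel" "AE x in lborel. Im (f x) = v x"
    using completion_ex_borel_measurable_real by metis
  have [measurable]: "u \<in> borel_measurable borel" "v \<in> borel_measurable borel" using uv by simp_all
  have "(\<lambda>x. Complex (u x) (v x)) = (\<lambda>x. complex_of_real (u x) + \<i> * complex_of_real (v x))"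
    by (simp add: fun_eq_iff Complex_eq)
  then have "(\<lambda>x. Complex (u x) (v x)) \<in> borel_measurable borel" by simp
  moreover have "AE x in lborel. f x = Complex (u x) (v x)"
    using uv(2,4) by eventually_elim (simp add: complex_eq_iff)
  ultimately show thesis by (rule that)
qed

definition reduce_period :: "real \<Rightarrow> real" where
  "reduce_period x = x - of_int \<lfloor>x / (2 * pi)\<rfloor> * (2 * pi)"

lemma borel_measurable_reduce_period [measurable]: "reduce_period \<in> borel_measurable borel"
  unfolding reduce_period_def by measurable

lemma reduce_period_in: "reduce_period x \<in> {0..<2 * pi}"
proof -
  have "of_int \<lfloor>x / (2 * pi)\<rfloor> \<le> x / (2 * pi)" "x / (2 * pi) < of_int \<lfloor>x / (2 * pi)\<rfloor> + 1"
    by linarith+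
  then have "of_int \<lfloor>x / (2 * pi)\<rfloor> * (2 * pi) \<le> x" "x < (of_int \<lfloor>x / (2 * pi)\<rfloor> + 1) * (2 * pi)"
    using pi_gt_zero by (simp_all only: pos_le_divide_eq pos_divide_less_eq mult_pos_pos zero_less_numeral)
  then show ?thesis by (simp add: reduce_period_def algebra_simps)
qed

lemma reduce_period_plus: "reduce_period (x + 2 * pi) = reduce_period x"
proof -
  have "(x + 2 * pi) / (2 * pi) = x / (2 * pi) + 1" using pi_gt_zero by (simp add: field_simps)
  then show ?thesis by (simp add: reduce_period_def algebra_simps)
qed

lemma periodic_reduce_period:
  assumes "\<And>x. f (x + 2 * pi) = f x"
  shows "f (x + reduce_period h) = f (x + h)"
proof -
  interpret periodic_fun_simple f "2 * pi" by unfold_locales (rule assms)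
  show ?thesis
    using minus_of_int[of "x + h" "\<lfloor>h / (2 * pi)\<rfloor>"] by (simp add: reduce_period_def algebra_simps)
qed

text \<open>After reducing \<open>h\<close> modulo the period, the window of integration is
  \<open>[r, r + 2 pi)\<close>; it is cut at \<open>2 pi\<close>, and the overhanging part is moved
  back by one period.\<close>

lemma nn_integral_period_translate:
  fixes g :: "real \<Rightarrow> ennreal"
  assumes [measurable]: "g \<in> borel_measurable borel" and per: "\<And>x. g (x + 2 * pi) = g x"
  shows "(\<integral>\<^sup>+ x\<in>{0..<2 * pi}. g (x + h) \<partial>lborel) = (\<integral>\<^sup>+ x\<in>{0..<2 * pi}. g x \<partial>lborel)"
proof -
  define r where "r = reduce_period h"
  have r: "0 \<le> r" "r < 2 * pi" using reduce_period_in[of h] by (simp_all add: r_def)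
  have "(\<integral>\<^sup>+ x\<in>{0..<2 * pi}. g (x + h) \<partial>lborel) = (\<integral>\<^sup>+ x. g (x + r) * indicator {r..<r + 2 * pi} (x + r) \<partial>lborel)"
    using periodic_reduce_period[of g, OF per, of _ h]
    by (intro nn_integral_cong) (auto simp: r_def indicator_def)
  also have "\<dots> = (\<integral>\<^sup>+ x. g x * indicator {r..<r + 2 * pi} x \<partial>lborel)"
    by (rule nn_integral_lborel_translate[where g = "\<lambda>x. g x * indicator {r..<r + 2 * pi} x"]) measurable
  also have "\<dots> = (\<integral>\<^sup>+ x. g x * indicator {r..<2 * pi} x + g x * indicator {2 * pi..<r + 2 * pi} x \<partial>lborel)"
    using r by (intro nn_integral_cong) (auto simp: indicator_def)
  also have "\<dots> = (\<integral>\<^sup>+ x. g x * indicator {r..<2 * pi} x \<partial>lborel) + (\<integral>\<^sup>+ x. g x * indicator {2 * pi..<r + 2 * pi} x \<partial>lborel)"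
    by (rule nn_integral_add) measurable
  also have "(\<integral>\<^sup>+ x. g x * indicator {2 * pi..<r + 2 * pi} x \<partial>lborel)
      = (\<integral>\<^sup>+ x. g (x + 2 * pi) * indicator {2 * pi..<r + 2 * pi} (x + 2 * pi) \<partial>lborel)"
    by (rule nn_integral_lborel_translate[where g = "\<lambda>x. g x * indicator {2 * pi..<r + 2 * pi} x", symmetric]) measurable
  also have "\<dots> = (\<integral>\<^sup>+ x. g x * indicator {0..<r} x \<partial>lborel)"
    using per by (intro nn_integral_cong) (auto simp: indicator_def)
  also have "(\<integral>\<^sup>+ x. g x * indicator {r..<2 * pi} x \<partial>lborel) + (\<integral>\<^sup>+ x. g x * indicator {0..<r} x \<partial>lborel)
      = (\<integral>\<^sup>+ x. g x * indicator {r..<2 * pi} x + g x * indicator {0..<r} x \<partial>lborel)"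
    by (rule nn_integral_add[symmetric]) measurable
  also have "\<dots> = (\<integral>\<^sup>+ x\<in>{0..<2 * pi}. g x \<partial>lborel)"
    using r by (intro nn_integral_cong) (auto simp: indicator_def)
  finally show ?thesis .
qed

text \<open>An arbitrary Borel representative need not be periodic. One is therefore chosen on a
  single period and extended by \<open>reduce_period\<close>.\<close>

lemma ex_periodic_borel_representative:
  fixes f :: "real \<Rightarrow> complex"
  assumes f: "f \<in> borel_measurable period_measure" and per: "\<And>x. f (x + 2 * pi) = f x"
  obtains g where "g \<in> borel_measurable borel" "\<And>x. g (x + 2 * pi) = g x" "AE x in lborel. f x = g x"
proof -
  define f0 where "f0 x = indicator {0..<2 * pi} x *\<^sub>R f x" for x
  have "f0 \<in> borel_measurable lebesgue"
    using f unfolding f0_def by (subst (asm) borel_measurable_restrict_space_iff) auto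
  then obtain g where g [measurable]: "g \<in> borel_measurable borel" and ae: "AE x in lborel. f0 x = g x"
    by (rule ex_borel_representative)
  \<comment> \<open>\<open>reduce_period x\<close> is one of countably many translates of
    \<open>x\<close>, so the exceptional set is covered by countably many translates of a null
    set.\<close>
  have "AE x in lborel. \<forall>n::int. f0 (x + - (of_int n * (2 * pi))) = g (x + - (of_int n * (2 * pi)))"
    using AE_lborel_translate[OF ae] by (simp only: AE_all_countable) blast
  then have "AE x in lborel. f x = g (reduce_period x)"
  proof (rule eventually_mono)
    fix x assume "\<forall>n::int. f0 (x + - (of_int n * (2 * pi))) = g (x + - (of_int n * (2 * pi)))"
    then have "f0 (reduce_period x) = g (reduce_period x)"
      unfolding reduce_period_def by (simp only: diff_conv_add_uminus)
    moreover have "f (reduce_period x) = f x" using periodic_reduce_period[of f, OF per, of 0 x] by simp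
    ultimately show "f x = g (reduce_period x)" using reduce_period_in[of x] by (simp add: f0_def)
  qed
  then show thesis
    by (intro that[of "\<lambda>x. g (reduce_period x)"]) (simp_all add: reduce_period_plus)
qed

theorem theorem10p6:
  fixes s b :: real and p q :: ennreal and k l :: nat
  assumes "0 \<le> s" and "1 \<le> p" and "0 < q"
    and "s < real k"
    and "s / 2 < real l"
  shows "equivalent_on (Lp_space (lebesgue :: (real ^ 'n) measure) p)
           (besov_norm lebesgue k s b p q) (ball_average_norm lebesgue l s b p q)
       \<and> equivalent_on (Lp_periodic p)
           (besov_norm period_measure k s b p q) (ball_average_norm period_measure l s b p q)"
proof
  have l: "s < 2 * real l" using assms(5) by simp
  interpret R: translation_setting "UNIV :: (real ^ 'n) set" "{}" p
  proof
    show "(\<integral>\<^sup>+ x\<in>UNIV. g (x + h) \<partial>lborel) = (\<integral>\<^sup>+ x\<in>UNIV. g x \<partial>lborel)"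
      if "g \<in> borel_measurable borel" for g :: "real ^ 'n \<Rightarrow> ennreal" and h
      using nn_integral_lborel_translate[OF that] by simp
  qed (use assms(2) in auto)
  have "equivalent_on (Lp_space lebesgue p)
      (besov_norm (lebesgue_on (UNIV :: (real ^ 'n) set)) k s b p q) (ball_average_norm (lebesgue_on UNIV) l s b p q)"
  proof (rule R.equivalent_on_lebesgue_on[OF assms(1,4) l assms(3)])
    fix f :: "real ^ 'n \<Rightarrow> complex" assume f: "f \<in> Lp_space lebesgue p"
    then obtain g where "g \<in> borel_measurable borel" "AE x in lborel. f x = g x"
      using ex_borel_representative[of f] by (auto simp: Lp_space_def)
    with f show "Lp_norm (lebesgue_on UNIV) p f < top
      \<and> (\<exists>g\<in>borel_measurable borel. (\<forall>z\<in>{}. \<forall>x. g (x + z) = g x) \<and> (AE x in lborel. f x = g x))"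
      by (auto simp: Lp_space_def lebesgue_on_UNIV_eq)
  qed
  then show "equivalent_on (Lp_space (lebesgue :: (real ^ 'n) measure) p)
      (besov_norm lebesgue k s b p q) (ball_average_norm lebesgue l s b p q)"
    by (simp only: lebesgue_on_UNIV_eq)
  interpret T: translation_setting "{0..<2 * pi} :: real set" "{2 * pi}" p
  proof
    show "(\<integral>\<^sup>+ x\<in>{0..<2 * pi}. g (x + h) \<partial>lborel) = (\<integral>\<^sup>+ x\<in>{0..<2 * pi}. g x \<partial>lborel)"
      if "g \<in> borel_measurable borel" "\<And>x z. z \<in> {2 * pi} \<Longrightarrow> g (x + z) = g x" for g :: "real \<Rightarrow> ennreal" and h
      using that by (intro nn_integral_period_translate) auto
  qed (use assms(2) in auto)
  show "equivalent_on (Lp_periodic p)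
      (besov_norm period_measure k s b p q) (ball_average_norm period_measure l s b p q)"
  proof (rule T.equivalent_on_lebesgue_on[OF assms(1,4) l assms(3)])
    fix f assume f: "f \<in> Lp_periodic p"
    then interpret periodic_fun_simple f "2 * pi" by (simp add: Lp_periodic_def)
    have "f \<in> borel_measurable period_measure" using f by (simp add: Lp_periodic_def Lp_space_def)
    then obtain g where "g \<in> borel_measurable borel" "\<And>x. g (x + 2 * pi) = g x" "AE x in lborel. f x = g x"
      using ex_periodic_borel_representative[of f] plus_1 by metis
    with f show "Lp_norm period_measure p f < top
      \<and> (\<exists>g\<in>borel_measurable borel. (\<forall>z\<in>{2 * pi}. \<forall>x. g (x + z) = g x) \<and> (AE x in lborel. f x = g x))"
      by (auto simp: Lp_periodic_def Lp_space_def)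
  qed
qed

end
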